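(* Let $\Omega\subset\mathbb{R}^n$ be open and bounded and $\Omega'\Subset\Omega$. Let $s\in(0,1)\setminus\{\frac12\}$ and $p\in(1,2]$. Let $f\in L^p(\Omega)$ and let $u\in L^p(\mathbb{R}^n)$ be a distributional solution of $(-\Delta)^su=f$ in $\Omega$. Then (the restriction of) $u$ belongs to $B^{2s,p,2}(\Omega')$ and $\|u\|_{B^{2s,p,2}(\Omega')}\le C\big(\|f\|_{L^p(\Omega)}+\|u\|_{L^p(\mathbb{R}^n)}\big)$ for some $C>0$ depending only on $n$, $p$, $s$, $\Omega$ and $\Omega'$.
   Context: $(-\Delta)^s\varphi:=\mathcal{F}^{-1}((2\pi|\xi|)^{2s}\widehat\varphi)$, $\widehat\varphi(\xi)=\int\varphi(x)e^{-2\pi ix\cdot\xi}dx$; distributional solution in $\Omega$: $\int_{\mathbb{R}^n}u(-\Delta)^s\varphi\,dx=\int_\Omega f\varphi\,dx$ for all $\varphi\in C^\infty_c(\Omega)$. Dyadic partition: fix $\varphi_0\in C^\infty_c(B_{19/10},[0,1])$ radial, radially nonincreasing, $\varphi_0=1$ on $B_{11/10}$; $\varphi_j(\xi):=\varphi_0(2^{-j}\xi)-\varphi_0(2^{-j+1}\xi)$ for $j\ge1$. For $\sigma>0$, $p,q\in[1,\infty)$, $B^{\sigma,p,q}(\mathbb{R}^n)$ is the set of $v\in L^p$ with $\|v\|_{B^{\sigma,p,q}(\mathbb{R}^n)}:=\big(\sum_{j\ge0}2^{j\sigma q}\|\check\varphi_j*v\|_{L^p}^q\big)^{1/q}<\infty$.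 $B^{\sigma,p,q}(\Omega')$ is the set of restrictions to $\Omega'$ of elements of $B^{\sigma,p,q}(\mathbb{R}^n)$, with $\|v\|_{B^{\sigma,p,q}(\Omega')}:=\inf\{\|\tilde v\|_{B^{\sigma,p,q}(\mathbb{R}^n)}:\tilde v=v\text{ in }\Omega'\}$. *)

theory Defs
  imports "HOL-Analysis.Analysis"
begin

fun iter_deriv :: "('a::real_normed_vector) list \<Rightarrow> ('a \<Rightarrow> real) \<Rightarrow> ('a \<Rightarrow> real)" where
  "iter_deriv [] g = g"
| "iter_deriv (v # vs) g = (\<lambda>x. frechet_derivative (iter_deriv vs g) (at x) v)"

definition smooth_fun :: "('a::real_normed_vector \<Rightarrow> real) \<Rightarrow> bool" where
  "smooth_fun g \<longleftrightarrow> (\<forall>vs x. iter_deriv vs g differentiable (at x))"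

definition fsupport :: "('a::topological_space \<Rightarrow> real) \<Rightarrow> 'a set" where
  "fsupport g = closure {x. g x \<noteq> 0}"

definition test_fun :: "('a::real_normed_vector) set \<Rightarrow> ('a \<Rightarrow> real) \<Rightarrow> bool" where
  "test_fun U g \<longleftrightarrow> smooth_fun g \<and> compact (fsupport g) \<and> fsupport g \<subseteq> U"

definition fourier :: "(real^'n::finite \<Rightarrow> complex) \<Rightarrow> real^'n \<Rightarrow> complex" where
  "fourier g \<xi> = (LINT x|lebesgue. g x * cis (- 2 * pi * (x \<bullet> \<xi>)))"

definition fourier_inv :: "(real^'n::finite \<Rightarrow> complex) \<Rightarrow> real^'n \<Rightarrow> complex" where
  "fourier_inv g x = (LINT \<xi>|lebesgue. g \<xi> * cis (2 * pi * (x \<bullet> \<xi>)))"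

definition frac_lap :: "real \<Rightarrow> (real^'n::finite \<Rightarrow> real) \<Rightarrow> real^'n \<Rightarrow> complex" where
  "frac_lap s \<phi> = fourier_inv (\<lambda>\<xi>. complex_of_real ((2 * pi * norm \<xi>) powr (2 * s))
                                      * fourier (\<lambda>x. complex_of_real (\<phi> x)) \<xi>)"

definition dist_solution :: "real \<Rightarrow> (real^'n::finite) set \<Rightarrow> (real^'n \<Rightarrow> real) \<Rightarrow> (real^'n \<Rightarrow> real) \<Rightarrow> bool" where
  "dist_solution s \<Omega> u f \<longleftrightarrow>
     (\<forall>\<phi>. test_fun \<Omega> \<phi> \<longrightarrow>
        (LINT x|lebesgue. complex_of_real (u x) * frac_lap s \<phi> x)
          = complex_of_real (LINT x:\<Omega>|lebesgue. f x * \<phi> x))"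

definition Lp_mem :: "real \<Rightarrow> ('a::euclidean_space) set \<Rightarrow> ('a \<Rightarrow> 'b::real_normed_vector) \<Rightarrow> bool" where
  "Lp_mem p S g \<longleftrightarrow> S \<in> sets lebesgue \<and> set_borel_measurable lebesgue S g
      \<and> set_integrable lebesgue S (\<lambda>x. norm (g x) powr p)"

definition Lp_norm :: "real \<Rightarrow> ('a::euclidean_space) set \<Rightarrow> ('a \<Rightarrow> 'b::real_normed_vector) \<Rightarrow> real" where
  "Lp_norm p S g = (LINT x:S|lebesgue. norm (g x) powr p) powr (1 / p)"

definition admissible_phi0 :: "(real^'n::finite \<Rightarrow> real) \<Rightarrow> bool" where
  "admissible_phi0 \<phi>0 \<longleftrightarrow> test_fun (ball 0 (19/10)) \<phi>0
     \<and> (\<forall>\<xi>. 0 \<le> \<phi>0 \<xi> \<and> \<phi>0 \<xi> \<le> 1)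
     \<and> (\<forall>\<xi> \<eta>. norm \<xi> = norm \<eta> \<longrightarrow> \<phi>0 \<xi> = \<phi>0 \<eta>)
     \<and> (\<forall>\<xi> \<eta>. norm \<xi> \<le> norm \<eta> \<longrightarrow> \<phi>0 \<eta> \<le> \<phi>0 \<xi>)
     \<and> (\<forall>\<xi>\<in>ball 0 (11/10). \<phi>0 \<xi> = 1)"

definition dyadic :: "(real^'n::finite \<Rightarrow> real) \<Rightarrow> nat \<Rightarrow> real^'n \<Rightarrow> real" where
  "dyadic \<phi>0 j \<xi> = (if j = 0 then \<phi>0 \<xi>
      else \<phi>0 ((2 powr - real j) *\<^sub>R \<xi>) - \<phi>0 ((2 powr (1 - real j)) *\<^sub>R \<xi>))"

definition dyadic_block :: "(real^'n::finite \<Rightarrow> real) \<Rightarrow> nat \<Rightarrow> (real^'n \<Rightarrow> real) \<Rightarrow> real^'n \<Rightarrow> complex" where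
  "dyadic_block \<phi>0 j v x =
     (LINT y|lebesgue. fourier_inv (\<lambda>\<xi>. complex_of_real (dyadic \<phi>0 j \<xi>)) (x - y) * complex_of_real (v y))"

definition besov_mem :: "(real^'n::finite \<Rightarrow> real) \<Rightarrow> real \<Rightarrow> real \<Rightarrow> real \<Rightarrow> (real^'n \<Rightarrow> real) \<Rightarrow> bool" where
  "besov_mem \<phi>0 \<sigma> p q v \<longleftrightarrow> Lp_mem p UNIV v
     \<and> (\<forall>j. Lp_mem p UNIV (dyadic_block \<phi>0 j v))
     \<and> summable (\<lambda>j. (2 powr (real j * \<sigma> * q)) * Lp_norm p UNIV (dyadic_block \<phi>0 j v) powr q)"

definition besov_norm :: "(real^'n::finite \<Rightarrow> real) \<Rightarrow> real \<Rightarrow> real \<Rightarrow> real \<Rightarrow> (real^'n \<Rightarrow> real) \<Rightarrow> real" where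
  "besov_norm \<phi>0 \<sigma> p q v =
     (\<Sum>j. (2 powr (real j * \<sigma> * q)) * Lp_norm p UNIV (dyadic_block \<phi>0 j v) powr q) powr (1 / q)"

definition besov_mem_on :: "(real^'n::finite \<Rightarrow> real) \<Rightarrow> real \<Rightarrow> real \<Rightarrow> real \<Rightarrow> (real^'n) set \<Rightarrow> (real^'n \<Rightarrow> real) \<Rightarrow> bool" where
  "besov_mem_on \<phi>0 \<sigma> p q U v \<longleftrightarrow>
     (\<exists>w. besov_mem \<phi>0 \<sigma> p q w \<and> (AE x in lebesgue. x \<in> U \<longrightarrow> w x = v x))"

definition besov_norm_on :: "(real^'n::finite \<Rightarrow> real) \<Rightarrow> real \<Rightarrow> real \<Rightarrow> real \<Rightarrow> (real^'n) set \<Rightarrow> (real^'n \<Rightarrow> real) \<Rightarrow> real" where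
  "besov_norm_on \<phi>0 \<sigma> p q U v =
     Inf {besov_norm \<phi>0 \<sigma> p q w | w. besov_mem \<phi>0 \<sigma> p q w \<and> (AE x in lebesgue. x \<in> U \<longrightarrow> w x = v x)}"

end

theory Submission
  imports Defs "HOL-Probability.Probability"
begin

text \<open>
  Fix a cutoff \<open>\<eta>\<close> that equals \<open>1\<close> on \<open>\<Omega>'\<close>. Testing the equation with \<open>\<eta>(y) A(t (x - y))\<close>, where
  \<open>A\<close> is a wave packet at frequency one and \<open>t = 2\<^sup>j\<close>, expresses the dyadic block of \<open>\<eta> u\<close>
  through a block of \<open>\<eta> f\<close> of size \<open>t\<^sup>-\<^sup>2\<^sup>s\<close>, first-order commutator terms of relative size \<open>1/t\<close>,
  which are blocks of \<open>(\<partial>\<eta>) u\<close> and can be treated by the same identity once more, and a remainder of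
  size \<open>t\<^sup>-\<^sup>2\<close>, which is negligible because \<open>s < 1\<close>. The remainder estimate decomposes
  \<open>|\<xi>|\<^sup>2\<^sup>s\<close> dyadically and Taylor expands \<open>\<eta>\<close> at \<open>y\<close> for high and at \<open>x\<close> for low frequencies.

  It remains to see that \<open>L\<^sup>p\<close> embeds into \<open>B\<^sup>0\<^sup>,\<^sup>p\<^sup>,\<^sup>2\<close> for \<open>1 < p \<le> 2\<close>. No singular integrals are
  needed: by uniform convexity of \<open>L\<^sup>p\<close>, averaging with a probability kernel at finer and finer
  scales loses a multiple of the squared norm of each increment, and these losses telescope.
\<close>

section \<open>Smooth functions\<close>

text \<open>The symbol |\<xi>|^(2s) is unbounded and in general not smooth at the origin, so
  \<open>frac_lap s\<close> is not convolution with an integrable kernel; only its dyadic pieces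
  are. The remainder is therefore bounded by one integrable function of \<open>x - y\<close>,
  assembled from majorants of the pieces, and Young's inequality does the rest. A piece at frequency
  \<open>c\<close> costs c^(2s-2) for large \<open>c\<close> and c^(2s) for small \<open>c\<close>,
  both summable because 0 < s < 1. The packet has symbol \<open>e\<close> divided by |2 pi
  \<xi>|^(2s), so that the operator returns exactly the block with symbol \<open>e\<close>. Symbols
  have definite parity because test functions are real-valued. One use of the identity leaves an
  error of size 1/t, which t^(2s) outweighs when s > 1/2; the second use leaves t^(-2). In the
  embedding, \<open>p \<le> 2\<close> gives a quadratic modulus of convexity and hence sums of
  squares. Coarse blocks survive the finer averagings only if the scales are far apart, by a factor
  \<open>2 ^ m\<close>, so the dyadic exponents are split into residue classes modulo
  \<open>m\<close>.\<close>

definition dd :: "('a::real_normed_vector \<Rightarrow> real) \<Rightarrow> 'a \<Rightarrow> 'a \<Rightarrow> real" where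
  "dd g v x = frechet_derivative g (at x) v"

lemma iter_deriv_Cons_dd: "iter_deriv (v # vs) g = dd (iter_deriv vs g) v"
  by (simp add: dd_def fun_eq_iff)

text \<open>Derivatives are taken along all lists of directions, so smoothness behaves
  coinductively: a set of differentiable functions that \<open>dd\<close> does not leave contains
  only smooth ones. The smoothness proofs below consist in finding such a set.\<close>

lemma smooth_fun_coinduct:
  assumes "g \<in> S"
    and "\<And>h x. h \<in> S \<Longrightarrow> h differentiable (at x)"
    and "\<And>h v. h \<in> S \<Longrightarrow> dd h v \<in> S"
  shows "smooth_fun g"
proof -
  have "iter_deriv vs g \<in> S" for vs
    by (induction vs) (use assms in \<open>auto simp: iter_deriv_Cons_dd simp del: iter_deriv.simps(2)\<close>)
  then show ?thesis
    using assms(2) by (auto simp: smooth_fun_def)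
qed

lemma smooth_fun_differentiable: "smooth_fun g \<Longrightarrow> g differentiable (at x)"
  unfolding smooth_fun_def by (metis iter_deriv.simps(1))

text \<open>In \<open>v # vs\<close> the head is applied last, so a derivative taken first sits at
  the end of the list. This is what makes \<open>dd g v\<close> smooth again.\<close>

lemma iter_deriv_append:
  "iter_deriv vs (dd g v) = iter_deriv (vs @ [v]) g"
  by (induction vs) (auto simp: dd_def)

lemma smooth_fun_frechet: "smooth_fun g \<Longrightarrow> smooth_fun (dd g v)"
  unfolding smooth_fun_def iter_deriv_append by blast

lemma dd_eqI: "(\<And>x. (g has_derivative g' x) (at x)) \<Longrightarrow> dd g v = (\<lambda>x. g' x v)"
proof
  fix x assume "\<And>x. (g has_derivative g' x) (at x)"
  then have "g' x = frechet_derivative g (at x)" by (intro frechet_derivative_at)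
  then show "dd g v x = g' x v" by (simp add: dd_def)
qed

lemma smooth_fun_has_derivative:
  "smooth_fun g \<Longrightarrow> (g has_derivative (\<lambda>v. dd g v x)) (at x)"
  unfolding dd_def using smooth_fun_differentiable frechet_derivative_works by blast

lemma smooth_fun_continuous_on: "smooth_fun g \<Longrightarrow> continuous_on A g"
  by (meson continuous_at_imp_continuous_on differentiable_imp_continuous_within smooth_fun_differentiable)

text \<open>The product rule turns a product into a sum of products, so the set of products is not
  closed under \<open>dd\<close>. The algebra generated by the smooth functions is, and it serves as
  the coinduction set.\<close>

inductive_set smooth_alg :: "('a::real_normed_vector \<Rightarrow> real) set" where
  base: "smooth_fun f \<Longrightarrow> f \<in> smooth_alg"
| add: "f \<in> smooth_alg \<Longrightarrow> g \<in> smooth_alg \<Longrightarrow> (\<lambda>x. f x + g x) \<in> smooth_alg"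
| mult: "f \<in> smooth_alg \<Longrightarrow> g \<in> smooth_alg \<Longrightarrow> (\<lambda>x. f x * g x) \<in> smooth_alg"

lemma smooth_alg_derivative:
  assumes "h \<in> smooth_alg"
  shows "\<exists>h'. (\<forall>x. (h has_derivative h' x) (at x)) \<and> (\<forall>v. (\<lambda>x. h' x v) \<in> smooth_alg)"
  using assms
proof induction
  case (base f)
  then show ?case
    by (intro exI[of _ "\<lambda>x v. dd f v x"])
       (auto intro: smooth_fun_has_derivative smooth_alg.base smooth_fun_frechet)
next
  case (add f g)
  then obtain f' g' where
    "\<forall>x. (f has_derivative f' x) (at x)" "\<forall>v. (\<lambda>x. f' x v) \<in> smooth_alg"
    "\<forall>x. (g has_derivative g' x) (at x)" "\<forall>v. (\<lambda>x. g' x v) \<in> smooth_alg" by blast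
  then show ?case
    by (intro exI[of _ "\<lambda>x v. f' x v + g' x v"])
       (auto intro!: has_derivative_add smooth_alg.add)
next
  case (mult f g)
  then obtain f' g' where
    "\<forall>x. (f has_derivative f' x) (at x)" "\<forall>v. (\<lambda>x. f' x v) \<in> smooth_alg"
    "\<forall>x. (g has_derivative g' x) (at x)" "\<forall>v. (\<lambda>x. g' x v) \<in> smooth_alg" by blast
  with mult.hyps show ?case
    by (intro exI[of _ "\<lambda>x v. f x * g' x v + f' x v * g x"])
       (auto intro!: has_derivative_mult smooth_alg.add smooth_alg.mult)
qed

lemma smooth_alg_smooth: "h \<in> smooth_alg \<Longrightarrow> smooth_fun h"
proof (rule smooth_fun_coinduct[of _ smooth_alg])
  fix h :: "'a \<Rightarrow> real" and v assume "h \<in> smooth_alg"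
  from smooth_alg_derivative[OF this] obtain h' where
    *: "\<And>x. (h has_derivative h' x) (at x)" "\<forall>v. (\<lambda>x. h' x v) \<in> smooth_alg" by blast
  then show "dd h v \<in> smooth_alg"
    by (subst dd_eqI[OF *(1)]) auto
  show "h differentiable (at x)" for x
    using *(1) differentiableI by blast
qed auto

lemma smooth_fun_add: "smooth_fun f \<Longrightarrow> smooth_fun g \<Longrightarrow> smooth_fun (\<lambda>x. f x + g x)"
  and smooth_fun_mult: "smooth_fun f \<Longrightarrow> smooth_fun g \<Longrightarrow> smooth_fun (\<lambda>x. f x * g x)"
  by (auto intro: smooth_alg_smooth smooth_alg.intros)

lemma smooth_fun_const: "smooth_fun (\<lambda>x. c)"
proof (rule smooth_fun_coinduct[of _ "range (\<lambda>c x. c)"])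
  fix h :: "'a \<Rightarrow> real" and v assume "h \<in> range (\<lambda>c x. c)"
  then obtain c where h: "h = (\<lambda>x. c)" by auto
  have "dd h v = (\<lambda>x. 0)" unfolding h by (rule dd_eqI) auto
  then show "dd h v \<in> range (\<lambda>c x. c)"
    by auto
qed auto

lemma smooth_fun_inner: "smooth_fun (\<lambda>x::'a::real_inner. x \<bullet> w)"
proof (rule smooth_fun_coinduct[of _ "{\<lambda>x. x \<bullet> w} \<union> range (\<lambda>c x. c)"])
  fix h :: "'a \<Rightarrow> real" and v assume "h \<in> {\<lambda>x. x \<bullet> w} \<union> range (\<lambda>c x. c)"
  moreover have "dd (\<lambda>x. x \<bullet> w) v = (\<lambda>x. v \<bullet> w)"
    by (rule dd_eqI) (auto intro!: derivative_eq_intros)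
  moreover have "dd (\<lambda>x. c) v = (\<lambda>x. 0)" for c
    by (rule dd_eqI) auto
  ultimately show "dd h v \<in> {\<lambda>x. x \<bullet> w} \<union> range (\<lambda>c x. c)"
    by auto
next
  fix h x assume "h \<in> {\<lambda>x::'a. x \<bullet> w} \<union> range (\<lambda>c x. c)"
  then show "h differentiable (at x)"
    by (auto intro: derivative_intros)
qed auto

lemma smooth_fun_cmult: "smooth_fun f \<Longrightarrow> smooth_fun (\<lambda>x. c * f x)"
  by (intro smooth_fun_mult smooth_fun_const)

lemma smooth_fun_diff: "smooth_fun f \<Longrightarrow> smooth_fun g \<Longrightarrow> smooth_fun (\<lambda>x. f x - g x)"
  using smooth_fun_add[of f "\<lambda>x. (-1) * g x"] smooth_fun_cmult[of g "-1"] by simp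

lemma smooth_fun_prod: "(\<And>i. i \<in> I \<Longrightarrow> smooth_fun (f i)) \<Longrightarrow> smooth_fun (\<lambda>x. \<Prod>i\<in>I. f i x)"
  by (induction I rule: infinite_finite_induct) (auto intro: smooth_fun_const smooth_fun_mult)

lemma has_derivative_affine_comp:
  assumes "smooth_fun g"
  shows "((\<lambda>x. g (c *\<^sub>R x + a)) has_derivative (\<lambda>v. dd g (c *\<^sub>R v) (c *\<^sub>R x + a))) (at x)"
  by (rule has_derivative_compose[where f = "\<lambda>x. c *\<^sub>R x + a" and f' = "\<lambda>v. c *\<^sub>R v", simplified])
     (auto intro!: derivative_eq_intros smooth_fun_has_derivative assms)

lemma dd_affine: "smooth_fun g \<Longrightarrow> dd (\<lambda>x. g (c *\<^sub>R x + a)) v = (\<lambda>x. dd g (c *\<^sub>R v) (c *\<^sub>R x + a))"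
  by (rule dd_eqI) (rule has_derivative_affine_comp)

lemma smooth_fun_affine:
  assumes "smooth_fun g"
  shows "smooth_fun (\<lambda>x. g (c *\<^sub>R x + a))"
proof (rule smooth_fun_coinduct[of _ "(\<lambda>h x. h (c *\<^sub>R x + a)) ` Collect smooth_fun"])
  fix h :: "'a \<Rightarrow> real" and v assume "h \<in> (\<lambda>h x. h (c *\<^sub>R x + a)) ` Collect smooth_fun"
  then obtain k where k: "smooth_fun k" "h = (\<lambda>x. k (c *\<^sub>R x + a))" by auto
  then show "dd h v \<in> (\<lambda>h x. h (c *\<^sub>R x + a)) ` Collect smooth_fun"
    using dd_affine[OF k(1), of c a v] smooth_fun_frechet[OF k(1)] by auto
  show "h differentiable (at x)" for x
    using has_derivative_affine_comp[OF k(1)] k(2) differentiableI by blast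
qed (use assms in auto)

lemma smooth_fun_scale: "smooth_fun g \<Longrightarrow> smooth_fun (\<lambda>x. g (c *\<^sub>R x))"
  using smooth_fun_affine[of g c 0] by simp

lemma smooth_fun_reflect: "smooth_fun g \<Longrightarrow> smooth_fun (\<lambda>x. g (a - x))"
  using smooth_fun_affine[of g "-1" a] by simp

lemma dd_linear: "smooth_fun g \<Longrightarrow> linear (\<lambda>v. dd g v x)"
  unfolding dd_def using linear_frechet_derivative[OF smooth_fun_differentiable] by fastforce

lemma dd_scale_dir: "smooth_fun g \<Longrightarrow> dd g (c *\<^sub>R v) x = c * dd g v x"
  using linear_cmul[OF dd_linear] by fastforce

lemma dd_scale: "smooth_fun g \<Longrightarrow> dd (\<lambda>x. g (c *\<^sub>R x)) v = (\<lambda>x. c * dd g v (c *\<^sub>R x))"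
  using dd_affine[of g c 0 v] by (auto simp: dd_scale_dir)

lemma dd_Basis:
  fixes g :: "'a::euclidean_space \<Rightarrow> real"
  assumes "smooth_fun g"
  shows "dd g v x = (\<Sum>b\<in>Basis. (v \<bullet> b) * dd g b x)"
proof -
  have l: "linear (\<lambda>v. dd g v x)"
    by (rule dd_linear[OF assms])
  have "dd g (\<Sum>b\<in>Basis. (v \<bullet> b) *\<^sub>R b) x = (\<Sum>b\<in>Basis. (v \<bullet> b) * dd g b x)"
    by (simp add: linear_sum[OF l] linear_cmul[OF l])
  then show ?thesis
    by (simp add: euclidean_representation)
qed

text \<open>Differentiating \<open>f x * norm x powr a\<close> lowers the exponent by two in one
  term, so no fixed exponent gives a set closed under \<open>dd\<close>. The vanishing of the
  coefficient near the origin passes to its derivative and to its product with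
  \<open>x \<bullet> v\<close>, and it hides the singularity of the norm.\<close>

inductive_set smooth_powr :: "('a::real_inner \<Rightarrow> real) set" where
  base: "smooth_fun f \<Longrightarrow> 0 < \<epsilon> \<Longrightarrow> (\<And>x. norm x < \<epsilon> \<Longrightarrow> f x = 0)
    \<Longrightarrow> (\<lambda>x. f x * norm x powr a) \<in> smooth_powr"
| add: "f \<in> smooth_powr \<Longrightarrow> g \<in> smooth_powr \<Longrightarrow> (\<lambda>x. f x + g x) \<in> smooth_powr"

lemma dd_vanish_nhd:
  assumes "\<And>x. norm x < \<epsilon> \<Longrightarrow> f x = 0" "norm x < \<epsilon>"
  shows "(f has_derivative (\<lambda>v. 0)) (at x)"
proof -
  have "((\<lambda>x. 0) has_derivative (\<lambda>v. 0)) (at x)" by simp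
  then show ?thesis
    by (rule has_derivative_transform_within_open[of _ _ _ _ "ball 0 \<epsilon>"]) (use assms in auto)
qed

lemma has_derivative_norm_powr:
  fixes x :: "'a::real_inner"
  assumes "x \<noteq> 0"
  shows "((\<lambda>x. norm x powr a) has_derivative (\<lambda>v. a * (x \<bullet> v) * norm x powr (a - 2))) (at x)"
proof -
  have n: "norm x > 0" using assms by simp
  have "norm x powr a * (0 * ln (norm x) + (v \<bullet> sgn x) * a / norm x) = a * (x \<bullet> v) * norm x powr (a - 2)" for v
    using n by (simp add: powr_diff power2_eq_square sgn_div_norm inner_commute field_simps)
  moreover have "((\<lambda>x. norm x powr a) has_derivative
     (\<lambda>v. norm x powr a * (0 * ln (norm x) + (v \<bullet> sgn x) * a / norm x))) (at x)"
    by (rule has_derivative_powr) (use assms in \<open>auto intro!: has_derivative_norm\<close>)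
  ultimately show ?thesis
    by simp
qed

lemma smooth_powr_derivative:
  assumes "h \<in> smooth_powr"
  shows "\<exists>h'. (\<forall>x. (h has_derivative h' x) (at x)) \<and> (\<forall>v. (\<lambda>x. h' x v) \<in> smooth_powr)"
  using assms
proof induction
  case (base f \<epsilon> a)
  define h' where "h' x v = dd f v x * norm x powr a + (f x * (a * (x \<bullet> v))) * norm x powr (a - 2)" for x v
  have z: "dd f v x = 0" if "norm x < \<epsilon>" for x v
  proof -
    have "(f has_derivative (\<lambda>v. 0)) (at x)"
      by (rule dd_vanish_nhd[OF base(3) that])
    from frechet_derivative_at[OF this, symmetric] show ?thesis by (simp add: dd_def)
  qed
  have "((\<lambda>x. f x * norm x powr a) has_derivative h' x) (at x)" for x
  proof (cases "x = 0")
    case True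
    then have "h' x = (\<lambda>v. 0)"
      using base(2) by (auto simp: h'_def)
    then show ?thesis
      using dd_vanish_nhd[of \<epsilon> "\<lambda>x. f x * norm x powr a" x] base True by auto
  next
    case False
    have "((\<lambda>x. f x * norm x powr a) has_derivative
      (\<lambda>v. f x * (a * (x \<bullet> v) * norm x powr (a - 2)) + dd f v x * norm x powr a)) (at x)"
      by (intro has_derivative_mult has_derivative_norm_powr False smooth_fun_has_derivative base)
    then show ?thesis
      unfolding h'_def by (simp add: algebra_simps)
  qed
  moreover have "(\<lambda>x. h' x v) \<in> smooth_powr" for v
    unfolding h'_def
  proof (rule smooth_powr.add; rule smooth_powr.base[of _ \<epsilon>])
    show "smooth_fun (\<lambda>x. f x * (a * (x \<bullet> v)))"
      by (intro smooth_fun_mult base smooth_fun_const smooth_fun_inner)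
  qed (use base z in \<open>auto intro: smooth_fun_frechet\<close>)
  ultimately show ?case by blast
next
  case (add f g)
  then obtain f' g' where
    "\<forall>x. (f has_derivative f' x) (at x)" "\<forall>v. (\<lambda>x. f' x v) \<in> smooth_powr"
    "\<forall>x. (g has_derivative g' x) (at x)" "\<forall>v. (\<lambda>x. g' x v) \<in> smooth_powr" by blast
  then show ?case
    by (intro exI[of _ "\<lambda>x v. f' x v + g' x v"])
       (auto intro!: has_derivative_add smooth_powr.add)
qed

lemma smooth_fun_norm_powr:
  fixes f :: "'a::real_inner \<Rightarrow> real"
  assumes "smooth_fun f" "0 < \<epsilon>" "\<And>x. norm x < \<epsilon> \<Longrightarrow> f x = 0"
  shows "smooth_fun (\<lambda>x. f x * norm x powr a)"
proof (rule smooth_fun_coinduct[of _ smooth_powr])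
  fix h :: "'a \<Rightarrow> real" and v assume "h \<in> smooth_powr"
  from smooth_powr_derivative[OF this] obtain h' where
    *: "\<And>x. (h has_derivative h' x) (at x)" "\<forall>v. (\<lambda>x. h' x v) \<in> smooth_powr" by blast
  then show "dd h v \<in> smooth_powr"
    by (subst dd_eqI[OF *(1)]) auto
  show "h differentiable (at x)" for x
    using *(1) differentiableI by blast
qed (use assms smooth_powr.base in auto)

subsection \<open>Test functions\<close>

abbreviation tf :: "('a::euclidean_space \<Rightarrow> real) \<Rightarrow> bool" where
  "tf \<equiv> test_fun UNIV"

lemma tf_smooth: "test_fun U f \<Longrightarrow> smooth_fun f"
  by (simp add: test_fun_def)

lemma tf_UNIV: "test_fun U f \<Longrightarrow> tf f"
  by (simp add: test_fun_def)

lemma fsupport_zero: "x \<notin> fsupport f \<Longrightarrow> f x = 0"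
  using closure_subset[of "{x. f x \<noteq> 0}"] by (auto simp: fsupport_def)

lemma fsupport_minimal: "closed S \<Longrightarrow> (\<And>x. f x \<noteq> 0 \<Longrightarrow> x \<in> S) \<Longrightarrow> fsupport f \<subseteq> S"
  unfolding fsupport_def by (rule closure_minimal) auto

lemma closed_fsupport: "closed (fsupport f)"
  by (simp add: fsupport_def)

lemma test_funI:
  fixes f :: "'a::real_normed_vector \<Rightarrow> real"
  assumes "smooth_fun f" "compact K" "K \<subseteq> U" "\<And>x. x \<notin> K \<Longrightarrow> f x = 0"
  shows "test_fun U f"
proof -
  have "fsupport f \<subseteq> K"
    using fsupport_minimal[of K f] assms by (auto simp: compact_imp_closed)
  moreover have "compact (fsupport f)"
    using compact_Int_closed[OF assms(2) closed_fsupport[of f]] calculation by (simp add: inf.absorb2)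
  ultimately show ?thesis
    using assms by (auto simp: test_fun_def)
qed

text \<open>The complement of the closed support is open. Hence disjointness of spectra is later
  phrased with \<open>fsupport\<close>: it removes the derivative of a symbol along with the
  symbol.\<close>

lemma dd_zero_outside:
  assumes "x \<notin> fsupport f"
  shows "dd f v x = 0"
proof -
  have "((\<lambda>x. 0) has_derivative (\<lambda>v. 0)) (at x)" by simp
  then have "(f has_derivative (\<lambda>v. 0)) (at x)"
    by (rule has_derivative_transform_within_open[of _ _ _ _ "- fsupport f"])
       (use assms in \<open>auto simp: closed_fsupport fsupport_zero\<close>)
  then show ?thesis by (simp add: dd_def frechet_derivative_at[symmetric])
qed

lemma test_fun_dd: "test_fun U f \<Longrightarrow> test_fun U (dd f v)"
  by (rule test_funI[of _ "fsupport f"])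
     (auto simp: test_fun_def intro: smooth_fun_frechet dd_zero_outside)

lemma test_fun_mult: "test_fun U f \<Longrightarrow> smooth_fun g \<Longrightarrow> test_fun U (\<lambda>x. f x * g x)"
  by (rule test_funI[of _ "fsupport f"])
     (auto simp: test_fun_def intro: smooth_fun_mult dest: fsupport_zero)

lemma test_fun_diff: "test_fun U f \<Longrightarrow> test_fun U g \<Longrightarrow> test_fun U (\<lambda>x. f x - g x)"
  by (rule test_funI[of _ "fsupport f \<union> fsupport g"])
     (auto simp: test_fun_def fsupport_zero intro: smooth_fun_diff compact_Un)

lemma tf_scale:
  fixes f :: "'a::euclidean_space \<Rightarrow> real"
  assumes "tf f" "c \<noteq> 0"
  shows "tf (\<lambda>x. f (c *\<^sub>R x))"
proof (rule test_funI[of _ "(\<lambda>x. (1/c) *\<^sub>R x) ` fsupport f"])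
  show "smooth_fun (\<lambda>x. f (c *\<^sub>R x))" using assms tf_smooth smooth_fun_scale by blast
  show "compact ((*\<^sub>R) (1 / c) ` fsupport f)"
    using assms by (auto intro: compact_scaling simp: test_fun_def)
  show "f (c *\<^sub>R x) = 0" if "x \<notin> (*\<^sub>R) (1 / c) ` fsupport f" for x
  proof -
    have "c *\<^sub>R x \<notin> fsupport f"
    proof
      assume "c *\<^sub>R x \<in> fsupport f"
      then have "(1 / c) *\<^sub>R (c *\<^sub>R x) \<in> (*\<^sub>R) (1 / c) ` fsupport f" by blast
      then show False using that assms by simp
    qed
    then show ?thesis by (rule fsupport_zero)
  qed
qed auto

lemma tf_bounded:
  fixes f :: "'a::euclidean_space \<Rightarrow> real"
  assumes "tf f"
  obtains B where "B \<ge> 0" "\<And>x. \<bar>f x\<bar> \<le> B"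
proof -
  have c: "compact (fsupport f)" using assms by (simp add: test_fun_def)
  have "bounded (f ` fsupport f)"
    by (intro compact_imp_bounded compact_continuous_image c smooth_fun_continuous_on tf_smooth[OF assms])
  then obtain B where B: "\<And>x. x \<in> fsupport f \<Longrightarrow> \<bar>f x\<bar> \<le> B"
    by (auto simp: bounded_iff)
  have "\<bar>f x\<bar> \<le> max B 0" for x
    using B[of x] fsupport_zero[of x f] by (cases "x \<in> fsupport f") auto
  then show ?thesis using that[of "max B 0"] by auto
qed

lemma tf_vanish:
  fixes f :: "'a::euclidean_space \<Rightarrow> real"
  assumes "tf f"
  obtains R where "R > 0" "\<And>x. norm x > R \<Longrightarrow> f x = 0"
proof -
  have "bounded (fsupport f)" using assms compact_imp_bounded by (auto simp: test_fun_def)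
  then obtain R where R: "R > 0" "\<And>x. x \<in> fsupport f \<Longrightarrow> norm x \<le> R" by (meson bounded_pos)
  then show ?thesis using that[of R] fsupport_zero[of _ f] by (metis not_less)
qed

lemma tf_measurable: "tf f \<Longrightarrow> f \<in> borel_measurable borel"
  by (intro borel_measurable_continuous_onI smooth_fun_continuous_on tf_smooth)

lemma tf_integrable:
  fixes f :: "'a::euclidean_space \<Rightarrow> real"
  assumes "tf f"
  shows "integrable lborel f"
proof -
  have "integrable lborel (\<lambda>x. indicator (fsupport f) x *\<^sub>R f x)"
    by (rule borel_integrable_compact) (use assms in \<open>auto simp: test_fun_def intro: smooth_fun_continuous_on\<close>)
  moreover have "(\<lambda>x. indicator (fsupport f) x *\<^sub>R f x) = f"
    using fsupport_zero[of _ f] by (auto simp: indicator_def fun_eq_iff)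
  ultimately show ?thesis by simp
qed

section \<open>Mean value and Taylor estimates along lines, and cutoff functions\<close>

lemma smooth_fun_line:
  assumes f: "smooth_fun f"
  shows "((\<lambda>t. f (y + t *\<^sub>R v)) has_real_derivative dd f v (y + t *\<^sub>R v)) (at t)"
proof -
  have "((\<lambda>t. f (y + t *\<^sub>R v)) has_derivative (\<lambda>h. dd f (h *\<^sub>R v) (y + t *\<^sub>R v))) (at t)"
    by (rule has_derivative_compose[of "\<lambda>t. y + t *\<^sub>R v" "\<lambda>h. h *\<^sub>R v"])
       (auto intro!: derivative_eq_intros smooth_fun_has_derivative f)
  then show ?thesis by (simp add: has_field_derivative_def dd_scale_dir[OF f] mult.commute[of _ "dd f v _"])
qed

lemma smooth_fun_line_bound:
  assumes f: "smooth_fun f" and B: "\<And>x. \<bar>dd f v x\<bar> \<le> B" and t: "t > 0"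
  shows "\<bar>f (y + t *\<^sub>R v) - f y\<bar> \<le> t * B"
proof -
  obtain z where "f (y + t *\<^sub>R v) - f (y + 0 *\<^sub>R v) = (t - 0) * dd f v (y + z *\<^sub>R v)"
    using MVT2[of 0 t "\<lambda>t. f (y + t *\<^sub>R v)" "\<lambda>t. dd f v (y + t *\<^sub>R v)"] smooth_fun_line[OF f] t by auto
  then show ?thesis using B[of "y + z *\<^sub>R v"] t by (simp add: abs_mult)
qed

text \<open>The mean value theorem is applied twice along the segment from \<open>y\<close> to
  \<open>y - w\<close>. The square of the dimension comes from expanding the second derivative in
  the basis, and the first-order sum has a plus sign because the displacement is
  \<open>- w\<close>.\<close>

lemma taylor_second:
  fixes f :: "'a::euclidean_space \<Rightarrow> real"
  assumes f: "smooth_fun f" and B: "\<And>b c x. b \<in> Basis \<Longrightarrow> c \<in> Basis \<Longrightarrow> \<bar>dd (dd f b) c x\<bar> \<le> B"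
  shows "\<bar>f (y - w) - f y + (\<Sum>b\<in>Basis. (w \<bullet> b) * dd f b y)\<bar> \<le> real (DIM('a))^2 * B * (norm w)\<^sup>2"
proof -
  \<comment> \<open>\<open>B\<close> bounds absolute values and is therefore nonnegative, once there
    is a basis vector to speak of.\<close>
  obtain b0 :: 'a where "b0 \<in> Basis" using nonempty_Basis by blast
  then have B0: "B \<ge> 0" using B[of b0 b0 0] by linarith
  define v where "v = - w"
  have sv: "smooth_fun (dd f v)" by (rule smooth_fun_frechet[OF f])
  have D2: "\<bar>dd (dd f v) v x\<bar> \<le> real (DIM('a))^2 * B * (norm w)\<^sup>2" for x
  proof -
    have e: "dd (dd f v) v x = (\<Sum>c\<in>Basis. \<Sum>b\<in>Basis. (v \<bullet> c) * ((v \<bullet> b) * dd (dd f b) c x))"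
    proof -
      have "dd f v = (\<lambda>x. \<Sum>b\<in>Basis. (v \<bullet> b) * dd f b x)"
        using dd_Basis[OF f] by blast
      moreover have "dd (\<lambda>x. \<Sum>b\<in>Basis. (v \<bullet> b) * dd f b x) c = (\<lambda>x. \<Sum>b\<in>Basis. (v \<bullet> b) * dd (dd f b) c x)" for c
        by (rule dd_eqI) (intro has_derivative_sum has_derivative_mult_right smooth_fun_has_derivative smooth_fun_frechet f)
      ultimately show ?thesis
        using dd_Basis[OF sv, of v x] by (simp add: sum_distrib_left)
    qed
    have "\<bar>dd (dd f v) v x\<bar> \<le> (\<Sum>c\<in>(Basis::'a set). \<Sum>b\<in>(Basis::'a set). norm w * (norm w * B))"
      unfolding e
    proof (intro order.trans[OF sum_abs] sum_mono)
      fix c b :: 'a assume cb: "c \<in> Basis" "b \<in> Basis"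
      have "\<bar>v \<bullet> c\<bar> \<le> norm w" "\<bar>v \<bullet> b\<bar> \<le> norm w"
        using Basis_le_norm[OF cb(1), of v] Basis_le_norm[OF cb(2), of v] by (auto simp: v_def)
      then show "\<bar>(v \<bullet> c) * ((v \<bullet> b) * dd (dd f b) c x)\<bar> \<le> norm w * (norm w * B)"
        unfolding abs_mult using B[OF cb(2,1)] B0 by (intro mult_mono) auto
    qed
    then show ?thesis by (simp add: power2_eq_square mult_ac)
  qed
  obtain z where z: "0 < z" "z < 1" "f (y + 1 *\<^sub>R v) - f (y + 0 *\<^sub>R v) = (1 - 0) * dd f v (y + z *\<^sub>R v)"
    using MVT2[of 0 1 "\<lambda>t. f (y + t *\<^sub>R v)" "\<lambda>t. dd f v (y + t *\<^sub>R v)"]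
      smooth_fun_line[OF f] by auto
  obtain z' where z': "0 < z'" "z' < z" "dd f v (y + z *\<^sub>R v) - dd f v (y + 0 *\<^sub>R v) = (z - 0) * dd (dd f v) v (y + z' *\<^sub>R v)"
    using MVT2[of 0 z "\<lambda>t. dd f v (y + t *\<^sub>R v)" "\<lambda>t. dd (dd f v) v (y + t *\<^sub>R v)"]
      smooth_fun_line[OF sv] z by auto
  have "dd f v y = - (\<Sum>b\<in>Basis. (w \<bullet> b) * dd f b y)"
    unfolding dd_Basis[OF f, of v] by (simp add: v_def sum_negf)
  then have "f (y - w) - f y + (\<Sum>b\<in>Basis. (w \<bullet> b) * dd f b y) = z * dd (dd f v) v (y + z' *\<^sub>R v)"
    using z(3) z'(3) by (simp add: v_def)
  moreover have "\<bar>z * dd (dd f v) v (y + z' *\<^sub>R v)\<bar> \<le> 1 * (real (DIM('a))^2 * B * (norm w)\<^sup>2)"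
    unfolding abs_mult by (intro mult_mono D2) (use z B0 in auto)
  ultimately show ?thesis by simp
qed

text \<open>\<open>\<phi>0\<close> itself supplies the bumps: recentred and scaled to radius
  \<open>r c\<close> it is 1 on the ball, as 11/10 > 1, and 0 outside the doubled ball, as 19/10 <
  2. One minus the product of the complements is 1 wherever a single bump is, so a finite cover of
  \<open>K\<close> suffices.\<close>

lemma cutoff_exists:
  fixes \<phi>0 :: "real^'n::finite \<Rightarrow> real" and U K :: "(real^'n) set"
  assumes \<phi>0: "admissible_phi0 \<phi>0" and "open U" "compact K" "K \<subseteq> U"
  obtains \<eta> where "test_fun U \<eta>" "\<And>x. x \<in> K \<Longrightarrow> \<eta> x = 1"
proof -
  have "\<exists>r>0. cball x (2 * r) \<subseteq> U" if x: "x \<in> K" for x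
  proof -
    obtain e where "e > 0" "cball x e \<subseteq> U"
      using x assms(2,4) unfolding open_contains_cball by blast
    then show ?thesis by (intro exI[of _ "e/2"]) auto
  qed
  then obtain r where r: "\<And>x. x \<in> K \<Longrightarrow> r x > 0 \<and> cball x (2 * r x) \<subseteq> U" by metis
  define \<psi> where "\<psi> c x = \<phi>0 ((1 / r c) *\<^sub>R (x - c))" for c x
  have "K \<subseteq> (\<Union>c\<in>K. ball c (r c))" using r by force
  then obtain D where D: "D \<subseteq> K" "finite D" "K \<subseteq> (\<Union>c\<in>D. ball c (r c))"
    using compactE_image[OF \<open>compact K\<close>, of K "\<lambda>c. ball c (r c)"] by (metis open_ball)
  have sm: "smooth_fun (\<psi> c)" for c
  proof -
    have "smooth_fun \<phi>0" using \<phi>0 by (simp only: admissible_phi0_def test_fun_def)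
    from smooth_fun_affine[OF this, of "1 / r c" "- (1 / r c) *\<^sub>R c"] show ?thesis
      unfolding \<psi>_def by (simp add: scaleR_diff_right)
  qed
  have one: "\<psi> c x = 1" if "c \<in> K" "x \<in> ball c (r c)" for c x
  proof -
    have "norm ((1 / r c) *\<^sub>R (x - c)) < 11/10"
    proof -
      have "r c > 0" "norm (x - c) < r c"
        using r[OF that(1)] that(2) by (auto simp: dist_norm norm_minus_commute)
      then show ?thesis by (simp add: divide_less_eq)
    qed
    then have "(1 / r c) *\<^sub>R (x - c) \<in> ball 0 (11/10)" by simp
    then show ?thesis using \<phi>0 unfolding \<psi>_def admissible_phi0_def by blast
  qed
  have zero: "\<psi> c x = 0" if "c \<in> K" "x \<notin> cball c (2 * r c)" for c x
  proof (rule ccontr)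
    assume "\<psi> c x \<noteq> 0"
    then have "(1 / r c) *\<^sub>R (x - c) \<in> fsupport \<phi>0" using fsupport_zero unfolding \<psi>_def by blast
    then have "(1 / r c) *\<^sub>R (x - c) \<in> ball 0 (19/10)" using \<phi>0 unfolding admissible_phi0_def test_fun_def by blast
    then have "norm (x - c) / r c < 19/10" using r[OF that(1)] by simp
    then have "norm (x - c) < 19/10 * r c" using r[OF that(1)] by (simp add: divide_simps)
    then show False using that r[OF that(1)] by (auto simp: dist_norm norm_minus_commute)
  qed
  define \<eta> where "\<eta> x = 1 - (\<Prod>c\<in>D. 1 - \<psi> c x)" for x
  show thesis
  proof
    show "test_fun U \<eta>"
    proof (rule test_funI[of _ "\<Union>c\<in>D. cball c (2 * r c)"])
      show "smooth_fun \<eta>" unfolding \<eta>_def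
        by (intro smooth_fun_diff smooth_fun_prod smooth_fun_const sm)
      show "compact (\<Union>c\<in>D. cball c (2 * r c))" using D by (intro compact_UN) auto
      show "(\<Union>c\<in>D. cball c (2 * r c)) \<subseteq> U" using D r by blast
      show "\<eta> x = 0" if "x \<notin> (\<Union>c\<in>D. cball c (2 * r c))" for x
        unfolding \<eta>_def using that zero D by (subst prod.neutral) auto
    qed
    show "\<eta> x = 1" if xK: "x \<in> K" for x
    proof -
      obtain c where c: "c \<in> D" "x \<in> ball c (r c)" using D xK by blast
      then have "(\<Prod>c\<in>D. 1 - \<psi> c x) = 0"
        using D one[of c x] by (intro prod_zero) (auto intro!: bexI[of _ c])
      then show ?thesis by (simp add: \<eta>_def)
    qed
  qed
qed

section \<open>Fourier transforms of test functions\<close>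

abbreviation cx :: "real \<Rightarrow> complex" where
  "cx \<equiv> complex_of_real"

section \<open>Affine substitution, and the transforms of Borel functions\<close>

lemma lborel_integral_affine:
  fixes f :: "real^'n::finite \<Rightarrow> 'b::{banach, second_countable_topology}"
  assumes [measurable]: "f \<in> borel_measurable borel" and c: "c \<noteq> 0"
  shows "(LBINT x. f x) = (\<bar>c\<bar> ^ CARD('n)) *\<^sub>R (LBINT x. f (t + c *\<^sub>R x))"
  by (subst lborel_affine[OF c, of t]) (simp add: integral_density integral_distr)

lemma lborel_integrable_affine:
  fixes f :: "real^'n::finite \<Rightarrow> 'b::{banach, second_countable_topology}"
  assumes [measurable]: "f \<in> borel_measurable borel" and c: "c \<noteq> 0"
  shows "integrable lborel (\<lambda>x. f (t + c *\<^sub>R x)) \<longleftrightarrow> integrable lborel f"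
proof -
  have "integrable lborel f \<longleftrightarrow> integrable (density (distr lborel borel (\<lambda>x. t + c *\<^sub>R x)) (\<lambda>_. \<bar>c\<bar> ^ DIM(real^'n))) f"
    by (subst lborel_affine[OF c, of t]) simp
  also have "\<dots> \<longleftrightarrow> integrable lborel (\<lambda>x. f (t + c *\<^sub>R x))"
  proof -
    have "integrable lborel (\<lambda>x. f (t + c *\<^sub>R x))" if "integrable lborel (\<lambda>x. \<bar>c\<bar> ^ CARD('n) *\<^sub>R f (t + c *\<^sub>R x))"
      using integrable_scaleR_right[OF that, of "1 / \<bar>c\<bar> ^ CARD('n)"] c by simp
    then show ?thesis
      using c by (auto simp: integrable_density integrable_distr_eq)
  qed
  finally show ?thesis by simp
qed

lemma lborel_nn_integral_affine:
  fixes f :: "real^'n::finite \<Rightarrow> ennreal"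
  assumes [measurable]: "f \<in> borel_measurable borel" and c: "c \<noteq> 0"
  shows "(\<integral>\<^sup>+x. f x \<partial>lborel) = ennreal (\<bar>c\<bar> ^ CARD('n)) * (\<integral>\<^sup>+x. f (t + c *\<^sub>R x) \<partial>lborel)"
  by (subst lborel_affine[OF c, of t]) (simp add: nn_integral_density nn_integral_distr nn_integral_cmult)

lemma lborel_integral_translate:
  fixes f :: "real^'n::finite \<Rightarrow> 'b::{banach, second_countable_topology}"
  assumes "f \<in> borel_measurable borel"
  shows "(LBINT x. f (x + t)) = (LBINT x. f x)"
    and "(LBINT x. f (t + x)) = (LBINT x. f x)"
    and "(LBINT x. f (t - x)) = (LBINT x. f x)"
  using lborel_integral_affine[OF assms, of 1 t] lborel_integral_affine[OF assms, of "-1" t]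
  by (auto simp: add.commute)

lemma lborel_integrable_translate:
  fixes f :: "real^'n::finite \<Rightarrow> 'b::{banach, second_countable_topology}"
  assumes "f \<in> borel_measurable borel"
  shows "integrable lborel (\<lambda>x. f (x + t)) \<longleftrightarrow> integrable lborel f"
    and "integrable lborel (\<lambda>x. f (t + x)) \<longleftrightarrow> integrable lborel f"
    and "integrable lborel (\<lambda>x. f (t - x)) \<longleftrightarrow> integrable lborel f"
  using lborel_integrable_affine[OF assms, of 1 t] lborel_integrable_affine[OF assms, of "-1" t]
  by (auto simp: add.commute)

lemma cis_measurable[measurable]: "cis \<in> borel_measurable borel"
  by (intro borel_measurable_continuous_onI continuous_intros)

lemma fourier_inv_lborel:
  assumes [measurable]: "g \<in> borel_measurable borel"
  shows "fourier_inv g x = (LBINT \<xi>. g \<xi> * cis (2 * pi * (x \<bullet> \<xi>)))"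
  unfolding fourier_inv_def by (subst integral_completion) auto

lemma fourier_lborel:
  assumes [measurable]: "g \<in> borel_measurable borel"
  shows "fourier g x = (LBINT \<xi>. g \<xi> * cis (- 2 * pi * (\<xi> \<bullet> x)))"
  unfolding fourier_def by (subst integral_completion) auto

lemma fourier_eq_inv:
  assumes [measurable]: "g \<in> borel_measurable borel"
  shows "fourier g x = fourier_inv g (- x)"
  by (simp add: fourier_inv_lborel fourier_lborel inner_commute)

text \<open>The symbols of all convolution operators below are real, and by
  \<open>fourier_eq_inv\<close> the forward transform of a Borel function is the reflected inverse
  one, so this single transform suffices.\<close>

definition finv :: "(real^'n::finite \<Rightarrow> real) \<Rightarrow> real^'n \<Rightarrow> complex" where
  "finv m = fourier_inv (\<lambda>\<xi>. cx (m \<xi>))"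

lemma finv_integrable:
  assumes "integrable lborel m"
  shows "integrable lborel (\<lambda>\<xi>. cx (m \<xi>) * cis (2 * pi * (x \<bullet> \<xi>)))"
proof (rule Bochner_Integration.integrable_bound[OF assms])
  have [measurable]: "m \<in> borel_measurable borel" using assms by (auto dest: borel_measurable_integrable)
  show "(\<lambda>\<xi>. cx (m \<xi>) * cis (2 * pi * (x \<bullet> \<xi>))) \<in> borel_measurable lborel" by measurable
qed (simp add: norm_mult)

lemma finv_lborel:
  assumes "integrable lborel m"
  shows "finv m x = (LBINT \<xi>. cx (m \<xi>) * cis (2 * pi * (x \<bullet> \<xi>)))"
  unfolding finv_def using assms by (intro fourier_inv_lborel) (auto dest: borel_measurable_integrable)

lemma finv_bound:
  assumes "integrable lborel m"
  shows "norm (finv m x) \<le> (LBINT \<xi>. \<bar>m \<xi>\<bar>)"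
  unfolding finv_lborel[OF assms] by (rule integral_norm_bound[THEN order_trans]) (simp add: norm_mult)

lemma finv_add:
  "integrable lborel m \<Longrightarrow> integrable lborel q \<Longrightarrow> finv (\<lambda>\<xi>. m \<xi> + q \<xi>) x = finv m x + finv q x"
  using finv_integrable[of m x] finv_integrable[of q x]
  by (simp add: finv_lborel ring_distribs)

lemma finv_cmult: "integrable lborel m \<Longrightarrow> finv (\<lambda>\<xi>. c * m \<xi>) x = cx c * finv m x"
  by (simp add: finv_lborel mult.assoc)

lemma finv_zero: "(\<And>\<xi>. m \<xi> = 0) \<Longrightarrow> finv m x = 0"
  by (simp add: finv_def fourier_inv_def)

lemma finv_reflect:
  assumes "integrable lborel m"
  shows "finv (\<lambda>\<xi>. m (- \<xi>)) x = finv m (- x)"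
proof -
  have [measurable]: "m \<in> borel_measurable borel" using assms by (auto dest: borel_measurable_integrable)
  have "integrable lborel (\<lambda>\<xi>. m (- \<xi>))"
    using lborel_integrable_translate(3)[of m 0] assms by simp
  then show ?thesis
    using lborel_integral_translate(3)[of "\<lambda>\<xi>. cx (m \<xi>) * cis (2 * pi * (- x \<bullet> \<xi>))" 0]
    by (simp add: finv_lborel assms)
qed

text \<open>Normalised to preserve integrals and \<open>L\<^sup>1\<close> norms for positive
  \<open>c\<close>. On the frequency side it stretches the symbol by \<open>c\<close>, as
  \<open>finv_dil\<close> records.\<close>

definition dil :: "real \<Rightarrow> (real^'n::finite \<Rightarrow> 'b::real_vector) \<Rightarrow> real^'n \<Rightarrow> 'b" where
  "dil c K x = c ^ CARD('n) *\<^sub>R K (c *\<^sub>R x)"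

lemma finv_dil:
  fixes m :: "real^'n::finite \<Rightarrow> real"
  assumes "integrable lborel m" "c > 0"
  shows "finv (\<lambda>\<xi>. m ((1/c) *\<^sub>R \<xi>)) = dil c (finv m)"
proof
  fix x
  have [measurable]: "m \<in> borel_measurable borel" using assms by (auto dest: borel_measurable_integrable)
  have i: "integrable lborel (\<lambda>\<xi>. m ((1/c) *\<^sub>R \<xi>))"
    using lborel_integrable_affine[of m "1/c" 0] assms by simp
  show "finv (\<lambda>\<xi>. m ((1/c) *\<^sub>R \<xi>)) x = dil c (finv m) x"
    using lborel_integral_affine[of "\<lambda>\<xi>. cx (m ((1/c) *\<^sub>R \<xi>)) * cis (2 * pi * (x \<bullet> \<xi>))" c 0] assms
    by (simp add: finv_lborel i dil_def)
qed

subsection \<open>Decay and differentiation\<close>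

text \<open>The quotients run along a sequence of steps because dominated convergence is applied to
  them.\<close>

lemma tendsto_dd:
  assumes "smooth_fun f"
  shows "(\<lambda>k. (f (x + (1 / real (Suc k)) *\<^sub>R v) - f x) * real (Suc k)) \<longlonglongrightarrow> dd f v x"
proof -
  have "((\<lambda>t. (f (x + t *\<^sub>R v) - f x) / t) \<longlongrightarrow> dd f v x) (at 0)"
    using smooth_fun_line[OF assms, of x v 0] by (simp add: has_field_derivative_iff)
  moreover have "filterlim (\<lambda>k. 1 / real (Suc k)) (at 0) sequentially"
    using LIMSEQ_inverse_real_of_nat by (auto simp: filterlim_at inverse_eq_divide)
  ultimately show ?thesis
    by (auto dest: filterlim_compose)
qed

lemma tendsto_cis_quotient:
  "(\<lambda>k. (cis (a / real (Suc k)) - 1) * cx (real (Suc k))) \<longlonglongrightarrow> \<i> * cx a"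
proof -
  have "((\<lambda>z. exp (\<i> * cx a * z)) has_field_derivative (\<i> * cx a)) (at 0)"
    by (auto intro!: derivative_eq_intros)
  then have "((\<lambda>z. (exp (\<i> * cx a * z) - 1) / z) \<longlongrightarrow> \<i> * cx a) (at 0)"
    by (simp add: has_field_derivative_iff)
  moreover have "filterlim (\<lambda>k. cx (1 / real (Suc k))) (at 0) sequentially"
  proof -
    have "1 + complex_of_nat k \<noteq> 0" for k using of_nat_neq_0[of k, where 'a=complex] by simp
    then show ?thesis
      using tendsto_of_real[OF LIMSEQ_inverse_real_of_nat, where 'a=complex]
      by (auto simp: filterlim_at inverse_eq_divide)
  qed
  ultimately have "(\<lambda>k. (exp (\<i> * cx a * cx (1 / real (Suc k))) - 1) / cx (1 / real (Suc k)))
      \<longlonglongrightarrow> \<i> * cx a"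
    by (rule filterlim_compose)
  then show ?thesis
    by (simp add: cis_conv_exp)
qed

text \<open>Translating a symbol multiplies its transform by a phase. Transforming the difference
  quotients of \<open>m\<close> thus gives difference quotients of the phase, and both sides
  converge; no integration by parts is involved.\<close>

lemma finv_dd:
  fixes m :: "real^'n::finite \<Rightarrow> real"
  assumes m: "tf m"
  shows "finv (dd m v) x = - (2 * pi * (x \<bullet> v)) * \<i> * finv m x"
proof -
  have mm[measurable]: "m \<in> borel_measurable borel" and sm: "smooth_fun m" and im: "integrable lborel m"
    using m by (auto intro: tf_measurable tf_smooth tf_integrable)
  have tdd: "tf (dd m v)" by (rule test_fun_dd[OF m])
  note [measurable] = tf_measurable[OF tdd]
  obtain B where B: "B \<ge> 0" "\<And>x. \<bar>dd m v x\<bar> \<le> B" using tf_bounded[OF tdd] by blast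
  obtain R where R: "R > 0" "\<And>x. norm x > R \<Longrightarrow> m x = 0" using tf_vanish[OF m] by blast
  define q where "q k \<xi> = (m (\<xi> + (1 / real (Suc k)) *\<^sub>R v) - m \<xi>) * real (Suc k)" for k \<xi>
  have [measurable]: "q k \<in> borel_measurable borel" for k unfolding q_def by measurable
  \<comment> \<open>The quotients are at most \<open>B\<close> by the mean value theorem, and since
    the steps are at most 1 they all vanish outside the ball of radius
    \<open>R + norm v\<close>.\<close>
  have "(\<lambda>k. LBINT \<xi>. cx (q k \<xi>) * cis (2 * pi * (x \<bullet> \<xi>)))
      \<longlonglongrightarrow> (LBINT \<xi>. cx (dd m v \<xi>) * cis (2 * pi * (x \<bullet> \<xi>)))"
  proof (rule integral_dominated_convergence[where w = "\<lambda>\<xi>. B * indicator (cball 0 (R + norm v)) \<xi>"])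
    show "integrable lborel (\<lambda>\<xi>::real^'n. B * indicator (cball 0 (R + norm v)) \<xi>)"
      by (intro integrable_mult_right integrable_real_indicator) (auto simp: emeasure_lborel_cball_finite[unfolded infinity_ennreal_def])
    show "AE \<xi> in lborel. (\<lambda>k. cx (q k \<xi>) * cis (2 * pi * (x \<bullet> \<xi>)))
        \<longlonglongrightarrow> cx (dd m v \<xi>) * cis (2 * pi * (x \<bullet> \<xi>))"
      unfolding q_def by (intro AE_I2 tendsto_intros tendsto_dd sm)
    fix k
    have "\<bar>q k \<xi>\<bar> \<le> B * indicator (cball 0 (R + norm v)) \<xi>" for \<xi>
    proof (cases "norm \<xi> \<le> R + norm v")
      case True
      have "\<bar>m (\<xi> + (1 / real (Suc k)) *\<^sub>R v) - m \<xi>\<bar> \<le> 1 / real (Suc k) * B"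
        by (rule smooth_fun_line_bound[OF sm B(2)]) auto
      then have "\<bar>m (\<xi> + (1 / real (Suc k)) *\<^sub>R v) - m \<xi>\<bar> * real (Suc k) \<le> (1 / real (Suc k) * B) * real (Suc k)"
        by (intro mult_right_mono) auto
      then show ?thesis using True by (simp add: q_def abs_mult)
    next
      case False
      have "norm ((1 / real (Suc k)) *\<^sub>R v) \<le> norm v"
        by (simp add: divide_simps mult_left_le_one_le) (metis mult_le_cancel_left1 norm_ge_zero not_le add_increasing2 le_add_same_cancel1 mult_nonneg_nonneg of_nat_0_le_iff mult.commute ring_class.ring_distribs(1) mult.right_neutral)
      moreover have "norm \<xi> \<le> norm (\<xi> + (1 / real (Suc k)) *\<^sub>R v) + norm ((1 / real (Suc k)) *\<^sub>R v)"
        by (metis add_diff_cancel norm_triangle_ineq4)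
      ultimately have "m (\<xi> + (1 / real (Suc k)) *\<^sub>R v) = 0" "m \<xi> = 0"
        using False norm_ge_zero[of v] by (intro R(2); linarith)+
      then show ?thesis by (simp add: q_def indicator_def B)
    qed
    then show "AE \<xi> in lborel. norm (cx (q k \<xi>) * cis (2 * pi * (x \<bullet> \<xi>)))
       \<le> B * indicator (cball 0 (R + norm v)) \<xi>"
      by (simp add: norm_mult)
  qed auto
  moreover have "(LBINT \<xi>. cx (q k \<xi>) * cis (2 * pi * (x \<bullet> \<xi>)))
     = (cis (- (2 * pi * (x \<bullet> v)) / real (Suc k)) - 1) * cx (real (Suc k)) * finv m x" for k
  proof -
    define t where "t = (1 / real (Suc k)) *\<^sub>R v"
    have ti: "integrable lborel (\<lambda>\<xi>. m (\<xi> + t))"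
      using lborel_integrable_translate(1)[OF mm, of t] im by simp
    have "(LBINT \<xi>. cx (m (\<xi> + t)) * cis (2 * pi * (x \<bullet> \<xi>)))
      = (LBINT \<xi>. cx (m \<xi>) * cis (2 * pi * (x \<bullet> (\<xi> - t))))"
      using lborel_integral_translate(1)[of "\<lambda>\<xi>. cx (m \<xi>) * cis (2 * pi * (x \<bullet> (\<xi> - t)))" t]
      by simp
    also have "\<dots> = (LBINT \<xi>. cis (- (2 * pi * (x \<bullet> t))) * (cx (m \<xi>) * cis (2 * pi * (x \<bullet> \<xi>))))"
      by (intro Bochner_Integration.integral_cong refl)
         (simp add: cis_mult inner_diff_right algebra_simps)
    also have "\<dots> = cis (- (2 * pi * (x \<bullet> t))) * finv m x"
      by (simp add: finv_lborel im)
    finally have e: "(LBINT \<xi>. cx (m (\<xi> + t)) * cis (2 * pi * (x \<bullet> \<xi>))) = cis (- (2 * pi * (x \<bullet> t))) * finv m x" .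
    have "(LBINT \<xi>. cx (q k \<xi>) * cis (2 * pi * (x \<bullet> \<xi>)))
     = (LBINT \<xi>. cx (real (Suc k)) * (cx (m (\<xi> + t)) * cis (2 * pi * (x \<bullet> \<xi>)) - cx (m \<xi>) * cis (2 * pi * (x \<bullet> \<xi>))))"
      by (intro Bochner_Integration.integral_cong refl) (simp add: q_def t_def algebra_simps)
    also have "\<dots> = cx (real (Suc k)) * (cis (- (2 * pi * (x \<bullet> t))) * finv m x - finv m x)"
      unfolding integral_mult_right_zero
      by (subst Bochner_Integration.integral_diff) (auto simp: e finv_integrable ti im finv_lborel)
    finally show ?thesis by (simp add: t_def algebra_simps)
  qed
  moreover have "(\<lambda>k. (cis (- (2 * pi * (x \<bullet> v)) / real (Suc k)) - 1) * cx (real (Suc k)) * finv m x)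
    \<longlonglongrightarrow> \<i> * cx (- (2 * pi * (x \<bullet> v))) * finv m x"
    by (intro tendsto_mult tendsto_cis_quotient tendsto_const)
  ultimately have "(LBINT \<xi>. cx (dd m v \<xi>) * cis (2 * pi * (x \<bullet> \<xi>)))
     = \<i> * cx (- (2 * pi * (x \<bullet> v))) * finv m x"
    using LIMSEQ_unique by fastforce
  then show ?thesis by (simp add: finv_lborel tf_integrable[OF tdd] mult_ac)
qed

text \<open>Decay as in the Schwartz class, without conditions on derivatives: enough for every
  moment to be integrable.\<close>

definition rapid :: "('a::real_normed_vector \<Rightarrow> 'b::real_normed_vector) \<Rightarrow> bool" where
  "rapid M \<longleftrightarrow> M \<in> borel_measurable borel \<and> (\<forall>N. \<exists>C. \<forall>x. (1 + norm x) ^ N * norm (M x) \<le> C)"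

text \<open>Each power of \<open>norm x\<close> is paid for by one derivative of the symbol:
  \<open>norm x\<close> is at most the sum of the coordinates, and \<open>finv_dd\<close> converts a
  coordinate into a derivative, with a factor \<open>2 * pi\<close> that exceeds 1.\<close>

lemma finv_decay:
  fixes m :: "real^'n::finite \<Rightarrow> real"
  assumes "tf m"
  shows "\<exists>C. \<forall>x. (1 + norm x) ^ N * norm (finv m x) \<le> C"
  using assms
proof (induction N arbitrary: m)
  case 0
  then show ?case using finv_bound[OF tf_integrable[OF 0]] by auto
next
  case (Suc N)
  obtain C where C: "\<And>x. (1 + norm x) ^ N * norm (finv m x) \<le> C" using Suc by blast
  obtain C' where C': "\<And>b x. (1 + norm x) ^ N * norm (finv (dd m b) x) \<le> C' b"
    using Suc.IH[OF test_fun_dd[OF Suc.prems]] by metis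
  show ?case
  proof (intro exI allI)
    fix x
    have "norm x * norm (finv m x) \<le> (\<Sum>b\<in>Basis. norm (finv (dd m b) x))"
    proof -
      have "norm x * norm (finv m x) \<le> (\<Sum>b\<in>Basis. \<bar>x \<bullet> b\<bar>) * norm (finv m x)"
        by (intro mult_right_mono norm_le_l1) auto
      also have "\<dots> \<le> (\<Sum>b\<in>Basis. norm (finv (dd m b) x))"
        unfolding sum_distrib_right
      proof (rule sum_mono)
        fix b
        have "norm (finv (dd m b) x) = 2 * pi * (\<bar>x \<bullet> b\<bar> * norm (finv m x))"
          unfolding finv_dd[OF Suc.prems] by (simp add: norm_mult abs_mult)
        moreover have "1 * (\<bar>x \<bullet> b\<bar> * norm (finv m x)) \<le> 2 * pi * (\<bar>x \<bullet> b\<bar> * norm (finv m x))"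
          using pi_gt3 by (intro mult_right_mono) auto
        ultimately show "\<bar>x \<bullet> b\<bar> * norm (finv m x) \<le> norm (finv (dd m b) x)" by simp
      qed
      finally show ?thesis .
    qed
    then have "(1 + norm x) ^ N * (norm (finv m x) + norm x * norm (finv m x))
       \<le> (1 + norm x) ^ N * (norm (finv m x) + (\<Sum>b\<in>Basis. norm (finv (dd m b) x)))"
      by (intro mult_left_mono) auto
    also have "\<dots> = (1 + norm x) ^ N * norm (finv m x) + (\<Sum>b\<in>Basis. (1 + norm x) ^ N * norm (finv (dd m b) x))"
      by (simp add: ring_distribs sum_distrib_left)
    also have "\<dots> \<le> C + (\<Sum>b\<in>Basis. C' b)"
      by (intro add_mono sum_mono C C')
    finally show "(1 + norm x) ^ Suc N * norm (finv m x) \<le> C + (\<Sum>b\<in>Basis. C' b)"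
      by (simp add: ring_distribs mult_ac)
  qed
qed

lemma cis_taylor: "norm (cis t - 1 - \<i> * cx t) \<le> t\<^sup>2"
proof -
  have "cmod (iexp t - (\<Sum>k\<le>1. (\<i> * cx t) ^ k / fact k)) \<le> \<bar>t\<bar> ^ Suc 1 / fact (Suc 1)"
    by (rule iexp_approx1)
  also have "\<dots> \<le> t\<^sup>2" by (simp add: power2_eq_square[symmetric])
  finally show ?thesis by (simp add: cis_conv_exp diff_diff_eq numeral_2_eq_2)
qed

text \<open>The quadratic error of \<open>cis_taylor\<close> is integrated against the symbol.
  Compact support makes the second moment of \<open>m\<close> finite, so the total error is of order
  \<open>(norm (y - x))\<^sup>2\<close>.\<close>

lemma finv_has_derivative:
  fixes m :: "real^'n::finite \<Rightarrow> real"
  assumes m: "tf m"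
  shows "(finv m has_derivative (\<lambda>v. 2 * pi * \<i> * finv (\<lambda>\<xi>. m \<xi> * (\<xi> \<bullet> v)) x)) (at x)"
proof -
  have mm[measurable]: "m \<in> borel_measurable borel" and im: "integrable lborel m"
    using m by (auto intro: tf_measurable tf_integrable)
  have iv: "integrable lborel (\<lambda>\<xi>. m \<xi> * (\<xi> \<bullet> v))" for v
    by (intro tf_integrable test_fun_mult m smooth_fun_inner)
  define D where "D v = 2 * pi * \<i> * finv (\<lambda>\<xi>. m \<xi> * (\<xi> \<bullet> v)) x" for v
  have "linear D"
  proof (rule linearI)
    show "D (v + w) = D v + D w" for v w
      unfolding D_def using finv_add[OF iv[of v] iv[of w]] by (simp add: inner_add_right ring_distribs)
    show "D (c *\<^sub>R v) = c *\<^sub>R D v" for c v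
    proof -
      have "(\<lambda>\<xi>. m \<xi> * (\<xi> \<bullet> (c *\<^sub>R v))) = (\<lambda>\<xi>. c * (m \<xi> * (\<xi> \<bullet> v)))" by auto
      then show ?thesis
        unfolding D_def using finv_cmult[OF iv[of v], of c x] by (simp add: scaleR_conv_of_real[where 'a=complex])
    qed
  qed
  have i2: "integrable lborel (\<lambda>\<xi>. \<bar>m \<xi>\<bar> * (2 * pi * norm \<xi>)\<^sup>2)"
  proof -
    have "integrable lborel (\<lambda>\<xi>. m \<xi> * (\<Sum>b\<in>Basis. (\<xi> \<bullet> b) * (\<xi> \<bullet> b)))"
      unfolding sum_distrib_left
      by (rule Bochner_Integration.integrable_sum) (intro tf_integrable test_fun_mult m smooth_fun_mult smooth_fun_inner)
    then have "integrable lborel (\<lambda>\<xi>. (2 * pi)\<^sup>2 * \<bar>m \<xi> * (\<xi> \<bullet> \<xi>)\<bar>)"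
      by (intro integrable_mult_right integrable_abs) (simp add: euclidean_inner[symmetric])
    then show ?thesis by (simp add: power_mult_distrib power2_norm_eq_inner abs_mult mult_ac)
  qed
  have est: "norm (finv m y - finv m x - D (y - x)) \<le> (LBINT \<xi>. \<bar>m \<xi>\<bar> * (2 * pi * norm \<xi>)\<^sup>2) * (norm (y - x))\<^sup>2" for y
  proof -
    define h where "h = y - x"
    define F where "F \<xi> = cx (m \<xi>) * cis (2 * pi * (y \<bullet> \<xi>)) - cx (m \<xi>) * cis (2 * pi * (x \<bullet> \<xi>))
        - 2 * pi * \<i> * (cx (m \<xi> * (\<xi> \<bullet> h)) * cis (2 * pi * (x \<bullet> \<xi>)))" for \<xi>
    have eq: "finv m y - finv m x - D (y - x) = (LBINT \<xi>. F \<xi>)"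
      unfolding F_def
      using finv_integrable[OF im, of y] finv_integrable[OF im, of x] finv_integrable[OF iv[of h], of x]
      by (simp add: finv_lborel im iv D_def h_def)
    have bound: "norm (F \<xi>) \<le> \<bar>m \<xi>\<bar> * (2 * pi * norm \<xi>)\<^sup>2 * (norm h)\<^sup>2" for \<xi>
    proof -
      define t where "t = 2 * pi * (h \<bullet> \<xi>)"
      have "cis (2 * pi * (y \<bullet> \<xi>)) = cis (2 * pi * (x \<bullet> \<xi>)) * cis t"
        by (simp add: t_def h_def cis_mult inner_diff_left algebra_simps)
      then have "F \<xi> = cx (m \<xi>) * cis (2 * pi * (x \<bullet> \<xi>)) * (cis t - 1 - \<i> * cx t)"
        by (simp add: F_def t_def inner_commute algebra_simps)
      then have "norm (F \<xi>) = \<bar>m \<xi>\<bar> * norm (cis t - 1 - \<i> * cx t)"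
        by (simp add: norm_mult)
      moreover have "t\<^sup>2 \<le> (2 * pi * norm \<xi> * norm h)\<^sup>2"
      proof (rule power2_le_iff_abs_le[THEN iffD2])
        have "2 * pi * \<bar>h \<bullet> \<xi>\<bar> \<le> 2 * pi * (norm h * norm \<xi>)"
          by (intro mult_left_mono Cauchy_Schwarz_ineq2) auto
        then show "\<bar>t\<bar> \<le> 2 * pi * norm \<xi> * norm h"
          by (simp add: t_def abs_mult mult_ac)
      qed auto
      ultimately show ?thesis
        using cis_taylor[of t] mult_left_mono[of "norm (cis t - 1 - \<i> * cx t)" "(2 * pi * norm \<xi> * norm h)\<^sup>2" "\<bar>m \<xi>\<bar>"]
        by (simp add: power_mult_distrib mult.assoc)
    qed
    have "norm (LBINT \<xi>. F \<xi>) \<le> (LBINT \<xi>. \<bar>m \<xi>\<bar> * (2 * pi * norm \<xi>)\<^sup>2 * (norm h)\<^sup>2)"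
      by (rule integral_norm_bound[THEN order_trans], rule integral_mono_AE') (use i2 bound in auto)
    then show ?thesis by (simp add: eq h_def)
  qed
  have "(finv m has_derivative D) (at x)"
  proof (rule has_derivativeI_sandwich[of 1])
    show "bounded_linear D" using \<open>linear D\<close> linear_conv_bounded_linear by blast
    show "((\<lambda>y. (LBINT \<xi>. \<bar>m \<xi>\<bar> * (2 * pi * norm \<xi>)\<^sup>2) * norm (y - x)) \<longlongrightarrow> 0) (at x within UNIV)"
      by (auto intro!: tendsto_eq_intros)
    fix y assume "y \<in> UNIV" "y \<noteq> x"
    then show "norm ((finv m y - finv m x) - D (y - x)) / norm (y - x) \<le> (LBINT \<xi>. \<bar>m \<xi>\<bar> * (2 * pi * norm \<xi>)\<^sup>2) * norm (y - x)"
      using est[of y] by (simp add: divide_simps power2_eq_square mult_ac)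
  qed simp
  then show ?thesis by (simp add: D_def[abs_def])
qed

lemma finv_continuous: "tf m \<Longrightarrow> continuous_on A (finv m)"
  by (meson continuous_at_imp_continuous_on has_derivative_continuous finv_has_derivative)

lemma finv_measurable: "tf m \<Longrightarrow> finv m \<in> borel_measurable borel"
  by (intro borel_measurable_continuous_onI finv_continuous)

lemma rapid_finv: "tf m \<Longrightarrow> rapid (finv m)"
  by (auto simp: rapid_def finv_measurable finv_decay)

lemma tf_mult_inner: "tf m \<Longrightarrow> tf (\<lambda>\<xi>. c * (m \<xi> * (\<xi> \<bullet> v)))"
  using test_fun_mult[OF test_fun_mult[OF _ smooth_fun_inner[of v]] smooth_fun_const[of c]]
  by (simp add: mult.commute)

text \<open>The factor \<i> in the derivative exchanges real and imaginary parts, so only the union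
  of both families, over all symbols, is closed under \<open>dd\<close>.\<close>

lemma smooth_fun_finv:
  fixes m :: "real^'n::finite \<Rightarrow> real"
  assumes m: "tf m"
  shows "smooth_fun (\<lambda>x. Re (finv m x))" "smooth_fun (\<lambda>x. Im (finv m x))"
proof -
  define S :: "(real^'n \<Rightarrow> real) set" where "S = (\<lambda>m x. Re (finv m x)) ` Collect tf \<union> (\<lambda>m x. Im (finv m x)) ` Collect tf"
  have d: "((\<lambda>x. Re (finv m x)) has_derivative (\<lambda>v. Im (finv (\<lambda>\<xi>. (- 2 * pi) * (m \<xi> * (\<xi> \<bullet> v))) x))) (at x)"
    "((\<lambda>x. Im (finv m x)) has_derivative (\<lambda>v. Re (finv (\<lambda>\<xi>. (2 * pi) * (m \<xi> * (\<xi> \<bullet> v))) x))) (at x)"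
    if "tf m" for m :: "real^'n \<Rightarrow> real" and x
  proof -
    have i: "integrable lborel (\<lambda>\<xi>. m \<xi> * (\<xi> \<bullet> v))" for v
      by (intro tf_integrable test_fun_mult that smooth_fun_inner)
    show "((\<lambda>x. Re (finv m x)) has_derivative (\<lambda>v. Im (finv (\<lambda>\<xi>. (- 2 * pi) * (m \<xi> * (\<xi> \<bullet> v))) x))) (at x)"
      using bounded_linear.has_derivative[OF bounded_linear_Re finv_has_derivative[OF that, of x]]
      by (subst finv_cmult[OF i]) simp
    show "((\<lambda>x. Im (finv m x)) has_derivative (\<lambda>v. Re (finv (\<lambda>\<xi>. (2 * pi) * (m \<xi> * (\<xi> \<bullet> v))) x))) (at x)"
      using bounded_linear.has_derivative[OF bounded_linear_Im finv_has_derivative[OF that, of x]]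
      by (subst finv_cmult[OF i]) simp
  qed
  have "smooth_fun h" if "h \<in> S" for h
  proof (rule smooth_fun_coinduct[OF that])
    fix h v assume "h \<in> S"
    then consider m where "tf m" "h = (\<lambda>x. Re (finv m x))" | m where "tf m" "h = (\<lambda>x. Im (finv m x))"
      by (auto simp: S_def)
    then show "dd h v \<in> S"
    proof cases
      case 1
      have "dd h v = (\<lambda>x. Im (finv (\<lambda>\<xi>. (- 2 * pi) * (m \<xi> * (\<xi> \<bullet> v))) x))"
        unfolding 1(2) by (rule dd_eqI) (rule d(1)[OF 1(1)])
      then show ?thesis unfolding S_def using tf_mult_inner[OF 1(1)] by blast
    next
      case 2
      have "dd h v = (\<lambda>x. Re (finv (\<lambda>\<xi>. (2 * pi) * (m \<xi> * (\<xi> \<bullet> v))) x))"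
        unfolding 2(2) by (rule dd_eqI) (rule d(2)[OF 2(1)])
      then show ?thesis unfolding S_def using tf_mult_inner[OF 2(1)] by blast
    qed
  next
    fix h x assume "h \<in> S"
    then show "h differentiable (at x)"
      unfolding S_def using d differentiableI by blast
  qed
  then show "smooth_fun (\<lambda>x. Re (finv m x))" "smooth_fun (\<lambda>x. Im (finv m x))"
    using m by (auto simp: S_def)
qed

subsection \<open>Integrability\<close>

text \<open>Where \<open>1 + norm x\<close> lies between \<open>2 ^ k\<close> and
  \<open>2 ^ Suc k\<close> the weight is at most 2^(-k(n+1)), and the shell lies in a ball of volume
  proportional to 2^((k+1)n). The products form a geometric series.\<close>

lemma nn_integral_weight:
  "(\<integral>\<^sup>+x. ennreal (1 / (1 + norm (x::real^'n::finite)) ^ Suc CARD('n)) \<partial>lborel) < \<infinity>"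
proof -
  let ?n = "CARD('n)"
  define V where "V = unit_ball_vol (real ?n)"
  have V: "V \<ge> 0" unfolding V_def by (rule unit_ball_vol_nonneg) simp
  have "ennreal (1 / (1 + norm x) ^ Suc ?n) \<le> (\<Sum>k. ennreal ((1/2) ^ (k * Suc ?n)) * indicator (ball (0::real^'n) (2 ^ Suc k)) x)"
    for x :: "real^'n"
  proof -
    define k where "k = nat \<lfloor>log 2 (1 + norm x)\<rfloor>"
    have "0 \<le> log 2 (1 + norm x)" by (subst zero_le_log_cancel_iff) (auto simp: add_pos_nonneg)
    then have k1: "real k \<le> log 2 (1 + norm x)" "log 2 (1 + norm x) < real (Suc k)"
      unfolding k_def by linarith+
    have pos: "1 + norm x > 0" by (smt (verit) norm_ge_zero)
    have k2: "2 ^ k \<le> 1 + norm x" "1 + norm x < 2 ^ Suc k"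
      using k1 pos powr_realpow[of 2 k] powr_realpow[of 2 "Suc k"]
      by (simp_all add: le_log_iff log_less_iff del: of_nat_Suc power_Suc)
    have "1 / (1 + norm x) ^ Suc ?n \<le> 1 / (2 ^ k) ^ Suc ?n"
      using k2 by (intro divide_left_mono power_mono) auto
    also have "\<dots> = (1/2) ^ (k * Suc ?n)" by (simp only: power_mult power_divide power_one)
    finally have "ennreal (1 / (1 + norm x) ^ Suc ?n) \<le> ennreal ((1/2) ^ (k * Suc ?n)) * indicator (ball (0::real^'n) (2 ^ Suc k)) x"
      using k2 by (auto intro!: ennreal_leI)
    also have "\<dots> \<le> (\<Sum>k. ennreal ((1/2) ^ (k * Suc ?n)) * indicator (ball (0::real^'n) (2 ^ Suc k)) x)"
    proof -
      have "g k \<le> suminf g" for g :: "nat \<Rightarrow> ennreal"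
        using sum_le_suminf[OF summableI, of "{k}" g] by simp
      then show ?thesis .
    qed
    finally show ?thesis .
  qed
  then have "(\<integral>\<^sup>+x. ennreal (1 / (1 + norm (x::real^'n)) ^ Suc ?n) \<partial>lborel)
     \<le> (\<integral>\<^sup>+x. (\<Sum>k. ennreal ((1/2) ^ (k * Suc ?n)) * indicator (ball (0::real^'n) (2 ^ Suc k)) x) \<partial>lborel)"
    by (intro nn_integral_mono)
  also have "\<dots> = (\<Sum>k. \<integral>\<^sup>+x. ennreal ((1/2) ^ (k * Suc ?n)) * indicator (ball (0::real^'n) (2 ^ Suc k)) x \<partial>lborel)"
  proof (rule nn_integral_suminf)
    have "(\<lambda>x. c * indicator (ball (0::real^'n) r) x) \<in> borel_measurable lborel" for c :: ennreal and r
    proof -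
      have [measurable]: "ball (0::real^'n) r \<in> sets borel" by simp
      show ?thesis by measurable
    qed
    then show "(\<lambda>x. ennreal ((1/2) ^ (k * Suc ?n)) * indicator (ball (0::real^'n) (2 ^ Suc k)) x) \<in> borel_measurable lborel" for k .
  qed
  also have "\<dots> = (\<Sum>k. ennreal (V * 2 ^ ?n * (1/2) ^ k))"
  proof (intro suminf_cong)
    fix k
    have "(\<integral>\<^sup>+x. ennreal ((1/2) ^ (k * Suc ?n)) * indicator (ball (0::real^'n) (2 ^ Suc k)) x \<partial>lborel)
      = ennreal ((1/2) ^ (k * Suc ?n)) * emeasure lborel (ball (0::real^'n) (2 ^ Suc k))"
      by (rule nn_integral_cmult_indicator) auto
    also have "\<dots> = ennreal ((1/2) ^ (k * Suc ?n) * (V * (2 ^ Suc k) ^ ?n))"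
      by (subst emeasure_ball) (auto simp: V_def ennreal_mult)
    also have "(1/2) ^ (k * Suc ?n) * (V * (2 ^ Suc k) ^ ?n) = V * 2 ^ ?n * (1/2) ^ k"
      by (simp add: power_add power_mult_distrib power_mult power_one_over field_simps)
    finally show "(\<integral>\<^sup>+x. ennreal ((1/2) ^ (k * Suc ?n)) * indicator (ball (0::real^'n) (2 ^ Suc k)) x \<partial>lborel)
      = ennreal (V * 2 ^ ?n * (1/2) ^ k)" .
  qed
  also have "\<dots> < \<infinity>"
    using V by (subst suminf_ennreal2) (auto intro!: summable_mult summable_geometric)
  finally show ?thesis .
qed

lemma integrable_weight:
  "integrable lborel (\<lambda>x::real^'n::finite. 1 / (1 + norm x) ^ Suc CARD('n))"
  by (rule integrableI_nonneg) (use nn_integral_weight in \<open>auto simp: less_top\<close>)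

lemma rapid_integrable_moment:
  fixes M :: "real^'n::finite \<Rightarrow> 'b::{banach, second_countable_topology}"
  assumes "rapid M"
  shows "integrable lborel (\<lambda>x. (1 + norm x) ^ k * norm (M x))"
proof -
  have [measurable]: "M \<in> borel_measurable borel" using assms by (simp add: rapid_def)
  obtain C where C: "\<And>x. (1 + norm x) ^ (k + Suc CARD('n)) * norm (M x) \<le> C"
    using assms unfolding rapid_def by blast
  show ?thesis
  proof (rule Bochner_Integration.integrable_bound)
    show "integrable lborel (\<lambda>x::real^'n. C * (1 / (1 + norm x) ^ Suc CARD('n)))"
      using integrable_weight by (rule integrable_mult_right)
    have "(1 + norm x) ^ k * norm (M x) \<le> C * (1 / (1 + norm x) ^ Suc CARD('n))" for x
    proof -
      have "(1 + norm x) ^ Suc CARD('n) > 0" by (intro zero_less_power) (smt (verit) norm_ge_zero)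
      moreover have "(1 + norm x) ^ k * norm (M x) * (1 + norm x) ^ Suc CARD('n) \<le> C"
        using C[of x] unfolding power_add by (simp only: mult_ac)
      ultimately show ?thesis by (simp add: pos_le_divide_eq del: power_Suc)
    qed
    moreover have "0 \<le> (1 + norm x) ^ k * norm (M x)" for x
      by (intro mult_nonneg_nonneg zero_le_power) auto
    ultimately show "AE x in lborel. norm ((1 + norm x) ^ k * norm (M x)) \<le> norm (C * (1 / (1 + norm x) ^ Suc CARD('n)))"
      by (intro AE_I2) (smt (verit) real_norm_def)
  qed measurable
qed

lemma rapid_integrable:
  fixes M :: "real^'n::finite \<Rightarrow> 'b::{banach, second_countable_topology}"
  assumes "rapid M"
  shows "integrable lborel M" "integrable lborel (\<lambda>x. norm x ^ k * norm (M x))"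
proof -
  have [measurable]: "M \<in> borel_measurable borel" using assms by (simp add: rapid_def)
  show "integrable lborel M"
    using rapid_integrable_moment[OF assms, of 0] by (simp add: integrable_norm_iff)
  show "integrable lborel (\<lambda>x. norm x ^ k * norm (M x))"
    by (rule Bochner_Integration.integrable_bound[OF rapid_integrable_moment[OF assms, of k]])
       (auto intro!: AE_I2 mult_right_mono power_mono simp: abs_mult)
qed

lemmas finv_in_L1 = rapid_integrable(1)[OF rapid_finv]

subsection \<open>Fourier inversion\<close>

lemma integrable_pair_mult:
  fixes f :: "'a::euclidean_space \<Rightarrow> real" and g :: "'b::euclidean_space \<Rightarrow> real"
  assumes f: "integrable lborel f" and g: "integrable lborel g"
  shows "integrable (lborel \<Otimes>\<^sub>M lborel) (\<lambda>(x, y). f x * g y)"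
proof -
  have [measurable]: "f \<in> borel_measurable borel" "g \<in> borel_measurable borel"
    using f g by (auto dest: borel_measurable_integrable)
  show ?thesis
  proof (rule lborel_pair.Fubini_integrable)
    show "integrable lborel (\<lambda>x. LINT y|lborel. norm (case (x, y) of (x, y) \<Rightarrow> f x * g y))"
      using f by (simp add: abs_mult)
    show "AE x in lborel. integrable lborel (\<lambda>y. case (x, y) of (x, y) \<Rightarrow> f x * g y)"
      using g by simp
  qed measurable
qed

lemma Fubini_dominated:
  fixes F :: "'a::euclidean_space \<Rightarrow> 'b::euclidean_space \<Rightarrow> 'c::{banach, second_countable_topology}"
  assumes "integrable lborel f" "integrable lborel g"
    and m: "case_prod F \<in> borel_measurable (lborel \<Otimes>\<^sub>M lborel)"
    and b: "\<And>x y. norm (F x y) \<le> f x * g y"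
  shows "(LBINT x. LBINT y. F x y) = (LBINT y. LBINT x. F x y)"
proof -
  have "integrable (lborel \<Otimes>\<^sub>M lborel) (case_prod F)"
    by (rule Bochner_Integration.integrable_bound[OF integrable_pair_mult[OF assms(1,2)] m])
       (use b in \<open>auto intro!: AE_I2 order_trans[OF b] simp: split_beta\<close>)
  from lborel_pair.Fubini_integral[OF this] show ?thesis by simp
qed

text \<open>The standard normal density without its constant, so that the known characteristic
  function gives the transform coordinate by coordinate. The factor \<open>2 * pi\<close> in the
  phase is absorbed by rescaling in the inversion theorem.\<close>

definition gauss :: "real^'n::finite \<Rightarrow> real" where
  "gauss x = exp (- (norm x)\<^sup>2 / 2)"

lemma gauss_1d:
  shows "integrable lborel (\<lambda>x. cx (exp (- x\<^sup>2 / 2)) * iexp (t * x))"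
    and "(LBINT x. cx (exp (- x\<^sup>2 / 2)) * iexp (t * x)) = cx (sqrt (2 * pi) * exp (- t\<^sup>2 / 2))"
proof -
  have e: "exp (- x\<^sup>2 / 2) = sqrt (2 * pi) * std_normal_density x" for x :: real
    by (simp add: std_normal_density_def)
  have "integrable lborel (\<lambda>x. sqrt (2 * pi) * std_normal_density x)"
    by (intro integrable_mult_right integrable_normal_density) simp
  then have i: "integrable lborel (\<lambda>x::real. exp (- x\<^sup>2 / 2))" by (simp only: e)
  show i1: "integrable lborel (\<lambda>x. cx (exp (- x\<^sup>2 / 2)) * iexp (t * x))"
    by (rule Bochner_Integration.integrable_bound[OF i]) (auto simp: norm_mult)
  have "char std_normal_distribution t = (LBINT x. std_normal_density x *\<^sub>R iexp (t * x))"
    unfolding char_def by (subst integral_density) (auto simp: normal_density_nonneg)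
  then have "(LBINT x. std_normal_density x *\<^sub>R iexp (t * x)) = cx (exp (- t\<^sup>2 / 2))"
    by (simp add: char_std_normal_distribution)
  note eq1 = this
  have eq2: "(LBINT x. cx (exp (- x\<^sup>2 / 2)) * iexp (t * x))
     = (LBINT x. cx (sqrt (2 * pi)) * (std_normal_density x *\<^sub>R iexp (t * x)))"
    by (intro Bochner_Integration.integral_cong refl) (simp only: e scaleR_conv_of_real of_real_mult mult.assoc)
  show "(LBINT x. cx (exp (- x\<^sup>2 / 2)) * iexp (t * x)) = cx (sqrt (2 * pi) * exp (- t\<^sup>2 / 2))"
    by (rule trans[OF eq2]) (unfold integral_mult_right_zero eq1, simp)
qed

lemma gauss_measurable[measurable]: "gauss \<in> borel_measurable borel"
  unfolding gauss_def by measurable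

lemma gauss_prod: "cx (gauss x) * cis (x \<bullet> y) = (\<Prod>b\<in>Basis. cx (exp (- (x \<bullet> b)\<^sup>2 / 2)) * iexp ((y \<bullet> b) * (x \<bullet> b)))"
proof -
  have "gauss x = (\<Prod>b\<in>Basis. exp (- (x \<bullet> b)\<^sup>2 / 2))"
    unfolding gauss_def power2_norm_eq_inner
    by (subst euclidean_inner) (simp add: exp_sum[symmetric] sum_negf sum_divide_distrib power2_eq_square)
  moreover have "cis (x \<bullet> y) = (\<Prod>b\<in>Basis. iexp ((y \<bullet> b) * (x \<bullet> b)))"
    by (subst euclidean_inner) (simp add: exp_sum[symmetric] cis_conv_exp sum_distrib_left mult_ac)
  ultimately show ?thesis by (simp add: prod.distrib)
qed

lemma fourier_gauss:
  fixes y :: "real^'n::finite"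
  shows "(LBINT x. cx (gauss x) * cis (x \<bullet> y)) = cx (sqrt (2 * pi) ^ CARD('n) * gauss y)"
proof -
  interpret product_sigma_finite "\<lambda>_::real^'n. lborel :: real measure" ..
  let ?f = "\<lambda>b x. cx (exp (- x\<^sup>2 / 2)) * iexp ((y \<bullet> b) * x)"
  have "(LBINT x. cx (gauss x) * cis (x \<bullet> y))
     = (\<integral>f. cx (gauss (\<Sum>b\<in>Basis. f b *\<^sub>R b)) * cis ((\<Sum>b\<in>Basis. f b *\<^sub>R b) \<bullet> y) \<partial>(\<Pi>\<^sub>M b\<in>Basis. lborel))"
  proof (subst lborel_eq, rule integral_distr)
    have "(\<lambda>x. x b) \<in> borel_measurable (Pi\<^sub>M Basis (\<lambda>b. lborel :: real measure))" if "b \<in> Basis" for b :: "real^'n"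
      using measurable_component_singleton[OF that, of "\<lambda>_. lborel :: real measure"] by simp
    then show "(\<lambda>f. \<Sum>b\<in>Basis. f b *\<^sub>R b) \<in> measurable (Pi\<^sub>M (Basis :: (real^'n) set) (\<lambda>b. lborel)) borel"
      by (intro borel_measurable_sum borel_measurable_scaleR) auto
  qed measurable
  also have "\<dots> = (\<integral>f. (\<Prod>b\<in>Basis. ?f b (f b)) \<partial>(\<Pi>\<^sub>M b\<in>Basis. lborel))"
    unfolding gauss_prod by (intro Bochner_Integration.integral_cong refl prod.cong) simp_all
  also have "\<dots> = (\<Prod>b\<in>Basis. LBINT x. ?f b x)"
    by (rule product_integral_prod) (simp, rule gauss_1d(1))
  also have "\<dots> = (\<Prod>b\<in>Basis. cx (sqrt (2 * pi) * exp (- (y \<bullet> b)\<^sup>2 / 2)))"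
    unfolding gauss_1d(2) ..
  also have "\<dots> = cx (sqrt (2 * pi) ^ CARD('n) * (\<Prod>b\<in>Basis. exp (- (y \<bullet> b)\<^sup>2 / 2)))"
    by (simp add: prod.distrib)
  also have "(\<Prod>b\<in>Basis. exp (- (y \<bullet> b)\<^sup>2 / 2)) = gauss y"
    unfolding gauss_def power2_norm_eq_inner
    by (subst euclidean_inner) (simp add: exp_sum[symmetric] sum_negf sum_divide_distrib power2_eq_square)
  finally show ?thesis .
qed

lemma gauss_integral:
  shows "integrable lborel (gauss :: real^'n::finite \<Rightarrow> real)"
    and "(LBINT x. gauss (x::real^'n)) = sqrt (2 * pi) ^ CARD('n)"
proof -
  have "(LBINT x. cx (gauss (x::real^'n))) = cx (sqrt (2 * pi) ^ CARD('n))"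
    using fourier_gauss[of "0::real^'n"] by (simp add: gauss_def[of 0])
  then show e: "(LBINT x. gauss (x::real^'n)) = sqrt (2 * pi) ^ CARD('n)"
    unfolding integral_complex_of_real of_real_eq_iff .
  then have "(LBINT x. gauss (x::real^'n)) \<noteq> 0" by simp
  \<comment> \<open>A Bochner integral that does not exist has the value 0, so a nonzero value
    proves integrability.\<close>
  then show "integrable lborel (gauss :: real^'n \<Rightarrow> real)"
    using not_integrable_integral_eq by blast
qed

text \<open>A factor \<open>gauss (\<epsilon> k *\<^sub>R x)\<close> makes the double integral
  absolutely convergent. Exchanging the integrals averages \<open>m\<close> around \<xi> against a
  narrow Gaussian, while for \<epsilon> tending to 0 the factor disappears on the other
  side.\<close>

theorem fourier_inversion:
  fixes m :: "real^'n::finite \<Rightarrow> real"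
  assumes m: "tf m"
  shows "(LBINT x. finv m x * cis (- (2 * pi * (x \<bullet> \<xi>)))) = cx (m \<xi>)"
proof -
  note [measurable] = tf_measurable[OF m] finv_measurable[OF m]
  have im: "integrable lborel m" by (rule tf_integrable[OF m])
  have iM: "integrable lborel (finv m)" by (rule finv_in_L1[OF m])
  obtain B where B: "B \<ge> 0" "\<And>x. \<bar>m x\<bar> \<le> B" using tf_bounded[OF m] by blast
  define c where "c = sqrt (2 * pi) ^ CARD('n)"
  have c: "c > 0" by (simp add: c_def)
  define \<epsilon> where "\<epsilon> k = 1 / real (Suc k)" for k
  have \<epsilon>: "\<epsilon> k > 0" for k by (simp add: \<epsilon>_def)
  have \<epsilon>0: "\<epsilon> \<longlonglongrightarrow> 0" using LIMSEQ_inverse_real_of_nat by (simp add: \<epsilon>_def[abs_def] inverse_eq_divide)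
  have g1: "gauss x \<le> 1" "0 \<le> gauss x" for x :: "real^'n" by (auto simp: gauss_def)
  define I where "I k = (LBINT x. cx (gauss (\<epsilon> k *\<^sub>R x)) * (finv m x * cis (- (2 * pi * (x \<bullet> \<xi>)))))" for k
  have lim1: "I \<longlonglongrightarrow> (LBINT x. finv m x * cis (- (2 * pi * (x \<bullet> \<xi>))))"
    unfolding I_def
  proof (rule integral_dominated_convergence[where w = "\<lambda>x. norm (finv m x)"])
    show "AE x in lborel. (\<lambda>k. cx (gauss (\<epsilon> k *\<^sub>R x)) * (finv m x * cis (- (2 * pi * (x \<bullet> \<xi>)))))
        \<longlonglongrightarrow> finv m x * cis (- (2 * pi * (x \<bullet> \<xi>)))"
    proof (rule AE_I2)
      fix x :: "real^'n"
      have "(\<lambda>k. gauss (\<epsilon> k *\<^sub>R x)) \<longlonglongrightarrow> exp (- (norm (0 *\<^sub>R x))\<^sup>2 / 2)"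
        unfolding gauss_def by (intro tendsto_intros \<epsilon>0) auto
      then have "(\<lambda>k. gauss (\<epsilon> k *\<^sub>R x)) \<longlonglongrightarrow> 1" by simp
      from tendsto_mult[OF tendsto_of_real[OF this] tendsto_const]
      show "(\<lambda>k. cx (gauss (\<epsilon> k *\<^sub>R x)) * (finv m x * cis (- (2 * pi * (x \<bullet> \<xi>)))))
        \<longlonglongrightarrow> finv m x * cis (- (2 * pi * (x \<bullet> \<xi>)))" by simp
    qed
    show "AE x in lborel. norm (cx (gauss (\<epsilon> k *\<^sub>R x)) * (finv m x * cis (- (2 * pi * (x \<bullet> \<xi>))))) \<le> norm (finv m x)" for k
      using g1 by (intro AE_I2) (auto simp: norm_mult intro!: mult_left_le_one_le)
  qed (use iM in \<open>auto simp: integrable_norm\<close>)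
  \<comment> \<open>After Fubini the inner integral is a Gaussian in \<eta> centred at \<xi> of
    width about \<open>\<epsilon> k\<close>; substituting its rescaled variable moves the parameter
    into the argument of \<open>m\<close>.\<close>
  have Ik: "I k = (LBINT z. cx (m (\<xi> + (\<epsilon> k / (2 * pi)) *\<^sub>R z)) * cx (gauss z / c))" for k
  proof -
    define e where "e = \<epsilon> k"
    have e: "e > 0" using \<epsilon> by (simp add: e_def)
    have "I k = (LBINT x. (LBINT \<eta>. cx (gauss (e *\<^sub>R x)) * cx (m \<eta>) * cis (2 * pi * (x \<bullet> (\<eta> - \<xi>)))))"
      unfolding I_def finv_lborel[OF im] e_def[symmetric]
      by (intro Bochner_Integration.integral_cong refl, subst integral_mult_left_zero[symmetric], subst integral_mult_right_zero[symmetric])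
         (intro Bochner_Integration.integral_cong refl, simp add: cis_mult inner_diff_right algebra_simps)
    also have "\<dots> = (LBINT \<eta>. (LBINT x. cx (gauss (e *\<^sub>R x)) * cx (m \<eta>) * cis (2 * pi * (x \<bullet> (\<eta> - \<xi>)))))"
    proof (rule Fubini_dominated)
      show "integrable lborel (\<lambda>x::real^'n. gauss (e *\<^sub>R x))"
        using lborel_integrable_affine[of "gauss :: real^'n \<Rightarrow> real" e 0] gauss_integral(1)[where 'n='n] e by simp
      show "integrable lborel (\<lambda>\<eta>. \<bar>m \<eta>\<bar>)" using im by simp
    qed (auto simp: norm_mult g1)
    also have "\<dots> = (LBINT \<eta>. cx (m \<eta>) * cx (c / e ^ CARD('n) * gauss ((2 * pi / e) *\<^sub>R (\<eta> - \<xi>))))"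
    proof (intro Bochner_Integration.integral_cong refl)
      fix \<eta> :: "real^'n"
      have "(LBINT x. cx (gauss (e *\<^sub>R x)) * cx (m \<eta>) * cis (2 * pi * (x \<bullet> (\<eta> - \<xi>))))
        = cx (m \<eta>) * (LBINT x. cx (gauss (e *\<^sub>R x)) * cis (e *\<^sub>R x \<bullet> ((2 * pi / e) *\<^sub>R (\<eta> - \<xi>))))"
        using e by (subst integral_mult_right_zero[symmetric]) (intro Bochner_Integration.integral_cong refl, simp add: mult_ac)
      also have "(LBINT x. cx (gauss (e *\<^sub>R x)) * cis (e *\<^sub>R x \<bullet> ((2 * pi / e) *\<^sub>R (\<eta> - \<xi>))))
        = cx (1 / e ^ CARD('n)) * (LBINT x. cx (gauss x) * cis (x \<bullet> ((2 * pi / e) *\<^sub>R (\<eta> - \<xi>))))"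
        using lborel_integral_affine[of "\<lambda>x. cx (gauss x) * cis (x \<bullet> ((2 * pi / e) *\<^sub>R (\<eta> - \<xi>)))" e 0] e
        by (simp add: scaleR_conv_of_real[where 'a=complex])
      finally show "(LBINT x. cx (gauss (e *\<^sub>R x)) * cx (m \<eta>) * cis (2 * pi * (x \<bullet> (\<eta> - \<xi>))))
        = cx (m \<eta>) * cx (c / e ^ CARD('n) * gauss ((2 * pi / e) *\<^sub>R (\<eta> - \<xi>)))"
        unfolding fourier_gauss by (simp add: c_def)
    qed
    also have "\<dots> = (e / (2 * pi)) ^ CARD('n) *\<^sub>R (LBINT z. cx (m (\<xi> + (e / (2 * pi)) *\<^sub>R z)) * cx (c / e ^ CARD('n) * gauss z))"
      using lborel_integral_affine[of "\<lambda>\<eta>. cx (m \<eta>) * cx (c / e ^ CARD('n) * gauss ((2 * pi / e) *\<^sub>R (\<eta> - \<xi>)))" "e / (2 * pi)" \<xi>] e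
      by simp
    also have "\<dots> = (LBINT z. cx (m (\<xi> + (e / (2 * pi)) *\<^sub>R z)) * cx (gauss z / c))"
    proof -
      \<comment> \<open>The powers of \<open>e\<close> cancel, and \<open>c * c\<close> equals
        \<open>(2 * pi) ^ n\<close>, so exactly the mass \<open>1 / c\<close> of a probability
        density is left.\<close>
      have e2: "(e / (2 * pi)) ^ CARD('n) * (c / e ^ CARD('n)) = 1 / c"
      proof -
        have "c * c = (2 * pi) ^ CARD('n)" unfolding c_def power_mult_distrib[symmetric, of "sqrt (2 * pi)"] by (simp only: real_sqrt_mult_self) simp
        then have "(e / (2 * pi)) ^ CARD('n) = e ^ CARD('n) / (c * c)" by (simp only: power_divide)
        then show ?thesis using e c by simp
      qed
      have sc: "r *\<^sub>R (u * cx w) = u * cx (r * w)" for r w u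
        by (simp add: scaleR_conv_of_real)
      from e2 have "(e / (2 * pi)) ^ CARD('n) * (c / e ^ CARD('n)) * gauss z = 1 / c * gauss z" for z :: "real^'n"
        by (simp only:)
      then have "(e / (2 * pi)) ^ CARD('n) * (c / e ^ CARD('n) * gauss z) = gauss z / c" for z :: "real^'n"
        by (simp only: mult.assoc) simp
      then show ?thesis
        by (simp only: integral_scaleR_right[symmetric] sc)
    qed
    finally show ?thesis by (simp add: e_def)
  qed
  have "I \<longlonglongrightarrow> (LBINT z. cx (m \<xi>) * cx (gauss (z::real^'n) / c))"
    unfolding Ik
  proof (rule integral_dominated_convergence[where w = "\<lambda>z. B * (gauss z / c)"])
    show "integrable lborel (\<lambda>z::real^'n. B * (gauss z / c))"
      by (intro integrable_mult_right integrable_divide_zero gauss_integral(1))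
    show "AE z in lborel. (\<lambda>k. cx (m (\<xi> + (\<epsilon> k / (2 * pi)) *\<^sub>R z)) * cx (gauss z / c))
       \<longlonglongrightarrow> cx (m \<xi>) * cx (gauss z / c)"
    proof (rule AE_I2)
      fix z :: "real^'n"
      have "(\<lambda>k. \<xi> + (\<epsilon> k / (2 * pi)) *\<^sub>R z) \<longlonglongrightarrow> \<xi> + (0 / (2 * pi)) *\<^sub>R z"
        by (intro tendsto_intros \<epsilon>0) auto
      then have "(\<lambda>k. \<xi> + (\<epsilon> k / (2 * pi)) *\<^sub>R z) \<longlonglongrightarrow> \<xi>" by simp
      moreover have "isCont m \<xi>"
        using smooth_fun_continuous_on[OF tf_smooth[OF m], of UNIV] by (simp add: continuous_on_eq_continuous_at)
      ultimately have "(\<lambda>k. m (\<xi> + (\<epsilon> k / (2 * pi)) *\<^sub>R z)) \<longlonglongrightarrow> m \<xi>"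
        by (rule isCont_tendsto_compose[rotated])
      then show "(\<lambda>k. cx (m (\<xi> + (\<epsilon> k / (2 * pi)) *\<^sub>R z)) * cx (gauss z / c))
       \<longlonglongrightarrow> cx (m \<xi>) * cx (gauss z / c)"
        by (intro tendsto_intros)
    qed
    show "AE z in lborel. norm (cx (m (\<xi> + (\<epsilon> k / (2 * pi)) *\<^sub>R z)) * cx (gauss z / c)) \<le> B * (gauss z / c)" for k
      using B c g1 by (intro AE_I2) (auto simp: norm_mult norm_divide abs_mult intro!: mult_right_mono divide_right_mono)
  qed auto
  also have "(LBINT z. cx (m \<xi>) * cx (gauss (z::real^'n) / c)) = cx (m \<xi>)"
    unfolding integral_mult_right_zero integral_complex_of_real
    using gauss_integral(2)[where 'n='n] c by (simp add: c_def)
  finally show ?thesis using lim1 LIMSEQ_unique by blast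
qed

text \<open>Write the second factor as an integral over frequencies, exchange, and apply inversion
  to the first. Correlation rather than convolution is needed because pairings of
  \<open>P (y - z)\<close> with \<open>Q (x - z)\<close> take this form after
  \<open>z = y - w\<close>; hence the reflected symbol.\<close>

lemma finv_correlation:
  fixes m q :: "real^'n::finite \<Rightarrow> real"
  assumes m: "tf m" and q: "tf q"
  shows "(LBINT w. finv m w * finv q (v + w)) = finv (\<lambda>\<xi>. q \<xi> * m (- \<xi>)) v"
proof -
  note [measurable] = tf_measurable[OF m] finv_measurable[OF m] tf_measurable[OF q] finv_measurable[OF q]
  have iq: "integrable lborel q" by (rule tf_integrable[OF q])
  have iM: "integrable lborel (finv m)" by (rule finv_in_L1[OF m])
  have "(LBINT w. finv m w * finv q (v + w))
     = (LBINT w. (LBINT \<xi>. finv m w * (cx (q \<xi>) * cis (2 * pi * ((v + w) \<bullet> \<xi>)))))"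
    unfolding finv_lborel[OF iq] integral_mult_right_zero ..
  also have "\<dots> = (LBINT \<xi>. (LBINT w. finv m w * (cx (q \<xi>) * cis (2 * pi * ((v + w) \<bullet> \<xi>)))))"
    by (rule Fubini_dominated[of "\<lambda>w. norm (finv m w)" "\<lambda>\<xi>. \<bar>q \<xi>\<bar>"])
       (use iM iq in \<open>auto simp: integrable_norm norm_mult\<close>)
  also have "\<dots> = (LBINT \<xi>. cx (q \<xi> * m (- \<xi>)) * cis (2 * pi * (v \<bullet> \<xi>)))"
  proof (intro Bochner_Integration.integral_cong refl)
    fix \<xi> :: "real^'n"
    have "(LBINT w. finv m w * (cx (q \<xi>) * cis (2 * pi * ((v + w) \<bullet> \<xi>))))
      = (LBINT w. cx (q \<xi>) * cis (2 * pi * (v \<bullet> \<xi>)) * (finv m w * cis (- (2 * pi * (w \<bullet> - \<xi>)))))"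
      by (intro Bochner_Integration.integral_cong refl) (simp add: inner_add_left ring_distribs cis_mult[symmetric] mult_ac)
    also have "\<dots> = cx (q \<xi>) * cis (2 * pi * (v \<bullet> \<xi>)) * cx (m (- \<xi>))"
      unfolding integral_mult_right_zero fourier_inversion[OF m] ..
    finally show "(LBINT w. finv m w * (cx (q \<xi>) * cis (2 * pi * ((v + w) \<bullet> \<xi>))))
      = cx (q \<xi> * m (- \<xi>)) * cis (2 * pi * (v \<bullet> \<xi>))"
      by simp
  qed
  also have "\<dots> = finv (\<lambda>\<xi>. q \<xi> * m (- \<xi>)) v"
    by (rule finv_lborel[symmetric], rule tf_integrable, rule test_fun_mult[OF q])
       (use smooth_fun_scale[OF tf_smooth[OF m], of "-1"] in simp)
  finally show ?thesis .
qed

lemma finv_convolution: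
  fixes m q :: "real^'n::finite \<Rightarrow> real"
  assumes m: "tf m" and q: "tf q"
  shows "(LBINT y. finv m (x - y) * finv q y) = finv (\<lambda>\<xi>. m \<xi> * q \<xi>) x"
proof -
  note [measurable] = finv_measurable[OF m] finv_measurable[OF q]
  have m': "tf (\<lambda>\<xi>. m (- \<xi>))" using tf_scale[OF m, of "-1"] by simp
  have "(LBINT y. finv m (x - y) * finv q y) = (LBINT w. finv m (x - (x + w)) * finv q (x + w))"
    by (rule lborel_integral_translate(2)[symmetric]) measurable
  also have "\<dots> = (LBINT w. finv (\<lambda>\<xi>. m (- \<xi>)) w * finv q (x + w))"
    using finv_reflect[OF tf_integrable[OF m]] by simp
  also have "\<dots> = finv (\<lambda>\<xi>. m \<xi> * q \<xi>) x"
    unfolding finv_correlation[OF m' q] by (simp add: mult.commute)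
  finally show ?thesis .
qed

section \<open>Lebesgue norms and convolution\<close>

text \<open>Borel counterpart of \<open>Lp_mem\<close>, which makes product measurability and Fubini
  directly available. Lebesgue measurable data are exchanged for Borel representatives only at the
  very end.\<close>

definition Lp :: "real \<Rightarrow> (real^'n::finite \<Rightarrow> 'b::{banach, second_countable_topology}) \<Rightarrow> bool" where
  "Lp p f \<longleftrightarrow> f \<in> borel_measurable borel \<and> integrable lborel (\<lambda>x. norm (f x) powr p)"

definition nrm :: "real \<Rightarrow> (real^'n::finite \<Rightarrow> 'b::{banach, second_countable_topology}) \<Rightarrow> real" where
  "nrm p f = (LBINT x. norm (f x) powr p) powr (1 / p)"

text \<open>Where the integrand is not integrable the value is 0, so additivity and associativity
  can only be stated almost everywhere.\<close>

definition conv :: "(real^'n::finite \<Rightarrow> 'b::{real_normed_field, banach, second_countable_topology}) \<Rightarrow> (real^'n \<Rightarrow> 'b) \<Rightarrow> real^'n \<Rightarrow> 'b" where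
  "conv K f x = (LBINT y. K (x - y) * f y)"

lemma Lp_measurable[measurable_dest]: "Lp p f \<Longrightarrow> f \<in> borel_measurable borel"
  by (simp add: Lp_def)

lemma nrm_nonneg: "nrm p f \<ge> 0"
  by (simp add: nrm_def)

lemma nrm_powr: "p \<noteq> 0 \<Longrightarrow> nrm p f powr p = (LBINT x. norm (f x) powr p)"
  by (simp add: nrm_def powr_powr)

lemma nrm_leI:
  assumes "p > 0" "c \<ge> 0" "(LBINT x. norm (f x) powr p) \<le> c powr p"
  shows "nrm p f \<le> c"
proof -
  have "nrm p f \<le> (c powr p) powr (1 / p)"
    unfolding nrm_def using assms by (intro powr_mono2) auto
  then show ?thesis using assms by (simp add: powr_powr)
qed

lemma Lp_norm_iff: "f \<in> borel_measurable borel \<Longrightarrow> Lp p (\<lambda>x. norm (f x)) \<longleftrightarrow> Lp p f"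
  by (auto simp: Lp_def)

lemma nrm_norm: "nrm p (\<lambda>x. norm (f x)) = nrm p f"
  by (simp add: nrm_def)

lemma Lp_of_real: "Lp p f \<Longrightarrow> Lp p (\<lambda>x. cx (f x))"
  by (auto simp: Lp_def)

lemma nrm_of_real: "nrm p (\<lambda>x. cx (f x)) = nrm p f"
  by (simp add: nrm_def)

lemma Lp_mono:
  assumes g: "Lp p g" and f: "f \<in> borel_measurable borel" and le: "AE x in lborel. norm (f x) \<le> norm (g x)" and p: "p > 0"
  shows "Lp p f" "nrm p f \<le> nrm p g"
proof -
  have ae: "AE x in lborel. norm (f x) powr p \<le> norm (g x) powr p"
    using le p by (auto intro!: powr_mono2 elim!: eventually_mono)
  note [measurable] = f Lp_measurable[OF g]
  have i: "integrable lborel (\<lambda>x. norm (f x) powr p)"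
    by (rule Bochner_Integration.integrable_bound[of _ "\<lambda>x. norm (g x) powr p"]) (use g ae in \<open>auto simp: Lp_def\<close>)
  then show "Lp p f" using f by (simp add: Lp_def)
  show "nrm p f \<le> nrm p g"
    unfolding nrm_def using p
    by (intro powr_mono2 integral_mono_AE i ae) (use g in \<open>auto simp: Lp_def\<close>)
qed

lemma nrm_cong_AE:
  assumes [measurable]: "f \<in> borel_measurable borel" "g \<in> borel_measurable borel" and "AE x in lborel. f x = g x"
  shows "nrm p f = nrm p g"
  unfolding nrm_def using assms(3)
  by (intro arg_cong[where f = "\<lambda>t. t powr (1/p)"] integral_cong_AE) (auto elim!: eventually_mono)

lemma Lp_cmult:
  fixes f :: "real^'n::finite \<Rightarrow> 'b::{real_normed_field, banach, second_countable_topology}"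
  assumes f: "Lp p f" and p: "p > 0"
  shows "Lp p (\<lambda>x. c * f x)" "nrm p (\<lambda>x. c * f x) = norm c * nrm p f"
proof -
  note [measurable] = Lp_measurable[OF f]
  show "Lp p (\<lambda>x. c * f x)" using f by (auto simp: Lp_def norm_mult powr_mult)
  show "nrm p (\<lambda>x. c * f x) = norm c * nrm p f"
    using p by (simp add: nrm_def norm_mult powr_mult powr_powr)
qed

lemma nrm_zero_AE:
  assumes f: "Lp p f" and "nrm p f = 0"
  shows "AE x in lborel. f x = 0"
proof -
  note [measurable] = Lp_measurable[OF f]
  have "(LBINT x. norm (f x) powr p) = 0" using assms(2) by (simp add: nrm_def)
  then have "AE x in lborel. norm (f x) powr p = 0"
    using f by (subst (asm) integral_nonneg_eq_0_iff_AE) (auto simp: Lp_def)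
  then show ?thesis by simp
qed

text \<open>Between positive points this is the usual convexity; with an endpoint at 0 it reduces to
  \<open>s powr p \<le> s\<close> for \<open>s\<close> between 0 and 1.\<close>

lemma convex_on_powr_nonneg:
  assumes p: "p > 1"
  shows "convex_on {0..} (\<lambda>x::real. x powr p)"
proof (rule convex_onI)
  fix t x y :: real
  assume t: "0 < t" "t < 1" and xy: "x \<in> {0..}" "y \<in> {0..}"
  have le: "s powr p \<le> s" if "0 < s" "s < 1" for s :: real
    using powr_mono'[of 1 p s] that p by simp
  consider "x = 0" | "y = 0" | "x > 0" "y > 0" using xy by fastforce
  then show "((1 - t) *\<^sub>R x + t *\<^sub>R y) powr p \<le> (1 - t) * x powr p + t * y powr p"
  proof cases
    case 1
    then show ?thesis using le[of t] t xy p by (simp add: powr_mult mult_right_mono)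
  next
    case 2
    then show ?thesis using le[of "1 - t"] t xy p by (simp add: powr_mult mult_right_mono)
  next
    case 3
    then show ?thesis using convex_onD[OF powr_convex[of p], of t x y] t p by simp
  qed
qed simp

text \<open>Minkowski's inequality from convexity alone: splitting the sum with weights
  \<open>l\<close> and \<open>1 - l\<close> bounds its p-th power by \<open>l powr (1 - p)\<close>
  and \<open>(1 - l) powr (1 - p)\<close> times those of the summands. The weights are optimised
  after integration.\<close>

lemma Lp_add:
  assumes f: "Lp p f" and g: "Lp p g" and p: "p > 1"
  shows "Lp p (\<lambda>x. f x + g x)" "nrm p (\<lambda>x. f x + g x) \<le> nrm p f + nrm p g"
proof -
  note [measurable] = Lp_measurable[OF f] Lp_measurable[OF g]
  have key: "norm (f x + g x) powr p \<le> l powr (1 - p) * norm (f x) powr p + (1 - l) powr (1 - p) * norm (g x) powr p"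
    if l: "0 < l" "l < 1" for l x
  proof -
    have "norm (f x + g x) powr p \<le> (norm (f x) + norm (g x)) powr p"
      using p by (intro powr_mono2 norm_triangle_ineq) auto
    also have "\<dots> = ((1 - (1 - l)) *\<^sub>R (norm (f x) / l) + (1 - l) *\<^sub>R (norm (g x) / (1 - l))) powr p"
      using l by simp
    also have "\<dots> \<le> (1 - (1 - l)) * (norm (f x) / l) powr p + (1 - l) * (norm (g x) / (1 - l)) powr p"
      by (rule convex_onD[OF convex_on_powr_nonneg]) (use l p in auto)
    also have "\<dots> = l powr (1 - p) * norm (f x) powr p + (1 - l) powr (1 - p) * norm (g x) powr p"
      using l by (simp add: powr_divide powr_diff)
    finally show ?thesis .
  qed
  have i: "integrable lborel (\<lambda>x. norm (f x) powr p)" "integrable lborel (\<lambda>x. norm (g x) powr p)"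
    using f g by (auto simp: Lp_def)
  have int: "integrable lborel (\<lambda>x. norm (f x + g x) powr p)"
    by (rule Bochner_Integration.integrable_bound[of _ "\<lambda>x. (1/2) powr (1 - p) * norm (f x) powr p + (1 - 1/2) powr (1 - p) * norm (g x) powr p"])
       (use i key[of "1/2"] in auto)
  then show "Lp p (\<lambda>x. f x + g x)" by (simp add: Lp_def)
  show "nrm p (\<lambda>x. f x + g x) \<le> nrm p f + nrm p g"
  proof (cases "nrm p f = 0 \<or> nrm p g = 0")
    case True
    then show ?thesis
    proof
      assume z: "nrm p f = 0"
      then have "AE x in lborel. f x + g x = g x" using nrm_zero_AE[OF f] by (auto elim!: eventually_mono)
      then show ?thesis using nrm_cong_AE[of "\<lambda>x. f x + g x" g p] z by simp
    next
      assume z: "nrm p g = 0"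
      then have "AE x in lborel. f x + g x = f x" using nrm_zero_AE[OF g] by (auto elim!: eventually_mono)
      then show ?thesis using nrm_cong_AE[of "\<lambda>x. f x + g x" f p] z by simp
    qed
  next
    case False
    define a b where "a = nrm p f" and "b = nrm p g"
    have ab: "a > 0" "b > 0" using False nrm_nonneg[of p f] nrm_nonneg[of p g] by (auto simp: a_def b_def)
    \<comment> \<open>Weights proportional to the norms make the two terms add up to
      \<open>(a + b) powr p\<close>.\<close>
    define l where "l = a / (a + b)"
    have aux: "(c / s) powr (1 - p) * c powr p = s powr p * (c / s)" if "c > 0" "s > 0" for c s :: real
      using that by (simp add: powr_diff powr_divide)
    have l: "0 < l" "l < 1" "1 - l = b / (a + b)" using ab by (auto simp: l_def divide_simps)
    show ?thesis
    proof (rule nrm_leI)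
      have "(LBINT x. norm (f x + g x) powr p) \<le> (LBINT x. l powr (1 - p) * norm (f x) powr p + (1 - l) powr (1 - p) * norm (g x) powr p)"
        by (intro integral_mono int key l) (use i in auto)
      also have "\<dots> = l powr (1 - p) * a powr p + (1 - l) powr (1 - p) * b powr p"
        using i p by (simp add: a_def b_def nrm_powr)
      also have "l powr (1 - p) * a powr p = (a + b) powr p * l"
        unfolding l_def using ab by (intro aux) auto
      also have "(1 - l) powr (1 - p) * b powr p = (a + b) powr p * (1 - l)"
        unfolding l(3) using ab by (intro aux) auto
      finally show "(LBINT x. norm (f x + g x) powr p) \<le> (nrm p f + nrm p g) powr p"
        by (simp add: a_def b_def algebra_simps)
    qed (use p in \<open>auto intro: add_nonneg_nonneg nrm_nonneg\<close>)
  qed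
qed

lemma Lp_diff:
  fixes f g :: "real^'n::finite \<Rightarrow> 'b::{real_normed_field, banach, second_countable_topology}"
  assumes f: "Lp p f" and g: "Lp p g" and p: "p > 1"
  shows "Lp p (\<lambda>x. f x - g x)" "nrm p (\<lambda>x. f x - g x) \<le> nrm p f + nrm p g"
  using Lp_add[OF f Lp_cmult(1)[OF g, of "-1"] p] Lp_cmult(2)[OF g, of "-1"] p by auto

lemma Lp_zero: "Lp p (\<lambda>x. 0)" "p > 0 \<Longrightarrow> nrm p (\<lambda>x. 0) = 0"
  by (auto simp: Lp_def nrm_def)

lemma Lp_sum:
  assumes p: "p > 1" and "finite I" and "\<And>i. i \<in> I \<Longrightarrow> Lp p (f i)"
  shows "Lp p (\<lambda>x. \<Sum>i\<in>I. f i x) \<and> nrm p (\<lambda>x. \<Sum>i\<in>I. f i x) \<le> (\<Sum>i\<in>I. nrm p (f i))"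
  using assms(2,3)
proof (induction I rule: finite_induct)
  case (insert i I)
  then show ?case
    using Lp_add[of p "f i" "\<lambda>x. \<Sum>i\<in>I. f i x"] p by (auto intro: order_trans)
qed (use p in \<open>auto simp: Lp_zero\<close>)

subsection \<open>Convolution\<close>

lemma conv_pair_integrable:
  fixes K g :: "real^'n::finite \<Rightarrow> 'b::{real_normed_field, banach, second_countable_topology}"
  assumes K: "integrable lborel K" and g: "integrable lborel g"
  shows "integrable (lborel \<Otimes>\<^sub>M lborel) (\<lambda>(x, y). K (x - y) * g y)"
proof -
  have Km[measurable]: "K \<in> borel_measurable borel" and [measurable]: "g \<in> borel_measurable borel"
    using K g by (auto dest: borel_measurable_integrable)
  have "integrable (lborel \<Otimes>\<^sub>M lborel) (\<lambda>(y, x). K (x - y) * g y)"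
  proof (rule lborel_pair.Fubini_integrable)
    have "(LINT x|lborel. norm (case (y, x) of (y, x) \<Rightarrow> K (x - y) * g y)) = (LINT x|lborel. norm (K x)) * norm (g y)" for y
      using lborel_integral_translate(1)[of "\<lambda>x. norm (K x)" "- y"] by (simp add: norm_mult)
    then show "integrable lborel (\<lambda>y. LINT x|lborel. norm (case (y, x) of (y, x) \<Rightarrow> K (x - y) * g y))"
      using g by simp
    show "AE y in lborel. integrable lborel (\<lambda>x. case (y, x) of (y, x) \<Rightarrow> K (x - y) * g y)"
      using lborel_integrable_translate(1)[of K "- y" for y] K by simp
  qed measurable
  from lborel_pair.integrable_product_swap[OF this] show ?thesis by (simp add: split_beta')
qed

lemma conv_measurable[measurable]:
  assumes [measurable]: "K \<in> borel_measurable borel" "f \<in> borel_measurable borel"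
  shows "conv K f \<in> borel_measurable borel"
proof -
  have "(\<lambda>x. LBINT y. K (x - y) * f y) \<in> borel_measurable lborel"
    by (rule lborel.borel_measurable_lebesgue_integral) measurable
  then show ?thesis by (simp add: conv_def[abs_def])
qed

lemma conv_integrable:
  fixes K g :: "real^'n::finite \<Rightarrow> 'b::{real_normed_field, banach, second_countable_topology}"
  assumes K: "integrable lborel K" and g: "integrable lborel g"
  shows "AE x in lborel. integrable lborel (\<lambda>y. K (x - y) * g y)"
    and "integrable lborel (conv K g)"
    and "(LBINT x. conv K g x) = (LBINT x. K x) * (LBINT x. g x)"
proof -
  have [measurable]: "K \<in> borel_measurable borel" using K by (auto dest: borel_measurable_integrable)
  note i = conv_pair_integrable[OF K g]
  show "AE x in lborel. integrable lborel (\<lambda>y. K (x - y) * g y)"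
    using lborel_pair.AE_integrable_fst'[OF i] by simp
  show "integrable lborel (conv K g)"
    using lborel_pair.integrable_fst'[OF i] by (simp add: conv_def[abs_def])
  have "(LBINT x. conv K g x) = (LBINT y. (LBINT x. K (x - y) * g y))"
    unfolding conv_def using lborel_pair.Fubini_integral[of "\<lambda>x y. K (x - y) * g y"] i by simp
  also have "\<dots> = (LBINT y. (LBINT x. K x) * g y)"
    using lborel_integral_translate(1)[of K "- y" for y] by simp
  finally show "(LBINT x. conv K g x) = (LBINT x. K x) * (LBINT x. g x)"
    by simp
qed

text \<open>The convex function \<open>t powr p\<close> lies above its tangent at \<mu>, here
  multiplied out. With \<mu> a mean value it yields Jensen's inequality.\<close>

lemma powr_tangent:
  fixes t \<mu> p :: real
  assumes "p > 1" "t \<ge> 0" "\<mu> \<ge> 0"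
  shows "p * \<mu> powr (p - 1) * t \<le> t powr p + (p - 1) * \<mu> powr p"
proof -
  define q where "q = p / (p - 1)"
  have "t * \<mu> powr (p - 1) \<le> t powr p / p + (\<mu> powr (p - 1)) powr q / q"
    by (rule Youngs_inequality) (use assms in \<open>auto simp: q_def field_simps\<close>)
  also have "(\<mu> powr (p - 1)) powr q = \<mu> powr p"
    using assms by (simp add: powr_powr q_def)
  finally have "p * (t * \<mu> powr (p - 1)) \<le> p * (t powr p / p + \<mu> powr p / q)"
    using assms by (intro mult_left_mono) auto
  moreover have "p * (A / p + B / q) = A + (p - 1) * B" for A B
    using assms by (simp add: q_def field_simps)
  ultimately show ?thesis by (simp only: mult_ac)
qed

text \<open>Jensen's inequality for the measure with density \<open>norm (K (x - y))\<close> bounds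
  the p-th power of the convolution by \<open>k powr (p - 1)\<close> times the convolution of
  \<open>norm K\<close> with the p-th power of \<open>norm f\<close>. The latter is integrable by
  the \<open>L\<^sup>1\<close> case.\<close>

theorem Young_inequality:
  fixes K f :: "real^'n::finite \<Rightarrow> 'b::{real_normed_field, banach, second_countable_topology}"
  assumes K: "integrable lborel K" and f: "Lp p f" and p: "p > 1"
  shows "AE x in lborel. integrable lborel (\<lambda>y. K (x - y) * f y)"
    and "Lp p (conv K f)"
    and "nrm p (conv K f) \<le> (LBINT x. norm (K x)) * nrm p f"
proof -
  have [measurable]: "K \<in> borel_measurable borel" "f \<in> borel_measurable borel"
    using K f by (auto dest: borel_measurable_integrable simp: Lp_def)
  define k where "k = (LBINT x. norm (K x))"
  have k0: "k \<ge> 0" by (simp add: k_def)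
  have nK: "integrable lborel (\<lambda>x. norm (K x))" using K by simp
  have np: "integrable lborel (\<lambda>x. norm (f x) powr p)" using f by (simp add: Lp_def)
  define P where "P = conv (\<lambda>x. norm (K x)) (\<lambda>x. norm (f x) powr p)"
  have P: "integrable lborel P" "(LBINT x. P x) = k * nrm p f powr p"
    using conv_integrable(2,3)[OF nK np] p by (auto simp: P_def k_def nrm_powr)
  have P0: "P x \<ge> 0" for x by (auto simp: P_def conv_def)
  have main: "AE x in lborel. integrable lborel (\<lambda>y. K (x - y) * f y) \<and> norm (conv K f x) powr p \<le> k powr (p - 1) * P x"
    using conv_integrable(1)[OF nK np]
  proof eventually_elim
    case (elim x)
    have kx: "integrable lborel (\<lambda>y. norm (K (x - y)))"
      using lborel_integrable_translate(3)[of "\<lambda>y. norm (K y)" x] nK by simp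
    have kxi: "(LBINT y. norm (K (x - y))) = k"
      using lborel_integral_translate(3)[of "\<lambda>y. norm (K y)" x] by (simp add: k_def)
    \<comment> \<open>Controls the first power by the p-th, so the integrand inherits integrability
      from the \<open>L\<^sup>1\<close> convolution \<open>P\<close>.\<close>
    have t1: "t \<le> 1 + t powr p" if "t \<ge> 0" for t :: real
    proof -
      have "p * t \<le> t powr p + (p - 1)" using powr_tangent[OF p that, of 1] by simp
      also have "\<dots> \<le> p * (1 + t powr p)"
        using mult_right_mono[of 1 p "t powr p"] p by (simp add: ring_distribs)
      finally show ?thesis using p by simp
    qed
    have i: "integrable lborel (\<lambda>y. norm (K (x - y)) * norm (f y))"
    proof (rule Bochner_Integration.integrable_bound)
      show "integrable lborel (\<lambda>y. norm (K (x - y)) + norm (K (x - y)) * norm (f y) powr p)"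
        using kx elim by simp
      have "norm (K (x - y)) * norm (f y) \<le> norm (K (x - y)) * (1 + norm (f y) powr p)" for y
        by (intro mult_left_mono t1) auto
      then show "AE y in lborel. norm (norm (K (x - y)) * norm (f y)) \<le> norm (norm (K (x - y)) + norm (K (x - y)) * norm (f y) powr p)"
        by (intro AE_I2) (simp add: ring_distribs)
    qed measurable
    then have i': "integrable lborel (\<lambda>y. K (x - y) * f y)"
      by (subst integrable_norm_iff[symmetric]) (auto simp: norm_mult)
    define a where "a = (LBINT y. norm (K (x - y)) * norm (f y))"
    have a0: "a \<ge> 0" by (simp add: a_def)
    have "norm (conv K f x) \<le> a"
      unfolding conv_def a_def by (rule integral_norm_bound[THEN order_trans]) (simp add: norm_mult)
    then have "norm (conv K f x) powr p \<le> a powr p"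
      using p by (intro powr_mono2) auto
    also have "a powr p \<le> k powr (p - 1) * P x"
    proof (cases "k = 0")
      case True
      have "AE y in lborel. norm (K (x - y)) = 0"
        using kxi True integral_nonneg_eq_0_iff_AE[OF kx] by simp
      then have "a = (\<integral>y. 0 \<partial>(lborel :: (real^'n) measure))"
        unfolding a_def by (intro integral_cong_AE) (auto elim!: eventually_mono)
      then show ?thesis using P0 p by simp
    next
      case False
      then have k: "k > 0" using k0 by simp
      \<comment> \<open>The mean of \<open>norm f\<close> with respect to the kernel; the tangent
        taken there makes the linear terms cancel after integration.\<close>
      define \<mu> where "\<mu> = a / k"
      have \<mu>: "\<mu> \<ge> 0" "a = k * \<mu>" using k a0 by (auto simp: \<mu>_def)
      have "(LBINT y. p * \<mu> powr (p - 1) * (norm (K (x - y)) * norm (f y)))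
         \<le> (LBINT y. norm (K (x - y)) * norm (f y) powr p + (p - 1) * \<mu> powr p * norm (K (x - y)))"
      proof (rule integral_mono)
        fix y
        have "norm (K (x - y)) * (p * \<mu> powr (p - 1) * norm (f y)) \<le> norm (K (x - y)) * (norm (f y) powr p + (p - 1) * \<mu> powr p)"
          by (intro mult_left_mono powr_tangent p \<mu>) auto
        then show "p * \<mu> powr (p - 1) * (norm (K (x - y)) * norm (f y)) \<le> norm (K (x - y)) * norm (f y) powr p + (p - 1) * \<mu> powr p * norm (K (x - y))"
          by (simp add: algebra_simps)
      qed (use i elim kx in auto)
      also have "\<dots> = P x + (p - 1) * \<mu> powr p * k"
        using elim kx kxi by (simp add: P_def conv_def)
      also have "(LBINT y. p * \<mu> powr (p - 1) * (norm (K (x - y)) * norm (f y))) = p * \<mu> powr (p - 1) * a"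
        unfolding a_def by (rule integral_mult_right_zero)
      finally have "p * (\<mu> powr (p - 1) * \<mu>) * k \<le> P x + (p - 1) * \<mu> powr p * k"
        using \<mu>(2) by (simp add: mult_ac)
      moreover have "\<mu> powr (p - 1) * \<mu> = \<mu> powr p"
        using \<mu> by (cases "\<mu> = 0") (auto simp: powr_diff)
      ultimately have "p * \<mu> powr p * k \<le> P x + (p - 1) * \<mu> powr p * k" by (simp only:)
      then have "k * \<mu> powr p \<le> P x" by (simp add: algebra_simps)
      then have "k powr (p - 1) * (k * \<mu> powr p) \<le> k powr (p - 1) * P x" by (intro mult_left_mono) auto
      moreover have "k powr (p - 1) * (k * \<mu> powr p) = a powr p"
        using k \<mu> by (simp add: powr_mult powr_diff)
      ultimately show ?thesis by simp
    qed
    finally show ?case using i' by blast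
  qed
  then show "AE x in lborel. integrable lborel (\<lambda>y. K (x - y) * f y)" by (auto elim!: eventually_mono)
  have i: "integrable lborel (\<lambda>x. norm (conv K f x) powr p)"
    by (rule Bochner_Integration.integrable_bound[of _ "\<lambda>x. k powr (p - 1) * P x"])
       (use P main P0 in \<open>auto elim!: eventually_mono\<close>)
  then show "Lp p (conv K f)" by (simp add: Lp_def)
  have "(LBINT x. norm (conv K f x) powr p) \<le> (LBINT x. k powr (p - 1) * P x)"
    by (intro integral_mono_AE i) (use P main in \<open>auto elim!: eventually_mono\<close>)
  also have "\<dots> = k powr (p - 1) * k * nrm p f powr p" using P by simp
  also have "k powr (p - 1) * k = k powr p" using k0 p by (cases "k = 0") (auto simp: powr_diff)
  finally show "nrm p (conv K f) \<le> (LBINT x. norm (K x)) * nrm p f"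
    using p k0 nrm_nonneg[of p f] by (intro nrm_leI) (auto simp: k_def[symmetric] powr_mult)
qed

lemma conv_add_AE:
  fixes K f g :: "real^'n::finite \<Rightarrow> 'b::{real_normed_field, banach, second_countable_topology}"
  assumes K: "integrable lborel K" and f: "Lp p f" and g: "Lp p g" and p: "p > 1"
  shows "AE x in lborel. conv K (\<lambda>y. f y + g y) x = conv K f x + conv K g x"
    and "AE x in lborel. conv K (\<lambda>y. f y - g y) x = conv K f x - conv K g x"
  using Young_inequality(1)[OF K f p] Young_inequality(1)[OF K g p]
  by (eventually_elim; simp add: conv_def ring_distribs)+

lemma conv_diff_AE:
  fixes K L f :: "real^'n::finite \<Rightarrow> 'b::{real_normed_field, banach, second_countable_topology}"
  assumes K: "integrable lborel K" and L: "integrable lborel L" and f: "Lp p f" and p: "p > 1"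
  shows "AE x in lborel. conv (\<lambda>y. K y - L y) f x = conv K f x - conv L f x"
  using Young_inequality(1)[OF K f p] Young_inequality(1)[OF L f p]
  by eventually_elim (simp add: conv_def ring_distribs)

lemma conv_cmult: "conv K (\<lambda>y. c * f y) x = c * conv K f x"
  "conv (\<lambda>y. c * K y) f x = c * conv K f x"
  by (simp_all add: conv_def mult.left_commute[of _ c] mult.assoc)

lemma conv_of_real: "conv (\<lambda>x. cx (K x)) (\<lambda>x. cx (f x)) x = cx (conv K f x)"
  unfolding conv_def of_real_mult[symmetric] integral_complex_of_real ..

text \<open>Fubini needs absolute convergence of the double integral. Young's inequality applied
  twice to the absolute values supplies it for almost every \<open>x\<close>.\<close>

lemma conv_assoc_AE:
  fixes K L f :: "real^'n::finite \<Rightarrow> 'b::{real_normed_field, banach, second_countable_topology}"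
  assumes K: "integrable lborel K" and L: "integrable lborel L" and f: "Lp p f" and p: "p > 1"
  shows "AE x in lborel. conv K (conv L f) x = conv (conv K L) f x"
proof -
  have [measurable]: "K \<in> borel_measurable borel" "L \<in> borel_measurable borel" "f \<in> borel_measurable borel"
    using K L f by (auto dest: borel_measurable_integrable simp: Lp_def)
  let ?k = "\<lambda>x. norm (K x)" and ?l = "\<lambda>x. norm (L x)" and ?f = "\<lambda>x. norm (f x)"
  have f': "Lp p ?f" using f by (simp add: Lp_norm_iff)
  have lf: "Lp p (conv ?l ?f)" using Young_inequality(2)[of ?l p ?f] L f' p by simp
  have "AE x in lborel. integrable lborel (\<lambda>y. ?k (x - y) * conv ?l ?f y)"
    using Young_inequality(1)[of ?k p "conv ?l ?f"] K lf p by simp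
  moreover have "AE y in lborel. integrable lborel (\<lambda>z. ?l (y - z) * ?f z)"
    using Young_inequality(1)[of ?l p ?f] L f' p by simp
  ultimately show ?thesis
  proof eventually_elim
    case (elim x)
    have aez: "AE y in lborel. integrable lborel (\<lambda>z. ?l (y - z) * ?f z)"
      using Young_inequality(1)[of ?l p ?f] L f' p by simp
    have int: "integrable (lborel \<Otimes>\<^sub>M lborel) (\<lambda>(y, z). K (x - y) * (L (y - z) * f z))"
    proof (rule lborel_pair.Fubini_integrable)
      have "(LINT z|lborel. norm (case (y, z) of (y, z) \<Rightarrow> K (x - y) * (L (y - z) * f z))) = ?k (x - y) * conv ?l ?f y" for y
        by (simp add: norm_mult conv_def)
      then show "integrable lborel (\<lambda>y. LINT z|lborel. norm (case (y, z) of (y, z) \<Rightarrow> K (x - y) * (L (y - z) * f z)))"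
        using elim by simp
      show "AE y in lborel. integrable lborel (\<lambda>z. case (y, z) of (y, z) \<Rightarrow> K (x - y) * (L (y - z) * f z))"
        using aez
      proof eventually_elim
        case (elim y)
        then have "integrable lborel (\<lambda>z. L (y - z) * f z)"
          by (subst integrable_norm_iff[symmetric]) (auto simp: norm_mult)
        then show ?case by simp
      qed
    qed measurable
    have "conv K (conv L f) x = (LBINT y. (LBINT z. K (x - y) * (L (y - z) * f z)))"
      by (simp add: conv_def)
    also have "\<dots> = (LBINT z. (LBINT y. K (x - y) * (L (y - z) * f z)))"
      using lborel_pair.Fubini_integral[of "\<lambda>y z. K (x - y) * (L (y - z) * f z)"] int by simp
    also have "\<dots> = (LBINT z. (LBINT y. K (x - z - y) * L y) * f z)"
    proof (intro Bochner_Integration.integral_cong refl)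
      fix z
      have "(LBINT y. K (x - y) * (L (y - z) * f z)) = (LBINT y. K (x - y) * L (y - z)) * f z"
        by (simp add: mult.assoc[symmetric])
      also have "(LBINT y. K (x - y) * L (y - z)) = (LBINT y. K (x - z - y) * L y)"
        using lborel_integral_translate(1)[of "\<lambda>y. K (x - y) * L (y - z)" z] by (simp add: diff_diff_eq add.commute)
      finally show "(LBINT y. K (x - y) * (L (y - z) * f z)) = (LBINT y. K (x - z - y) * L y) * f z" .
    qed
    finally show ?case by (simp add: conv_def)
  qed
qed

lemma dil_integrable:
  fixes K :: "real^'n::finite \<Rightarrow> 'b::{real_normed_field, banach, second_countable_topology}"
  assumes K: "integrable lborel K" and c: "c > 0"
  shows "integrable lborel (dil c K)" "(LBINT x. norm (dil c K x)) = (LBINT x. norm (K x))"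
    "(LBINT x. dil c K x) = (LBINT x. K x)"
proof -
  have [measurable]: "K \<in> borel_measurable borel"
    using K by (auto dest: borel_measurable_integrable)
  show "integrable lborel (dil c K)"
    using lborel_integrable_affine[of K c 0] K c by (simp add: dil_def[abs_def])
  show "(LBINT x. norm (dil c K x)) = (LBINT x. norm (K x))"
    using lborel_integral_affine[of "\<lambda>x. norm (K x)" c 0] c by (simp add: dil_def)
  show "(LBINT x. dil c K x) = (LBINT x. K x)"
    using lborel_integral_affine[of K c 0] c by (simp add: dil_def)
qed

subsection \<open>Uniform convexity\<close>

lemma powr_abs_deriv:
  fixes t p :: real
  assumes p: "p > 1"
  shows "((\<lambda>t. \<bar>t\<bar> powr p) has_real_derivative (p * sgn t * \<bar>t\<bar> powr (p - 1))) (at t)"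
proof -
  consider "t > 0" | "t < 0" | "t = 0" by linarith
  then show ?thesis
  proof cases
    case 1
    have "((\<lambda>t. t powr p) has_real_derivative (p * t powr (p - 1))) (at t)"
      using 1 by (rule has_real_derivative_powr)
    then have "((\<lambda>t. \<bar>t\<bar> powr p) has_real_derivative (p * t powr (p - 1))) (at t)"
      by (rule has_field_derivative_transform_within_open[of _ _ _ "{0<..}"]) (use 1 in auto)
    then show ?thesis using 1 by simp
  next
    case 2
    have "((\<lambda>t. (- t) powr p) has_real_derivative (p * (- t) powr (p - 1) * - 1)) (at t)"
      by (rule DERIV_chain2[OF has_real_derivative_powr]) (use 2 in \<open>auto intro!: derivative_eq_intros\<close>)
    then have "((\<lambda>t. \<bar>t\<bar> powr p) has_real_derivative (p * (- t) powr (p - 1) * - 1)) (at t)"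
      by (rule has_field_derivative_transform_within_open[of _ _ _ "{..<0}"]) (use 2 in auto)
    then show ?thesis using 2 by simp
  next
    case 3
    have "((\<lambda>h. \<bar>h\<bar> powr p / h) \<longlongrightarrow> 0) (at 0)"
    proof (rule Lim_null_comparison)
      have "((\<lambda>h::real. \<bar>h\<bar> powr (p - 1)) \<longlongrightarrow> \<bar>0\<bar> powr (p - 1)) (at 0)"
        using p by (intro tendsto_powr' tendsto_rabs tendsto_ident_at tendsto_const) auto
      then show "((\<lambda>h::real. \<bar>h\<bar> powr (p - 1)) \<longlongrightarrow> 0) (at 0)" by simp
      show "\<forall>\<^sub>F h in at 0. norm (\<bar>h\<bar> powr p / h) \<le> \<bar>h\<bar> powr (p - 1)"
        by (rule always_eventually) (auto simp: powr_diff abs_divide)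
    qed
    then show ?thesis using 3 by (simp add: has_field_derivative_iff)
  qed
qed

text \<open>On the interval up to \<open>M\<close> the derivative of \<open>t powr (p - 1)\<close>
  is smallest at \<open>M\<close>, since its exponent \<open>p - 2\<close> is not positive. The
  endpoint 0 is treated directly, using \<open>p - 1 \<le> 1\<close>.\<close>

lemma powr_increment:
  fixes x y M p :: real
  assumes p: "1 < p" "p \<le> 2" and "0 \<le> x" "x \<le> y" "y \<le> M"
  shows "(p - 1) * M powr (p - 2) * (y - x) \<le> y powr (p - 1) - x powr (p - 1)"
proof (cases "x = y")
  case False
  then have y: "y > 0" "x < y" using assms by auto
  have mono: "M powr (p - 2) \<le> z powr (p - 2)" if "0 < z" "z \<le> M" for z
    using that p by (intro powr_mono2') auto
  show ?thesis
  proof (cases "x = 0")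
    case True
    have "(p - 1) * M powr (p - 2) * y \<le> 1 * y powr (p - 2) * y"
      using p y assms by (intro mult_right_mono mult_mono mono) auto
    also have "\<dots> = y powr (p - 1)" using y by (simp add: powr_diff power2_eq_square)
    finally show ?thesis using True p by simp
  next
    case False
    then have x: "x > 0" using assms by simp
    obtain z where z: "x < z" "z < y" "y powr (p - 1) - x powr (p - 1) = (y - x) * ((p - 1) * z powr (p - 1 - 1))"
      using MVT2[OF y(2), of "\<lambda>t. t powr (p - 1)" "\<lambda>t. (p - 1) * t powr (p - 1 - 1)"] x
        has_real_derivative_powr[of _ "p - 1"] by force
    have "(y - x) * ((p - 1) * M powr (p - 2)) \<le> (y - x) * ((p - 1) * z powr (p - 2))"
      using z x assms by (intro mult_left_mono mono) auto
    then show ?thesis using z(3) by (simp add: mult_ac)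
  qed
qed simp

text \<open>\<open>k\<close> is half the least second derivative of
  \<open>\<bar>t\<bar> powr p\<close> on the interval, so subtracting \<open>k * t\<^sup>2\<close>
  keeps the function convex; the midpoint defect of the square is the gain. Convexity is read off a
  monotone first derivative, because at 0 no second derivative exists when
  \<open>p < 2\<close>.\<close>

lemma powr_midpoint:
  fixes a b p :: real
  assumes p: "1 < p" "p \<le> 2"
  shows "\<bar>(a + b) / 2\<bar> powr p + p * (p - 1) / 8 * ((a - b)\<^sup>2 * (\<bar>a\<bar> + \<bar>b\<bar>) powr (p - 2)) \<le> (\<bar>a\<bar> powr p + \<bar>b\<bar> powr p) / 2"
proof -
  define M where "M = \<bar>a\<bar> + \<bar>b\<bar>"
  define k where "k = p * (p - 1) / 2 * M powr (p - 2)"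
  define \<psi> where "\<psi> t = \<bar>t\<bar> powr p - k * t\<^sup>2" for t
  define g where "g t = p * (t powr (p - 1) - (p - 1) * M powr (p - 2) * t)" for t
  have g0: "g 0 = 0" by (simp add: g_def)
  have gm: "g x \<le> g y" if "0 \<le> x" "x \<le> y" "y \<le> M" for x y
  proof -
    have "x powr (p - 1) - (p - 1) * M powr (p - 2) * x \<le> y powr (p - 1) - (p - 1) * M powr (p - 2) * y"
      using powr_increment[OF p that] by (simp add: right_diff_distrib)
    then show ?thesis unfolding g_def using p by (intro mult_left_mono) auto
  qed
  have cvx: "convex_on {-M..M} \<psi>"
  proof (rule convex_on_realI[where f' = "\<lambda>t. sgn t * g \<bar>t\<bar>"])
    show "(\<psi> has_real_derivative sgn t * g \<bar>t\<bar>) (at t)" for t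
    proof -
      have "(\<psi> has_real_derivative (p * sgn t * \<bar>t\<bar> powr (p - 1) - k * (2 * t))) (at t)"
        unfolding \<psi>_def
        by (rule DERIV_diff[OF powr_abs_deriv[OF p(1)]]) (auto intro!: derivative_eq_intros)
      moreover have "p * sgn t * \<bar>t\<bar> powr (p - 1) - k * (2 * t) = sgn t * g \<bar>t\<bar>"
      proof -
        have "sgn t * \<bar>t\<bar> = t" by (simp add: sgn_if)
        have "sgn t * g \<bar>t\<bar> = p * sgn t * \<bar>t\<bar> powr (p - 1) - p * (p - 1) * M powr (p - 2) * (sgn t * \<bar>t\<bar>)"
          by (simp add: g_def algebra_simps)
        then show ?thesis unfolding \<open>sgn t * \<bar>t\<bar> = t\<close> by (simp add: k_def)
      qed
      ultimately show ?thesis by simp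
    qed
    fix x y assume xy: "x \<in> {-M..M}" "y \<in> {-M..M}" "x \<le> y"
    consider "0 \<le> x" | "x < 0" "0 \<le> y" | "y < 0" using xy by linarith
    then show "sgn x * g \<bar>x\<bar> \<le> sgn y * g \<bar>y\<bar>"
    proof cases
      case 1
      then show ?thesis using gm[of x y] g0 gm[of 0 y] xy by (auto simp: sgn_if)
    next
      case 2
      then show ?thesis using gm[of 0 "- x"] gm[of 0 y] g0 xy by (auto simp: sgn_if)
    next
      case 3
      then show ?thesis using gm[of "- y" "- x"] xy by (auto simp: sgn_if)
    qed
  qed auto
  have "\<psi> ((a + b) / 2) \<le> (\<psi> a + \<psi> b) / 2"
  proof -
    have "a \<in> {-M..M}" "b \<in> {-M..M}" by (auto simp: M_def)
    from convex_onD[OF cvx _ _ this, of "1/2"] show ?thesis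
      by (simp add: add_divide_distrib)
  qed
  moreover have "k * a\<^sup>2 / 2 + k * b\<^sup>2 / 2 - k * ((a + b) / 2)\<^sup>2 = k / 4 * (a - b)\<^sup>2"
    by (simp add: power2_eq_square field_simps)
  moreover have "k / 4 * (a - b)\<^sup>2 = p * (p - 1) / 8 * ((a - b)\<^sup>2 * (\<bar>a\<bar> + \<bar>b\<bar>) powr (p - 2))"
    by (simp add: k_def M_def)
  ultimately show ?thesis by (simp add: \<psi>_def field_simps)
qed

text \<open>Divide \<open>X\<close> and \<open>Y\<close> by their integrals, apply the weighted
  arithmetic-geometric mean inequality pointwise and integrate.\<close>

lemma Hoelder_interpolation:
  fixes X Y :: "'a::euclidean_space \<Rightarrow> real"
  assumes X: "integrable lborel X" "\<And>x. X x \<ge> 0" and Y: "integrable lborel Y" "\<And>x. Y x \<ge> 0"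
    and Z: "\<And>x. Z x \<le> X x powr \<theta> * Y x powr (1 - \<theta>)" "Z \<in> borel_measurable borel"
    and \<theta>: "0 < \<theta>" "\<theta> \<le> 1" and J: "(LBINT x. Y x) > 0"
  shows "(LBINT x. Z x) \<le> (LBINT x. X x) powr \<theta> * (LBINT x. Y x) powr (1 - \<theta>)"
proof -
  define I J where "I = (LBINT x. X x)" and "J = (LBINT x. Y x)"
  have I0: "I \<ge> 0" unfolding I_def using X by simp
  have J0: "J > 0" using J by (simp add: J_def)
  show ?thesis
  proof (cases "I = 0")
    case True
    then have "AE x in lborel. X x = 0"
      using X by (subst (asm) I_def, subst (asm) integral_nonneg_eq_0_iff_AE) auto
    then have "AE x in lborel. Z x \<le> 0"
    proof eventually_elim
      case (elim x)
      then show ?case using Z(1)[of x] \<theta> by simp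
    qed
    then have "(LBINT x. Z x) \<le> 0" by (metis (mono_tags, lifting) integral_nonneg_AE eventually_mono neg_0_le_iff_le integral_minus)
    then show ?thesis by (smt (verit) powr_ge_zero mult_nonneg_nonneg)
  next
    case False
    then have I: "I > 0" using I0 by simp
    have le: "Z x \<le> I powr \<theta> * J powr (1 - \<theta>) * (\<theta> * (X x / I) + (1 - \<theta>) * (Y x / J))" for x
    proof (cases "X x = 0 \<or> Y x = 0")
      case True
      then have "Z x \<le> 0" using Z(1)[of x] \<theta> by auto
      moreover have "0 \<le> I powr \<theta> * J powr (1 - \<theta>) * (\<theta> * (X x / I) + (1 - \<theta>) * (Y x / J))"
        using \<theta> X(2)[of x] Y(2)[of x] I J0 by (intro mult_nonneg_nonneg add_nonneg_nonneg) auto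
      ultimately show ?thesis by linarith
    next
      case False
      then have xy: "X x > 0" "Y x > 0" using X(2)[of x] Y(2)[of x] by auto
      have "Z x \<le> I powr \<theta> * J powr (1 - \<theta>) * ((X x / I) powr \<theta> * (Y x / J) powr (1 - \<theta>))"
        using Z(1)[of x] I J0 xy by (simp add: powr_divide)
      also have "\<dots> \<le> I powr \<theta> * J powr (1 - \<theta>) * (\<theta> * (X x / I) + (1 - \<theta>) * (Y x / J))"
        by (intro mult_left_mono Youngs_inequality_0) (use \<theta> xy I J0 in auto)
      finally show ?thesis .
    qed
    have "(LBINT x. Z x) \<le> (LBINT x. I powr \<theta> * J powr (1 - \<theta>) * (\<theta> * (X x / I) + (1 - \<theta>) * (Y x / J)))"
      by (rule integral_mono_AE')
         (use X Y le in \<open>auto intro!: AE_I2 mult_nonneg_nonneg add_nonneg_nonneg divide_nonneg_nonneg simp: I0 J0 less_imp_le \<theta>\<close>)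
    also have "\<dots> = I powr \<theta> * J powr (1 - \<theta>)"
      using X Y I J0 by (simp add: I_def[symmetric] J_def[symmetric])
    finally show ?thesis by (simp add: I_def J_def)
  qed
qed

text \<open>Integrating \<open>powr_midpoint\<close> produces the energy \<open>X\<close>, with
  weight \<open>(\<bar>F\<bar> + \<bar>G\<bar>) powr (p - 2)\<close>. The p-th power of the
  difference equals \<open>X powr (p/2) * Y powr (1 - p/2)\<close>, as the weights cancel, so
  Hoelder recovers its norm. The factor \<open>2 powr (p - 2)\<close> stems from the norm of the
  weight, at most \<open>2 * N\<close>.\<close>

theorem uniform_convexity:
  fixes F G :: "real^'n::finite \<Rightarrow> real"
  assumes p: "1 < p" "p \<le> 2" and F: "Lp p F" and G: "Lp p G" and le: "nrm p G \<le> nrm p F"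
  shows "nrm p (\<lambda>x. (F x + G x) / 2) powr p + p * (p - 1) / 8 * 2 powr (p - 2) * (nrm p (\<lambda>x. F x - G x))\<^sup>2 * nrm p F powr (p - 2) \<le> nrm p F powr p"
proof -
  note [measurable] = Lp_measurable[OF F] Lp_measurable[OF G]
  define N where "N = nrm p F"
  define c where "c = p * (p - 1) / 8"
  have c0: "c > 0" using p by (simp add: c_def)
  have iF: "integrable lborel (\<lambda>x. \<bar>F x\<bar> powr p)" and iG: "integrable lborel (\<lambda>x. \<bar>G x\<bar> powr p)"
    using F G by (auto simp: Lp_def)
  have FG: "Lp p (\<lambda>x. (F x + G x) / 2)"
    using Lp_cmult(1)[OF Lp_add(1)[OF F G p(1)], of "1/2"] p by simp
  have D: "Lp p (\<lambda>x. F x - G x)" using Lp_diff[OF F G p(1)] by simp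
  define X where "X x = (F x - G x)\<^sup>2 * (\<bar>F x\<bar> + \<bar>G x\<bar>) powr (p - 2)" for x
  define Y where "Y x = (\<bar>F x\<bar> + \<bar>G x\<bar>) powr p" for x
  have [measurable]: "X \<in> borel_measurable borel" "Y \<in> borel_measurable borel"
    unfolding X_def Y_def by measurable
  have mid: "\<bar>(F x + G x) / 2\<bar> powr p + c * X x \<le> (\<bar>F x\<bar> powr p + \<bar>G x\<bar> powr p) / 2" for x
    unfolding X_def c_def by (rule powr_midpoint[OF p])
  have X0: "X x \<ge> 0" for x by (simp add: X_def)
  have Y0: "Y x \<ge> 0" for x by (simp add: Y_def)
  have iX: "integrable lborel X"
  proof (rule Bochner_Integration.integrable_bound)
    show "integrable lborel (\<lambda>x. (\<bar>F x\<bar> powr p + \<bar>G x\<bar> powr p) / 2 / c)" using iF iG by simp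
    have "X x \<le> (\<bar>F x\<bar> powr p + \<bar>G x\<bar> powr p) / 2 / c" for x
    proof -
      have "c * X x \<le> (\<bar>F x\<bar> powr p + \<bar>G x\<bar> powr p) / 2" using mid[of x] powr_ge_zero[of "\<bar>(F x + G x) / 2\<bar>" p] by linarith
      then show ?thesis unfolding pos_le_divide_eq[OF c0] by (simp only: mult.commute)
    qed
    then show "AE x in lborel. norm (X x) \<le> norm ((\<bar>F x\<bar> powr p + \<bar>G x\<bar> powr p) / 2 / c)"
      using X0 by (intro AE_I2) (smt (verit) real_norm_def)
  qed measurable
  have Fa: "Lp p (\<lambda>x. \<bar>F x\<bar>)" "Lp p (\<lambda>x. \<bar>G x\<bar>)" "nrm p (\<lambda>x. \<bar>F x\<bar>) = N" "nrm p (\<lambda>x. \<bar>G x\<bar>) = nrm p G"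
    using Lp_norm_iff[of F p] Lp_norm_iff[of G p] F G nrm_norm[of p F] nrm_norm[of p G] by (auto simp: N_def)
  have S: "Lp p (\<lambda>x. \<bar>F x\<bar> + \<bar>G x\<bar>)" "nrm p (\<lambda>x. \<bar>F x\<bar> + \<bar>G x\<bar>) \<le> 2 * N"
    using Lp_add[OF Fa(1,2) p(1)] Fa(3,4) le by (auto simp: N_def)
  have iY: "integrable lborel Y" using S(1) by (simp add: Lp_def Y_def[abs_def])
  have Jle: "(LBINT x. Y x) \<le> (2 * N) powr p"
  proof -
    have "(LBINT x. Y x) = nrm p (\<lambda>x. \<bar>F x\<bar> + \<bar>G x\<bar>) powr p" using p by (simp add: nrm_powr Y_def)
    also have "\<dots> \<le> (2 * N) powr p" using S(2) p nrm_nonneg by (intro powr_mono2) auto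
    finally show ?thesis .
  qed
  have energy: "nrm p (\<lambda>x. (F x + G x) / 2) powr p + c * (LBINT x. X x) \<le> N powr p"
  proof -
    have "(LBINT x. \<bar>(F x + G x) / 2\<bar> powr p + c * X x) \<le> (LBINT x. (\<bar>F x\<bar> powr p + \<bar>G x\<bar> powr p) / 2)"
      by (intro integral_mono mid) (use FG iX iF iG in \<open>auto simp: Lp_def\<close>)
    also have "\<dots> = (N powr p + nrm p G powr p) / 2"
      using iF iG p by (simp add: N_def nrm_powr)
    also have "\<dots> \<le> N powr p" using powr_mono2[of p "nrm p G" N] le p nrm_nonneg[of p G] by (simp add: N_def)
    also have "(LBINT x. \<bar>(F x + G x) / 2\<bar> powr p + c * X x) = nrm p (\<lambda>x. (F x + G x) / 2) powr p + c * (LBINT x. X x)"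
      using FG iX p by (subst Bochner_Integration.integral_add) (auto simp: Lp_def nrm_powr)
    finally show ?thesis .
  qed
  have N0: "N \<ge> 0" by (simp add: N_def nrm_nonneg)
  show ?thesis
  proof (cases "N = 0")
    case True
    have "c * (LBINT x. X x) \<ge> 0" using c0 X0 by simp
    then have "nrm p (\<lambda>x. (F x + G x) / 2) powr p \<le> N powr p" using energy by linarith
    then show ?thesis using True by (simp add: N_def)
  next
    case False
    then have N: "N > 0" using N0 by simp
    have "N powr p \<le> (LBINT x. Y x)"
      unfolding N_def nrm_powr[OF less_imp_neq[OF less_trans[OF zero_less_one p(1)], symmetric]]
      unfolding real_norm_def by (rule integral_mono[OF iF iY]) (use p in \<open>auto simp: Y_def intro!: powr_mono2\<close>)
    then have Jpos: "(LBINT x. Y x) > 0" using N by (smt (verit) powr_gt_zero)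
    define I where "I = (LBINT x. X x)"
    have I0: "I \<ge> 0" by (simp add: I_def X0)
    have "(LBINT x. \<bar>F x - G x\<bar> powr p) \<le> I powr (p/2) * (LBINT x. Y x) powr (1 - p/2)"
      unfolding I_def
    proof (rule Hoelder_interpolation[OF iX X0 iY Y0 _ _ _ _ Jpos])
      fix x
      show "\<bar>F x - G x\<bar> powr p \<le> X x powr (p/2) * Y x powr (1 - p/2)"
      proof (cases "F x = G x")
        case False
        define s d where "s = \<bar>F x\<bar> + \<bar>G x\<bar>" and "d = \<bar>F x - G x\<bar>"
        have sd: "s > 0" "d > 0" using False by (auto simp: s_def d_def)
        have "X x powr (p/2) * Y x powr (1 - p/2) = (d powr 2 * s powr (p - 2)) powr (p/2) * (s powr p) powr (1 - p/2)"
          using sd by (simp add: X_def Y_def s_def d_def)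
        also have "\<dots> = d powr p * (s powr ((p - 2) * (p/2)) * s powr (p * (1 - p/2)))"
          using sd by (simp add: powr_mult powr_powr del: powr_numeral)
        also have "s powr ((p - 2) * (p/2)) * s powr (p * (1 - p/2)) = 1"
          using sd by (simp add: powr_add[symmetric] algebra_simps diff_divide_distrib)
        finally show ?thesis by (simp add: d_def)
      qed (use p in auto)
    qed (use p in auto)
    also have "\<dots> \<le> I powr (p/2) * ((2 * N) powr p) powr (1 - p/2)"
      using p Jpos Jle by (intro mult_left_mono powr_mono2) auto
    finally have "(LBINT x. \<bar>F x - G x\<bar> powr p) \<le> I powr (p/2) * ((2 * N) powr p) powr (1 - p/2)" .
    then have "nrm p (\<lambda>x. F x - G x) powr p \<le> I powr (p/2) * ((2 * N) powr p) powr (1 - p/2)"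
      using p by (simp add: nrm_powr)
    then have "(nrm p (\<lambda>x. F x - G x) powr p) powr (2/p) \<le> (I powr (p/2) * ((2 * N) powr p) powr (1 - p/2)) powr (2/p)"
      using p by (intro powr_mono2) auto
    also have "\<dots> = I * (2 * N) powr (2 - p)"
      using p I0 N by (simp add: powr_mult powr_powr right_diff_distrib diff_divide_distrib)
    also have "(nrm p (\<lambda>x. F x - G x) powr p) powr (2/p) = (nrm p (\<lambda>x. F x - G x))\<^sup>2"
      using p nrm_nonneg[of p "\<lambda>x. F x - G x"] by (simp add: powr_powr)
    finally have "(nrm p (\<lambda>x. F x - G x))\<^sup>2 * (2 * N) powr (p - 2) \<le> I * (2 * N) powr (2 - p) * (2 * N) powr (p - 2)"
      by (intro mult_right_mono) auto
    also have "\<dots> = I" using N by (simp add: powr_add[symmetric] mult.assoc)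
    finally have "c * ((nrm p (\<lambda>x. F x - G x))\<^sup>2 * (2 * N) powr (p - 2)) \<le> c * I"
      using c0 by (intro mult_left_mono) auto
    then show ?thesis
      using energy N by (simp add: I_def[symmetric] N_def[symmetric] c_def[symmetric] powr_mult mult_ac)
  qed
qed

section \<open>A Littlewood--Paley inequality\<close>

lemma tf_translate:
  fixes f :: "'a::euclidean_space \<Rightarrow> real"
  assumes "tf f"
  shows "tf (\<lambda>x. f (x - a))"
proof (rule test_funI[of _ "(\<lambda>x. a + x) ` fsupport f"])
  show "smooth_fun (\<lambda>x. f (x - a))" using smooth_fun_affine[OF tf_smooth[OF assms], of 1 "- a"] by simp
  show "compact ((+) a ` fsupport f)"
    using assms by (intro compact_translation) (simp add: test_fun_def)
  show "f (x - a) = 0" if "x \<notin> (+) a ` fsupport f" for x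
  proof -
    have "x - a \<notin> fsupport f"
    proof
      assume "x - a \<in> fsupport f"
      then have "a + (x - a) \<in> (+) a ` fsupport f" by blast
      then show False using that by simp
    qed
    then show ?thesis by (rule fsupport_zero)
  qed
qed auto

lemma admissible_tf: "admissible_phi0 \<phi>0 \<Longrightarrow> tf \<phi>0"
  by (auto simp: admissible_phi0_def intro: tf_UNIV)

lemma admissible_zero:
  fixes \<phi>0 :: "real^'n::finite \<Rightarrow> real"
  assumes "admissible_phi0 \<phi>0" "norm \<xi> \<ge> 19/10"
  shows "\<phi>0 \<xi> = 0"
proof (rule fsupport_zero[of _ \<phi>0])
  have "fsupport \<phi>0 \<subseteq> ball 0 (19/10)" using assms(1) unfolding admissible_phi0_def test_fun_def by blast
  then show "\<xi> \<notin> fsupport \<phi>0" using assms(2) by auto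
qed

lemma admissible_one:
  fixes \<phi>0 :: "real^'n::finite \<Rightarrow> real"
  assumes "admissible_phi0 \<phi>0" "norm \<xi> < 11/10"
  shows "\<phi>0 \<xi> = 1"
proof -
  have "\<xi> \<in> ball 0 (11/10)" using assms(2) by simp
  then show ?thesis using assms(1) unfolding admissible_phi0_def by blast
qed

lemma admissible_radial:
  "admissible_phi0 \<phi>0 \<Longrightarrow> norm \<xi> = norm \<eta> \<Longrightarrow> \<phi>0 \<xi> = \<phi>0 \<eta>"
  unfolding admissible_phi0_def by blast

text \<open>A kernel whose averages contract every \<open>L\<^sup>p\<close> norm must be nonnegative; squaring the
  inverse transform of a bump makes it so and keeps its spectrum compact.\<close>

lemma averaging_kernel_exists:
  fixes \<phi>0 :: "real^'n::finite \<Rightarrow> real"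
  assumes \<phi>0: "admissible_phi0 \<phi>0"
  obtains K :: "real^'n \<Rightarrow> real" where "integrable lborel K" "\<And>x. K x \<ge> 0" "(LBINT x. K x) = 1"
    "integrable lborel (\<lambda>x. norm x * K x)"
    "\<And>\<xi>. norm \<xi> \<ge> 1/2 \<Longrightarrow> (LBINT x. cx (K x) * cis (2 * pi * (x \<bullet> \<xi>))) = 0"
proof -
  \<comment> \<open>With the factor 8 the bump vanishes from radius 19/80 on, so the
    autocorrelation, the spectrum of the square, lives inside radius 19/40 < 1/2.\<close>
  define \<psi> where "\<psi> \<xi> = \<phi>0 (8 *\<^sub>R \<xi>)" for \<xi>
  have tp: "tf \<psi>" unfolding \<psi>_def by (rule tf_scale[OF admissible_tf[OF \<phi>0]]) simp
  have ev: "\<psi> (- \<xi>) = \<psi> \<xi>" for \<xi> unfolding \<psi>_def by (rule admissible_radial[OF \<phi>0]) simp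
  have z: "\<psi> \<xi> = 0" if "norm \<xi> \<ge> 19/80" for \<xi>
    unfolding \<psi>_def by (rule admissible_zero[OF \<phi>0]) (use that in simp)
  have p0: "\<psi> 0 = 1" unfolding \<psi>_def by (rule admissible_one[OF \<phi>0]) simp
  define \<Phi> where "\<Phi> = finv \<psi>"
  have [measurable]: "\<Phi> \<in> borel_measurable borel" unfolding \<Phi>_def by (rule finv_measurable[OF tp])
  have even: "\<Phi> (- x) = \<Phi> x" for x
    unfolding \<Phi>_def using finv_reflect[OF tf_integrable[OF tp]] ev by simp
  have real: "cnj (\<Phi> x) = \<Phi> x" for x
  proof -
    have "cnj (\<Phi> x) = (LBINT \<xi>. cnj (cx (\<psi> \<xi>) * cis (2 * pi * (x \<bullet> \<xi>))))"
      unfolding \<Phi>_def finv_lborel[OF tf_integrable[OF tp]] by (rule Bochner_Integration.integral_cnj[symmetric])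
    also have "\<dots> = \<Phi> (- x)"
      unfolding \<Phi>_def finv_lborel[OF tf_integrable[OF tp]] by (simp add: cis_cnj)
    finally show ?thesis by (simp add: even)
  qed
  have sq: "cx ((norm (\<Phi> x))\<^sup>2) = \<Phi> x * \<Phi> x" for x
    using complex_norm_square[of "\<Phi> x"] real[of x] by simp
  have sq2: "cx (norm (\<Phi> x)) * cx (norm (\<Phi> x)) = \<Phi> x * \<Phi> x" for x
    using sq[of x] unfolding power2_eq_square of_real_mult .
  obtain C where C: "\<And>x. norm (\<Phi> x) \<le> C"
    using finv_bound[OF tf_integrable[OF tp]] unfolding \<Phi>_def by blast
  have rap: "rapid \<Phi>" unfolding \<Phi>_def by (rule rapid_finv[OF tp])
  have i1: "integrable lborel (\<lambda>x. norm x ^ k * (norm (\<Phi> x))\<^sup>2)" for k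
  proof (rule Bochner_Integration.integrable_bound)
    show "integrable lborel (\<lambda>x. C * (norm x ^ k * norm (\<Phi> x)))"
      by (intro integrable_mult_right rapid_integrable(2) rap)
    have "norm x ^ k * (norm (\<Phi> x))\<^sup>2 \<le> C * (norm x ^ k * norm (\<Phi> x))" for x
      using mult_right_mono[OF C[of x], of "norm x ^ k * norm (\<Phi> x)"] by (simp add: power2_eq_square mult_ac)
    moreover have "0 \<le> norm x ^ k * (norm (\<Phi> x))\<^sup>2" for x by simp
    ultimately show "AE x in lborel. norm (norm x ^ k * (norm (\<Phi> x))\<^sup>2) \<le> norm (C * (norm x ^ k * norm (\<Phi> x)))"
      by (intro AE_I2) (smt (verit) real_norm_def)
  qed measurable
  define I where "I = (LBINT x. (norm (\<Phi> x))\<^sup>2)"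
  \<comment> \<open>Otherwise the transform of \<psi> would vanish almost everywhere, and inversion
    would contradict \<open>\<psi> 0 = 1\<close>.\<close>
  have "I \<noteq> 0"
  proof
    assume "I = 0"
    then have "AE x in lborel. (norm (\<Phi> x))\<^sup>2 = 0"
      using integral_nonneg_eq_0_iff_AE[of lborel "\<lambda>x. (norm (\<Phi> x))\<^sup>2"] i1[of 0] by (simp add: I_def)
    then have "(LBINT x. \<Phi> x * cis (- (2 * pi * (x \<bullet> 0)))) = (\<integral>x. 0 \<partial>(lborel :: (real^'n) measure))"
      by (intro integral_cong_AE) auto
    then show False using fourier_inversion[OF tp, of 0] p0 by (simp add: \<Phi>_def)
  qed
  moreover have "I \<ge> 0" by (simp add: I_def)
  ultimately have I: "I > 0" by simp
  show thesis
  proof (rule that[of "\<lambda>x. (norm (\<Phi> x))\<^sup>2 / I"])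
    show "integrable lborel (\<lambda>x. (norm (\<Phi> x))\<^sup>2 / I)" using i1[of 0] by simp
    show "integrable lborel (\<lambda>x. norm x * ((norm (\<Phi> x))\<^sup>2 / I))" using i1[of 1] by simp
    show "(norm (\<Phi> x))\<^sup>2 / I \<ge> 0" for x using I by simp
    show "(LBINT x. (norm (\<Phi> x))\<^sup>2 / I) = 1" using I by (simp add: I_def[symmetric])
    fix \<xi> :: "real^'n" assume \<xi>: "norm \<xi> \<ge> 1/2"
    have tt: "tf (\<lambda>\<eta>. \<psi> (\<eta> - \<xi>))" by (rule tf_translate[OF tp])
    \<comment> \<open>A phase on the kernel shifts its symbol. The transform of the squared kernel
      at \<xi> thereby becomes the correlation of \<psi> with a translate, evaluated at 0, and the
      two supports are disjoint.\<close>
    have sh: "finv (\<lambda>\<eta>. \<psi> (\<eta> - \<xi>)) x = \<Phi> x * cis (2 * pi * (x \<bullet> \<xi>))" for x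
    proof -
      note [measurable] = tf_measurable[OF tp]
      have "finv (\<lambda>\<eta>. \<psi> (\<eta> - \<xi>)) x = (LBINT \<eta>. cx (\<psi> (\<eta> - \<xi>)) * cis (2 * pi * (x \<bullet> \<eta>)))"
        by (rule finv_lborel[OF tf_integrable[OF tt]])
      also have "\<dots> = (LBINT \<eta>. cx (\<psi> \<eta>) * cis (2 * pi * (x \<bullet> (\<eta> + \<xi>))))"
        using lborel_integral_translate(1)[of "\<lambda>\<eta>. cx (\<psi> (\<eta> - \<xi>)) * cis (2 * pi * (x \<bullet> \<eta>))" \<xi>] by simp
      also have "\<dots> = (LBINT \<eta>. (cx (\<psi> \<eta>) * cis (2 * pi * (x \<bullet> \<eta>))) * cis (2 * pi * (x \<bullet> \<xi>)))"
        by (intro Bochner_Integration.integral_cong refl) (simp add: inner_add_right ring_distribs cis_mult)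
      also have "\<dots> = \<Phi> x * cis (2 * pi * (x \<bullet> \<xi>))"
        unfolding \<Phi>_def finv_lborel[OF tf_integrable[OF tp]] by simp
      finally show ?thesis .
    qed
    have "(LBINT x. cx ((norm (\<Phi> x))\<^sup>2 / I) * cis (2 * pi * (x \<bullet> \<xi>)))
       = (LBINT x. cx (1 / I) * (finv (\<lambda>\<eta>. \<psi> (\<eta> - \<xi>)) x * finv \<psi> (0 + x)))"
      by (intro Bochner_Integration.integral_cong refl) (simp add: sh sq2 \<Phi>_def[symmetric] power2_eq_square)
    also have "\<dots> = cx (1 / I) * finv (\<lambda>\<eta>. \<psi> \<eta> * \<psi> (- \<eta> - \<xi>)) 0"
      unfolding integral_mult_right_zero finv_correlation[OF tt tp] ..
    also have "finv (\<lambda>\<eta>. \<psi> \<eta> * \<psi> (- \<eta> - \<xi>)) 0 = 0"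
    proof (rule finv_zero)
      fix \<eta> :: "real^'n"
      show "\<psi> \<eta> * \<psi> (- \<eta> - \<xi>) = 0"
      proof (cases "norm \<eta> \<ge> 19/80")
        case False
        have "norm \<xi> \<le> norm \<eta> + norm (- \<eta> - \<xi>)"
          by (metis norm_triangle_sub norm_minus_cancel norm_minus_commute minus_diff_eq add.commute diff_minus_eq_add diff_conv_add_uminus)
        then have "norm (- \<eta> - \<xi>) \<ge> 19/80" using False \<xi> by simp
        then show ?thesis using z by simp
      qed (use z in simp)
    qed
    finally show "(LBINT x. cx ((norm (\<Phi> x))\<^sup>2 / I) * cis (2 * pi * (x \<bullet> \<xi>))) = 0" by simp
  qed
qed

text \<open>The multiplier rule in a form in which \<open>K\<close> need only be integrable. The
  averaging kernel enters through the vanishing of its transform, not as the \<open>finv\<close> of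
  a test function.\<close>

lemma conv_finv:
  fixes e :: "real^'n::finite \<Rightarrow> real" and K :: "real^'n \<Rightarrow> complex"
  assumes e: "integrable lborel e" and K: "integrable lborel K"
  shows "conv K (finv e) x = (LBINT \<xi>. cx (e \<xi>) * cis (2 * pi * (x \<bullet> \<xi>)) * (LBINT w. K w * cis (2 * pi * (w \<bullet> - \<xi>))))"
proof -
  have [measurable]: "e \<in> borel_measurable borel" "K \<in> borel_measurable borel"
    using e K by (auto dest: borel_measurable_integrable)
  have Kx: "integrable lborel (\<lambda>y. norm (K (x - y)))"
    using lborel_integrable_translate(3)[of "\<lambda>y. norm (K y)" x] K by simp
  have "conv K (finv e) x = (LBINT y. (LBINT \<xi>. K (x - y) * (cx (e \<xi>) * cis (2 * pi * (y \<bullet> \<xi>)))))"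
    unfolding conv_def finv_lborel[OF e] integral_mult_right_zero ..
  also have "\<dots> = (LBINT \<xi>. (LBINT y. K (x - y) * (cx (e \<xi>) * cis (2 * pi * (y \<bullet> \<xi>)))))"
    by (rule Fubini_dominated[OF Kx, of "\<lambda>\<xi>. \<bar>e \<xi>\<bar>"]) (use e in \<open>auto simp: norm_mult\<close>)
  also have "\<dots> = (LBINT \<xi>. cx (e \<xi>) * cis (2 * pi * (x \<bullet> \<xi>)) * (LBINT w. K w * cis (2 * pi * (w \<bullet> - \<xi>))))"
  proof (intro Bochner_Integration.integral_cong refl)
    fix \<xi>
    have "(LBINT y. K (x - y) * (cx (e \<xi>) * cis (2 * pi * (y \<bullet> \<xi>))))
      = (LBINT w. K (x - (x - w)) * (cx (e \<xi>) * cis (2 * pi * ((x - w) \<bullet> \<xi>))))"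
      by (rule lborel_integral_translate(3)[symmetric]) measurable
    also have "\<dots> = (LBINT w. cx (e \<xi>) * cis (2 * pi * (x \<bullet> \<xi>)) * (K w * cis (2 * pi * (w \<bullet> - \<xi>))))"
    proof (intro Bochner_Integration.integral_cong refl)
      fix w
      have "cis (2 * pi * ((x - w) \<bullet> \<xi>)) = cis (2 * pi * (x \<bullet> \<xi>)) * cis (2 * pi * (w \<bullet> - \<xi>))"
        by (simp add: cis_mult inner_diff_left algebra_simps)
      then show "K (x - (x - w)) * (cx (e \<xi>) * cis (2 * pi * ((x - w) \<bullet> \<xi>)))
        = cx (e \<xi>) * cis (2 * pi * (x \<bullet> \<xi>)) * (K w * cis (2 * pi * (w \<bullet> - \<xi>)))" by simp
    qed
    finally show "(LBINT y. K (x - y) * (cx (e \<xi>) * cis (2 * pi * (y \<bullet> \<xi>))))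
      = cx (e \<xi>) * cis (2 * pi * (x \<bullet> \<xi>)) * (LBINT w. K w * cis (2 * pi * (w \<bullet> - \<xi>)))"
      by simp
  qed
  finally show ?thesis .
qed

lemma conv_commute:
  fixes K f :: "real^'n::finite \<Rightarrow> 'b::{real_normed_field, banach, second_countable_topology}"
  assumes [measurable]: "K \<in> borel_measurable borel" "f \<in> borel_measurable borel"
  shows "conv K f x = conv f K x"
proof -
  have "conv K f x = (LBINT y. K (x - (x - y)) * f (x - y))"
    unfolding conv_def by (rule lborel_integral_translate(3)[symmetric]) measurable
  then show ?thesis by (simp add: conv_def mult.commute)
qed

lemma conv_dil:
  fixes K f :: "real^'n::finite \<Rightarrow> 'b::{real_normed_field, banach, second_countable_topology}"
  assumes [measurable]: "K \<in> borel_measurable borel" "f \<in> borel_measurable borel" and c: "c > 0"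
  shows "conv (dil c K) (dil c f) x = dil c (conv K f) x"
proof -
  have "dil c (conv K f) x = c ^ CARD('n) *\<^sub>R (LBINT y. K (c *\<^sub>R x - y) * f y)"
    by (simp add: dil_def conv_def)
  also have "(LBINT y. K (c *\<^sub>R x - y) * f y) = c ^ CARD('n) *\<^sub>R (LBINT y. K (c *\<^sub>R x - c *\<^sub>R y) * f (c *\<^sub>R y))"
    using lborel_integral_affine[of "\<lambda>y. K (c *\<^sub>R x - y) * f y" c 0] c by simp
  finally show ?thesis
    by (simp add: dil_def conv_def scaleR_diff_right)
qed

lemma dil_dil: "a > 0 \<Longrightarrow> dil a (dil b K) = dil (a * b) K"
  by (simp add: dil_def fun_eq_iff power_mult_distrib mult_ac)

lemma dil_measurable[measurable]:
  fixes K :: "real^'n::finite \<Rightarrow> 'b::real_normed_vector"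
  assumes [measurable]: "K \<in> borel_measurable borel"
  shows "dil c K \<in> borel_measurable borel"
  unfolding dil_def[abs_def] by measurable

text \<open>For \<open>norm h \<le> 1\<close> the mean value inequality applies with a derivative of
  order (1+|x|)^(-n-1); along the segment this weight changes by at most the factor
  \<open>2 ^ Suc n\<close>, so the bound stays integrable. For larger \<open>h\<close> the triangle
  inequality suffices, since then \<open>norm h > 1\<close>.\<close>

lemma finv_translation_L1:
  fixes m :: "real^'n::finite \<Rightarrow> real"
  assumes m: "tf m"
  obtains C where "C \<ge> 0" "\<And>h. (LBINT x. norm (finv m x - finv m (x - h))) \<le> C * norm h"
proof -
  let ?N = "Suc CARD('n)"
  note [measurable] = finv_measurable[OF m]
  have tb: "tf (\<lambda>\<xi>. m \<xi> * (\<xi> \<bullet> b))" for b by (rule test_fun_mult[OF m smooth_fun_inner])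
  obtain A where A: "\<And>b x. (1 + norm x) ^ ?N * norm (finv (\<lambda>\<xi>. m \<xi> * (\<xi> \<bullet> b)) x) \<le> A b"
    using finv_decay[OF tb, of ?N] by metis
  define B where "B = 2 * pi * (\<Sum>b\<in>Basis. A b)"
  have pos: "(1 + norm x) ^ ?N > 0" for x :: "real^'n" by (intro zero_less_power) (simp add: add_pos_nonneg)
  have A0: "A b \<ge> 0" for b
    using A[of 0 b] by (smt (verit) norm_ge_zero mult_nonneg_nonneg pos)
  have B0: "B \<ge> 0" unfolding B_def using A0 by (simp add: sum_nonneg)
  have der: "norm (2 * pi * \<i> * finv (\<lambda>\<xi>. m \<xi> * (\<xi> \<bullet> v)) x) \<le> B / (1 + norm x) ^ ?N * norm v" for v x
  proof -
    have "finv (\<lambda>\<xi>. m \<xi> * (\<xi> \<bullet> v)) x = (\<Sum>b\<in>Basis. cx (v \<bullet> b) * finv (\<lambda>\<xi>. m \<xi> * (\<xi> \<bullet> b)) x)"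
    proof -
      define g where "g b \<xi> = cx (m \<xi> * (\<xi> \<bullet> b)) * cis (2 * pi * (x \<bullet> \<xi>))" for b \<xi>
      have ig: "integrable lborel (g b)" for b
        unfolding g_def by (rule finv_integrable[OF tf_integrable[OF tb]])
      have "g v \<xi> = (\<Sum>b\<in>Basis. cx (v \<bullet> b) * g b \<xi>)" for \<xi>
      proof -
        have "cx (\<xi> \<bullet> v) = (\<Sum>b\<in>Basis. cx (v \<bullet> b) * cx (\<xi> \<bullet> b))"
          by (subst euclidean_inner) (simp add: mult.commute)
        then show ?thesis by (simp add: g_def sum_distrib_left sum_distrib_right mult_ac)
      qed
      then have "(LBINT \<xi>. g v \<xi>) = (LBINT \<xi>. (\<Sum>b\<in>Basis. cx (v \<bullet> b) * g b \<xi>))" by simp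
      also have "\<dots> = (\<Sum>b\<in>Basis. cx (v \<bullet> b) * (LBINT \<xi>. g b \<xi>))"
        by (subst Bochner_Integration.integral_sum) (auto intro: ig integrable_mult_right)
      finally show ?thesis
        unfolding finv_lborel[OF tf_integrable[OF tb]] g_def .
    qed
    also have "norm \<dots> \<le> (\<Sum>b\<in>Basis. norm v * (A b / (1 + norm x) ^ ?N))"
    proof (intro sum_norm_le)
      fix b :: "real^'n" assume "b \<in> Basis"
      then have "\<bar>v \<bullet> b\<bar> \<le> norm v" by (rule Basis_le_norm)
      moreover have "norm (finv (\<lambda>\<xi>. m \<xi> * (\<xi> \<bullet> b)) x) \<le> A b / (1 + norm x) ^ ?N"
        using A[of x b] pos[of x] by (simp add: pos_le_divide_eq mult.commute del: power_Suc)
      ultimately show "norm (cx (v \<bullet> b) * finv (\<lambda>\<xi>. m \<xi> * (\<xi> \<bullet> b)) x) \<le> norm v * (A b / (1 + norm x) ^ ?N)"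
        unfolding norm_mult norm_of_real by (intro mult_mono) auto
    qed
    finally have "norm (finv (\<lambda>\<xi>. m \<xi> * (\<xi> \<bullet> v)) x) \<le> norm v * ((\<Sum>b\<in>Basis. A b) / (1 + norm x) ^ ?N)"
      by (simp add: sum_distrib_left sum_divide_distrib)
    then have "2 * pi * norm (finv (\<lambda>\<xi>. m \<xi> * (\<xi> \<bullet> v)) x) \<le> 2 * pi * (norm v * ((\<Sum>b\<in>Basis. A b) / (1 + norm x) ^ ?N))"
      by (intro mult_left_mono) auto
    then show ?thesis by (simp add: B_def norm_mult mult_ac)
  qed
  define J where "J = (LBINT x. 1 / (1 + norm (x::real^'n)) ^ ?N)"
  have J0: "J \<ge> 0" unfolding J_def using pos by (intro integral_nonneg_AE AE_I2) (simp add: less_imp_le)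
  define M where "M = (LBINT x. norm (finv m x))"
  have M0: "M \<ge> 0" by (simp add: M_def)
  have iM: "integrable lborel (finv m)" by (rule finv_in_L1[OF m])
  show thesis
  proof (rule that)
    show "0 \<le> 2 * M + B * 2 ^ ?N * J" using M0 B0 J0 by simp
    fix h :: "real^'n"
    show "(LBINT x. norm (finv m x - finv m (x - h))) \<le> (2 * M + B * 2 ^ ?N * J) * norm h"
    proof (cases "norm h \<le> 1")
      case True
      have pt: "norm (finv m x - finv m (x - h)) \<le> B * 2 ^ ?N * norm h * (1 / (1 + norm x) ^ ?N)" for x
      proof -
        have "norm (finv m x - finv m (x - h)) \<le> B * 2 ^ ?N / (1 + norm x) ^ ?N * norm (x - (x - h))"
        proof (rule differentiable_bound[of "closed_segment (x - h) x" "finv m" "\<lambda>z v. 2 * pi * \<i> * finv (\<lambda>\<xi>. m \<xi> * (\<xi> \<bullet> v)) z"])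
          fix z assume z: "z \<in> closed_segment (x - h) x"
          show "(finv m has_derivative (\<lambda>v. 2 * pi * \<i> * finv (\<lambda>\<xi>. m \<xi> * (\<xi> \<bullet> v)) z)) (at z within closed_segment (x - h) x)"
            by (rule has_derivative_at_withinI[OF finv_has_derivative[OF m]])
          have "norm (x - z) \<le> norm h"
            using dist_in_closed_segment[OF z] by (simp add: dist_norm norm_minus_commute)
          then have "norm x \<le> norm z + 1"
            using True norm_triangle_ineq2[of x z] by linarith
          then have "1 + norm x \<le> 2 * (1 + norm z)" using norm_ge_zero[of z] unfolding distrib_left by linarith
          then have "(1 + norm x) ^ ?N \<le> 2 ^ ?N * (1 + norm z) ^ ?N"
            unfolding power_mult_distrib[symmetric] by (intro power_mono) auto
          then have "B * (1 + norm x) ^ ?N \<le> B * (2 ^ ?N * (1 + norm z) ^ ?N)"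
            using B0 by (intro mult_left_mono)
          then have "B / (1 + norm z) ^ ?N \<le> B * 2 ^ ?N / (1 + norm x) ^ ?N"
            using pos[of x] pos[of z] by (simp add: divide_le_eq pos_le_divide_eq mult_ac del: power_Suc)
          then have "B / (1 + norm z) ^ ?N * norm v \<le> B * 2 ^ ?N / (1 + norm x) ^ ?N * norm v" for v :: "real^'n"
            by (intro mult_right_mono) auto
          then show "onorm (\<lambda>v. 2 * pi * \<i> * finv (\<lambda>\<xi>. m \<xi> * (\<xi> \<bullet> v)) z) \<le> B * 2 ^ ?N / (1 + norm x) ^ ?N"
            by (intro onorm_le order_trans[OF der])
        qed auto
        then show ?thesis by (simp add: mult_ac)
      qed
      have "(LBINT x. norm (finv m x - finv m (x - h))) \<le> (LBINT x. B * 2 ^ ?N * norm h * (1 / (1 + norm (x::real^'n)) ^ ?N))"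
      proof (rule integral_mono_AE')
        show "integrable lborel (\<lambda>x::real^'n. B * 2 ^ ?N * norm h * (1 / (1 + norm x) ^ ?N))"
          by (intro integrable_mult_right integrable_weight)
        show "AE x in lborel. norm (finv m x - finv m (x - h)) \<le> B * 2 ^ ?N * norm h * (1 / (1 + norm x) ^ ?N)"
          by (intro AE_I2 pt)
        show "AE x in lborel. 0 \<le> B * 2 ^ ?N * norm h * (1 / (1 + norm (x::real^'n)) ^ ?N)"
          using B0 by (intro AE_I2 mult_nonneg_nonneg divide_nonneg_nonneg) (auto simp: add_nonneg_nonneg)
      qed
      also have "\<dots> = B * 2 ^ ?N * J * norm h"
        unfolding integral_mult_right_zero J_def by simp
      also have "\<dots> \<le> (2 * M + B * 2 ^ ?N * J) * norm h"
        using M0 by (intro mult_right_mono) auto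
      finally show ?thesis .
    next
      case False
      have iMh: "integrable lborel (\<lambda>x. finv m (x - h))"
        using lborel_integrable_translate(1)[of "finv m" "- h"] iM by simp
      have "(LBINT x. norm (finv m x - finv m (x - h))) \<le> (LBINT x. norm (finv m x) + norm (finv m (x - h)))"
        by (intro integral_mono) (use iM iMh in \<open>auto intro: norm_triangle_ineq4\<close>)
      also have "\<dots> = 2 * M"
        using iM iMh lborel_integral_translate(1)[of "\<lambda>x. norm (finv m x)" "- h"] by (simp add: M_def)
      also have "\<dots> \<le> (2 * M) * norm h" using False M0 mult_left_mono[of 1 "norm h" "2 * M"] by simp
      also have "\<dots> \<le> (2 * M + B * 2 ^ ?N * J) * norm h"
        using B0 J0 by (intro mult_right_mono) auto
      finally show ?thesis .
    qed
  qed
qed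

text \<open>As the kernel has mass one, the error is an average of translation differences, each at
  most \<open>C * norm y\<close> in \<open>L\<^sup>1\<close>. The first moment of the dilated kernel
  is that of \<open>K\<close> divided by \<mu>.\<close>

lemma averaging_L1_error:
  fixes m :: "real^'n::finite \<Rightarrow> real" and K :: "real^'n \<Rightarrow> real"
  assumes m: "tf m" and K: "integrable lborel K" "\<And>x. K x \<ge> 0" "(LBINT x. K x) = 1" "integrable lborel (\<lambda>x. norm x * K x)"
  obtains C where "C \<ge> 0" "\<And>\<mu>. \<mu> > 0 \<Longrightarrow> (LBINT x. norm (finv m x - conv (dil \<mu> (\<lambda>x. cx (K x))) (finv m) x)) \<le> C / \<mu>"
proof -
  obtain C where C: "C \<ge> 0" "\<And>h. (LBINT x. norm (finv m x - finv m (x - h))) \<le> C * norm h"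
    using finv_translation_L1[OF m] by blast
  have [measurable]: "K \<in> borel_measurable borel" "finv m \<in> borel_measurable borel"
    using K finv_measurable[OF m] by (auto dest: borel_measurable_integrable)
  have iM: "integrable lborel (finv m)" by (rule finv_in_L1[OF m])
  have nM: "integrable lborel (\<lambda>x. norm (finv m x))" using iM by simp
  obtain A where A: "\<And>x. norm (finv m x) \<le> A" using finv_bound[OF tf_integrable[OF m]] by blast
  define J where "J = (LBINT x. norm x * K x)"
  have J0: "J \<ge> 0" using K(2) by (simp add: J_def)
  show thesis
  proof (rule that)
    show "C * J \<ge> 0" using C J0 by simp
    fix \<mu> :: real assume \<mu>: "\<mu> > 0"
    define k where "k = dil \<mu> K"
    have k: "integrable lborel k" "\<And>x. k x \<ge> 0" "(LBINT x. k x) = 1"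
      using dil_integrable[OF K(1) \<mu>] K(2,3) \<mu> by (auto simp: k_def) (simp add: dil_def)
    have [measurable]: "k \<in> borel_measurable borel" using k by (auto dest: borel_measurable_integrable)
    have kn: "integrable lborel (\<lambda>x. norm x * k x)" "(LBINT x. norm x * k x) = J / \<mu>"
    proof -
      have e: "norm x * k x = \<mu> ^ CARD('n) / \<mu> * (norm (\<mu> *\<^sub>R x) * K (\<mu> *\<^sub>R x))" for x
        using \<mu> by (simp add: k_def dil_def)
      show "integrable lborel (\<lambda>x. norm x * k x)"
        unfolding e using lborel_integrable_affine[of "\<lambda>x. norm x * K x" \<mu> 0] K(4) \<mu>
        by (intro integrable_mult_right) simp
      have "(LBINT x. norm x * k x) = \<mu> ^ CARD('n) / \<mu> * (LBINT x. norm (\<mu> *\<^sub>R x) * K (\<mu> *\<^sub>R x))"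
        unfolding e by (rule integral_mult_right_zero)
      then show "(LBINT x. norm x * k x) = J / \<mu>"
        using lborel_integral_affine[of "\<lambda>x. norm x * K x" \<mu> 0] \<mu> by (simp add: J_def field_simps)
    qed
    have kc: "dil \<mu> (\<lambda>x. cx (K x)) = (\<lambda>x. cx (k x))"
      by (simp add: k_def dil_def fun_eq_iff scaleR_conv_of_real)
    have eq: "finv m x - conv (\<lambda>x. cx (k x)) (finv m) x = (LBINT y. cx (k y) * (finv m x - finv m (x - y)))" for x
    proof -
      have i1: "integrable lborel (\<lambda>y. cx (k y) * finv m (x - y))"
        by (rule Bochner_Integration.integrable_bound[of _ "\<lambda>y. A * k y"])
           (use k A in \<open>auto simp: norm_mult mult.commute[of A] abs_mult intro!: mult_left_mono order_trans[OF A]\<close>)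
      have "conv (\<lambda>x. cx (k x)) (finv m) x = conv (finv m) (\<lambda>x. cx (k x)) x"
        by (rule conv_commute) auto
      also have "\<dots> = (LBINT y. cx (k y) * finv m (x - y))"
        by (simp add: conv_def mult.commute)
      finally have "conv (\<lambda>x. cx (k x)) (finv m) x = (LBINT y. cx (k y) * finv m (x - y))" .
      moreover have "finv m x = (LBINT y. cx (k y) * finv m x)"
        using k by simp
      ultimately show ?thesis
        using i1 k by (simp add: right_diff_distrib)
    qed
    have ip: "integrable (lborel \<Otimes>\<^sub>M lborel) (\<lambda>(x, y). k y * norm (finv m x - finv m (x - y)))"
    proof (rule Bochner_Integration.integrable_bound)
      show "integrable (lborel \<Otimes>\<^sub>M lborel) (\<lambda>z. (case z of (x, y) \<Rightarrow> norm (finv m x) * k y) + (case z of (x, y) \<Rightarrow> norm (finv m (x - y)) * k y))"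
        by (intro Bochner_Integration.integrable_add integrable_pair_mult[OF nM k(1)] conv_pair_integrable[OF nM k(1)])
      have "k y * norm (finv m x - finv m (x - y)) \<le> norm (finv m x) * k y + norm (finv m (x - y)) * k y" for x y
        using mult_left_mono[OF norm_triangle_ineq4[of "finv m x" "finv m (x - y)"] k(2)[of y]] by (simp add: algebra_simps)
      then show "AE z in lborel \<Otimes>\<^sub>M lborel. norm (case z of (x, y) \<Rightarrow> k y * norm (finv m x - finv m (x - y)))
        \<le> norm ((case z of (x, y) \<Rightarrow> norm (finv m x) * k y) + (case z of (x, y) \<Rightarrow> norm (finv m (x - y)) * k y))"
        using k(2) by (intro AE_I2) (auto split: prod.splits simp: abs_mult)
    qed measurable
    have "(LBINT x. norm (finv m x - conv (\<lambda>x. cx (k x)) (finv m) x))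
       \<le> (LBINT x. (LBINT y. k y * norm (finv m x - finv m (x - y))))"
    proof (rule integral_mono_AE')
      show "integrable lborel (\<lambda>x. LBINT y. k y * norm (finv m x - finv m (x - y)))"
        using lborel_pair.integrable_fst'[OF ip] by simp
      show "AE x in lborel. norm (finv m x - conv (\<lambda>x. cx (k x)) (finv m) x) \<le> (LBINT y. k y * norm (finv m x - finv m (x - y)))"
        unfolding eq using k(2)
        by (intro AE_I2 order_trans[OF integral_norm_bound]) (simp add: norm_mult)
    qed (use k(2) in simp)
    also have "\<dots> = (LBINT y. (LBINT x. k y * norm (finv m x - finv m (x - y))))"
      using lborel_pair.Fubini_integral[of "\<lambda>x y. k y * norm (finv m x - finv m (x - y))"] ip by simp
    also have "\<dots> \<le> (LBINT y. C * (norm y * k y))"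
    proof (rule integral_mono_AE')
      show "integrable lborel (\<lambda>y. C * (norm y * k y))" using kn by simp
      have "k y * (LBINT x. norm (finv m x - finv m (x - y))) \<le> k y * (C * norm y)" for y
        by (intro mult_left_mono C k)
      then show "AE y in lborel. (LBINT x. k y * norm (finv m x - finv m (x - y))) \<le> C * (norm y * k y)"
        by (simp add: mult_ac)
    qed (use C k in auto)
    also have "\<dots> = C * J / \<mu>" using kn by simp
    finally show "(LBINT x. norm (finv m x - conv (dil \<mu> (\<lambda>x. cx (K x))) (finv m) x)) \<le> C * J / \<mu>"
      by (simp add: kc)
  qed
qed

text \<open>The symbol of the block is \<open>e\<close> at \<xi>/t, so \<open>t\<close> is its
  frequency.\<close>

abbreviation block_norm :: "real \<Rightarrow> real \<Rightarrow> (real^'n::finite \<Rightarrow> real) \<Rightarrow> (real^'n \<Rightarrow> real) \<Rightarrow> real" where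
  "block_norm p t e g \<equiv> nrm p (conv (dil t (finv e)) (\<lambda>y. cx (g y)))"

text \<open>The bound is a fixed multiple of the next power outside the sum, which is what lets the
  induction close.\<close>

lemma sum_geometric_tail:
  fixes r :: real
  assumes r: "0 < r" "r < 1" and "j \<le> k"
  shows "(\<Sum>i<j. r ^ (k - i)) \<le> r ^ (k - j) * (r / (1 - r))"
  using assms(3)
proof (induction j)
  case 0
  then show ?case using r by simp
next
  case (Suc j)
  have e: "r ^ (k - j) = r ^ (k - Suc j) * r" using Suc.prems by (metis Suc_diff_Suc Suc_le_lessD power_Suc mult.commute)
  have "(\<Sum>i<Suc j. r ^ (k - i)) \<le> r ^ (k - j) * (r / (1 - r)) + r ^ (k - j)"
    using Suc by simp
  also have "\<dots> = r ^ (k - Suc j) * (r * (r / (1 - r) + 1))"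
    unfolding e by (simp add: algebra_simps)
  also have "r * (r / (1 - r) + 1) = r / (1 - r)" using r by (simp add: field_simps)
  finally show ?case .
qed

text \<open>The chain \<open>F\<^sub>q = T\<^sub>q\<^sub>+\<^sub>1 \<dots> T\<^sub>Q F\<close>, indexed by the number of averaging operators
  \<open>T = (1 + G)/2\<close> already applied. By uniform convexity the increments \<open>F\<^sub>q - G\<^sub>q F\<^sub>q\<close> have a
  convergent sum of squared norms, and the spectral projections at level \<open>q\<close> are hardly affected
  by the averaging at much finer scales.\<close>

context
  fixes K :: "real^'n::finite \<Rightarrow> real" and e \<theta> :: "real^'n \<Rightarrow> real" and p C R :: real
  assumes p: "1 < p" "p \<le> 2"
    and K: "integrable lborel K" "\<And>x. K x \<ge> 0" "(LBINT x. K x) = 1"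
    and spec: "\<And>\<xi>. norm \<xi> \<ge> 1/2 \<Longrightarrow> (LBINT x. cx (K x) * cis (2 * pi * (x \<bullet> \<xi>))) = 0"
    and e: "tf e" "\<And>\<xi>. e \<xi> \<noteq> 0 \<Longrightarrow> norm \<xi> \<ge> 1/2"
    and \<theta>: "tf \<theta>" "\<And>\<xi>. e \<xi> \<noteq> 0 \<Longrightarrow> \<theta> \<xi> = 1"
    and C: "C \<ge> 0" "\<And>\<mu>. \<mu> > 0 \<Longrightarrow> (LBINT x. norm (finv \<theta> x - conv (dil \<mu> (\<lambda>x. cx (K x))) (finv \<theta>) x)) \<le> C / \<mu>"
    and R: "R > 1" "R \<ge> 1 + C"
begin

text \<open>\<open>Tm s F\<close> is the midpoint of \<open>F\<close> and its average
  \<open>Av s F\<close>, the configuration to which uniform convexity applies. \<open>Pr s\<close>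
  is the block at frequency \<open>s\<close>; it need not be idempotent.\<close>

private definition "Av s F = conv (dil s K) F"
private definition "Pr s F = conv (dil s (finv e)) (\<lambda>x. cx (F x))"
private definition "Tm s F x = (F x + Av s F x) / 2"

private lemma dil_of_real: "dil s (\<lambda>x. cx (K x)) = (\<lambda>x. cx (dil s K x))"
  by (simp add: dil_def fun_eq_iff scaleR_conv_of_real)

private lemma meas[measurable]: "K \<in> borel_measurable borel" "finv e \<in> borel_measurable borel" "finv \<theta> \<in> borel_measurable borel"
  using K finv_measurable[OF e(1)] finv_measurable[OF \<theta>(1)] by (auto dest: borel_measurable_integrable)

private lemma iKc: "integrable lborel (\<lambda>x. cx (K x))"
  using K by simp

private lemma ie: "integrable lborel (finv e)" and i\<theta>: "integrable lborel (finv \<theta>)"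
  by (rule finv_in_L1[OF e(1)], rule finv_in_L1[OF \<theta>(1)])

private lemma Av: assumes "s > 0" "Lp p F" shows "Lp p (Av s F)" "nrm p (Av s F) \<le> nrm p F"
proof -
  have "(LBINT x. norm (dil s K x)) = 1"
    using dil_integrable(2)[OF K(1) assms(1)] K(2,3) by simp
  then show "Lp p (Av s F)" "nrm p (Av s F) \<le> nrm p F"
    using Young_inequality(2,3)[OF dil_integrable(1)[OF K(1) assms(1)] assms(2) p(1)] by (auto simp: Av_def)
qed

private lemma Tm: assumes "s > 0" "Lp p F" shows "Lp p (Tm s F)"
  using Lp_cmult(1)[OF Lp_add(1)[OF assms(2) Av(1)[OF assms] p(1)], of "1/2"] p by (simp add: Tm_def[abs_def])

private lemma Pr: assumes "s > 0" "Lp p F" shows "Lp p (Pr s F)" "nrm p (Pr s F) \<le> (LBINT x. norm (finv e x)) * nrm p F"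
  using Young_inequality(2,3)[OF dil_integrable(1)[OF ie assms(1)] Lp_of_real[OF assms(2)] p(1)]
  by (auto simp: Pr_def dil_integrable(2)[OF ie assms(1)] nrm_of_real)

private lemma Av_complex: "(\<lambda>x. cx (Av s F x)) = conv (dil s (\<lambda>x. cx (K x))) (\<lambda>x. cx (F x))"
  by (simp add: Av_def dil_of_real conv_of_real fun_eq_iff)

text \<open>At equal scales the symbols multiply to zero: the transform of \<open>K\<close> vanishes
  from radius 1/2 on, and \<open>e\<close> lives there.\<close>

private lemma Pr_Av_zero:
  assumes s: "s > 0" and F: "Lp p F"
  shows "AE x in lborel. Pr s (Av s F) x = 0"
proof -
  have "conv (finv e) (\<lambda>x. cx (K x)) x = 0" for x
  proof -
    have "conv (finv e) (\<lambda>x. cx (K x)) x = conv (\<lambda>x. cx (K x)) (finv e) x"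
      by (rule conv_commute) auto
    also have "\<dots> = (\<integral>\<xi>. 0 \<partial>(lborel :: (real^'n) measure))"
      unfolding conv_finv[OF tf_integrable[OF e(1)] iKc]
    proof (intro Bochner_Integration.integral_cong refl)
      fix \<xi> :: "real^'n"
      show "cx (e \<xi>) * cis (2 * pi * (x \<bullet> \<xi>)) * (LBINT w. cx (K w) * cis (2 * pi * (w \<bullet> - \<xi>))) = 0"
      proof (cases "e \<xi> = 0")
        case False
        then have "norm (- \<xi>) \<ge> 1/2" using e(2) by simp
        from spec[OF this] show ?thesis by simp
      qed simp
    qed
    finally show ?thesis by simp
  qed
  then have z: "conv (dil s (finv e)) (dil s (\<lambda>x. cx (K x))) x = 0" for x
    by (subst conv_dil[OF _ _ s]) (auto simp: dil_def)
  have "AE x in lborel. Pr s (Av s F) x = conv (conv (dil s (finv e)) (dil s (\<lambda>x. cx (K x)))) (\<lambda>x. cx (F x)) x"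
    unfolding Pr_def Av_complex
    by (rule conv_assoc_AE[OF dil_integrable(1)[OF ie s] dil_integrable(1)[OF iKc s] Lp_of_real[OF F] p(1)])
  moreover have "conv (dil s (finv e)) (dil s (\<lambda>x. cx (K x))) = (\<lambda>x. 0)" using z by auto
  moreover have "conv (\<lambda>x. 0) (\<lambda>x. cx (F x)) x = 0" for x by (simp add: conv_def)
  ultimately show ?thesis by simp
qed

text \<open>Since the block of the average is zero, the block of \<open>F\<close> is the block of
  the increment. This ties the blocks to the losses in the energy.\<close>

private lemma Pr_le_increment:
  assumes s: "s > 0" and F: "Lp p F"
  shows "nrm p (Pr s F) \<le> (LBINT x. norm (finv e x)) * nrm p (\<lambda>x. F x - Av s F x)"
proof -
  have D: "Lp p (\<lambda>x. F x - Av s F x)" by (rule Lp_diff(1)[OF F Av(1)[OF s F] p(1)])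
  note [measurable] = Lp_measurable[OF Pr(1)[OF s F]] Lp_measurable[OF Pr(1)[OF s D]] Lp_measurable[OF Pr(1)[OF s Av(1)[OF s F]]]
  have "AE x in lborel. Pr s (\<lambda>x. F x - Av s F x) x = Pr s F x - Pr s (Av s F) x"
    using conv_add_AE(2)[OF dil_integrable(1)[OF ie s] Lp_of_real[OF F] Lp_of_real[OF Av(1)[OF s F]] p(1)]
    by (simp add: Pr_def)
  with Pr_Av_zero[OF s F] have "AE x in lborel. Pr s F x = Pr s (\<lambda>x. F x - Av s F x) x"
    by eventually_elim simp
  then have "nrm p (Pr s F) = nrm p (Pr s (\<lambda>x. F x - Av s F x))"
    by (intro nrm_cong_AE) measurable
  also have "\<dots> \<le> (LBINT x. norm (finv e x)) * nrm p (\<lambda>x. F x - Av s F x)"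
    by (rule Pr(2)[OF s D])
  finally show ?thesis .
qed

text \<open>As \<theta> is 1 on the spectrum of \<open>e\<close>, the block \<open>v\<close> is
  reproduced by convolution with the dilated \<open>finv \<theta>\<close>. Hence \<open>v\<close>
  minus its average is a convolution of \<open>v\<close> with the averaging error of that kernel,
  whose \<open>L\<^sup>1\<close> norm is at most \<open>C * s / t\<close>. Only half of it enters
  \<open>Tm\<close>.\<close>

private lemma Pr_Tm_lower:
  assumes s: "s > 0" and t: "t > 0" and F: "Lp p F"
  shows "nrm p (Pr s F) * (1 - C * s / t / 2) \<le> nrm p (Pr s (Tm t F))"
proof -
  let ?E = "dil s (finv e)" and ?K = "dil t (\<lambda>x. cx (K x))" and ?T = "dil s (finv \<theta>)"
  let ?F = "\<lambda>x. cx (F x)"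
  note iE = dil_integrable(1)[OF ie s] and iK = dil_integrable(1)[OF iKc t] and iT = dil_integrable(1)[OF i\<theta> s]
  have F': "Lp p ?F" by (rule Lp_of_real[OF F])
  note A = Av(1)[OF t F] and T = Tm[OF t F]
  define v where "v = Pr s F"
  have v: "Lp p v" unfolding v_def by (rule Pr(1)[OF s F])
  note [measurable] = Lp_measurable[OF v] Lp_measurable[OF F'] Lp_measurable[OF Pr(1)[OF s A]] Lp_measurable[OF Pr(1)[OF s T]]
  have iKT: "integrable lborel (conv ?K ?T)" by (rule conv_integrable(2)[OF iK iT])
  define D where "D y = ?T y - conv ?K ?T y" for y
  have iD: "integrable lborel D" unfolding D_def[abs_def] using iT iKT by simp
  have Dn: "(LBINT x. norm (D x)) \<le> C * s / t"
  proof -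
    \<comment> \<open>Undoing the dilation by \<open>s\<close> leaves only the ratio of the two
      scales, to which the assumption on \<theta> applies.\<close>
    define \<mu> where "\<mu> = t / s"
    have \<mu>: "\<mu> > 0" using s t by (simp add: \<mu>_def)
    define D0 where "D0 x = finv \<theta> x - conv (dil \<mu> (\<lambda>x. cx (K x))) (finv \<theta>) x" for x
    have iD0: "integrable lborel D0"
      unfolding D0_def[abs_def] using i\<theta> conv_integrable(2)[OF dil_integrable(1)[OF iKc \<mu>] i\<theta>] by simp
    have "?K = dil s (dil \<mu> (\<lambda>x. cx (K x)))"
      using s by (simp add: dil_dil \<mu>_def)
    then have "D x = dil s D0 x" for x
      unfolding D_def by (simp add: conv_dil[OF _ _ s]) (simp add: dil_def D0_def scaleR_diff_right)
    then have "(LBINT x. norm (D x)) = (LBINT x. norm (D0 x))"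
      using dil_integrable(2)[OF iD0 s] by simp
    also have "\<dots> \<le> C / \<mu>" unfolding D0_def by (rule C(2)[OF \<mu>])
    finally show ?thesis by (simp add: \<mu>_def)
  qed
  have ET: "conv ?T ?E x = ?E x" for x
  proof -
    have "(\<lambda>\<xi>. \<theta> \<xi> * e \<xi>) = e" using \<theta>(2) by force
    then have "conv (finv \<theta>) (finv e) x = finv e x" for x
      unfolding conv_def finv_convolution[OF \<theta>(1) e(1)] by simp
    then have "conv (finv \<theta>) (finv e) = finv e" by auto
    then show ?thesis by (simp add: conv_dil[OF _ _ s])
  qed
  have eq1: "AE x in lborel. conv ?T v x = v x"
    using conv_assoc_AE[OF iT iE F' p(1)]
    by eventually_elim (simp add: v_def Pr_def conv_def ET[unfolded conv_def])
  have eq2: "AE x in lborel. Pr s (Av t F) x = conv ?K v x"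
  proof -
    have c: "conv ?E ?K = conv ?K ?E" by (intro ext conv_commute) measurable
    show ?thesis
      using conv_assoc_AE[OF iE iK F' p(1)] conv_assoc_AE[OF iK iE F' p(1)]
      by eventually_elim (simp add: Pr_def Av_complex v_def c)
  qed
  have eq3: "AE x in lborel. conv ?K (conv ?T v) x = conv ?K v x"
    using eq1 by (intro AE_I2) (auto simp: conv_def intro!: integral_cong_AE elim!: eventually_mono)
  have eq4: "AE x in lborel. v x - Pr s (Av t F) x = conv D v x"
    using eq1 eq2 eq3 conv_assoc_AE[OF iK iT v p(1)] conv_diff_AE[OF iT iKT v p(1)]
    by eventually_elim (simp add: D_def[abs_def])
  have eq5: "AE x in lborel. Pr s (Tm t F) x = v x - cx (1/2) * conv D v x"
  proof -
    have T2: "Pr s (Tm t F) x = cx (1/2) * conv ?E (\<lambda>y. ?F y + cx (Av t F y)) x" for x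
      unfolding Pr_def by (subst conv_cmult(1)[symmetric]) (simp add: Tm_def)
    show ?thesis
      using conv_add_AE(1)[OF iE F' Lp_of_real[OF A] p(1)] eq4
    proof eventually_elim
      case (elim x)
      have a: "conv D v x = v x - conv ?E (\<lambda>x. cx (Av t F x)) x"
        using elim(2)[symmetric] by (simp add: Pr_def)
      have b: "conv ?E ?F x = v x" by (simp add: v_def Pr_def)
      show ?case unfolding T2 elim(1) b a by (simp add: field_simps)
    qed
  qed
  have dv: "Lp p (conv D v)" "nrm p (conv D v) \<le> C * s / t * nrm p v"
    using Young_inequality(2,3)[OF iD v p(1)] mult_right_mono[OF Dn nrm_nonneg[of p v]] by auto
  note [measurable] = Lp_measurable[OF dv(1)]
  have "nrm p v = nrm p (\<lambda>x. Pr s (Tm t F) x + cx (1/2) * conv D v x)"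
    using eq5 by (intro nrm_cong_AE) (auto elim!: eventually_mono)
  also have "\<dots> \<le> nrm p (Pr s (Tm t F)) + nrm p (\<lambda>x. cx (1/2) * conv D v x)"
    by (rule Lp_add(2)[OF Pr(1)[OF s T] Lp_cmult(1)[OF dv(1)] p(1)]) (use p in simp)
  also have "nrm p (\<lambda>x. cx (1/2) * conv D v x) = 1/2 * nrm p (conv D v)"
    using Lp_cmult(2)[OF dv(1), of "cx (1/2)"] p by simp
  finally have "nrm p v \<le> nrm p (Pr s (Tm t F)) + 1/2 * nrm p (conv D v)" .
  moreover have "nrm p v * (1 - C * s / t / 2) = nrm p v - 1/2 * (C * s / t * nrm p v)"
    by (simp add: algebra_simps)
  ultimately show ?thesis using dv(2) unfolding v_def[symmetric] by linarith
qed

private lemma energy_step: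
  assumes s: "s > 0" and F: "Lp p F"
  shows "nrm p (Tm s F) powr p + p * (p - 1) / 8 * 2 powr (p - 2) * (nrm p (\<lambda>x. F x - Av s F x))\<^sup>2 * nrm p F powr (p - 2) \<le> nrm p F powr p"
  using uniform_convexity[OF p F Av(1)[OF s F] Av(2)[OF s F]] by (simp add: Tm_def[abs_def])

text \<open>For \<open>k \<le> Q\<close> this is \<open>F\<^sub>q\<close> of the preceding remark
  with \<open>q = Q - k\<close>: the finest scale \<open>a * R ^ Q\<close> acts first.\<close>

private fun Ch :: "real \<Rightarrow> nat \<Rightarrow> (real^'n \<Rightarrow> real) \<Rightarrow> nat \<Rightarrow> real^'n \<Rightarrow> real" where
  "Ch a Q F 0 = F"
| "Ch a Q F (Suc k) = Tm (a * R ^ (Q - k)) (Ch a Q F k)"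

private lemma Ch_Lp: assumes "a > 0" "Lp p F" shows "Lp p (Ch a Q F k)"
  using assms R by (induction k) (auto intro!: Tm)

text \<open>The losses of \<open>energy_step\<close> telescope. Norms decrease along the chain and
  \<open>p - 2\<close> is not positive, so the weights of the individual steps can all be replaced
  by that of the initial function.\<close>

private lemma Ch_energy:
  assumes a: "a > 0" and F: "Lp p F" and pos: "nrm p F > 0"
  shows "nrm p (Ch a Q F n) powr p + p * (p - 1) / 8 * 2 powr (p - 2) * nrm p F powr (p - 2) *
      (\<Sum>k<n. (nrm p (\<lambda>x. Ch a Q F k x - Av (a * R ^ (Q - k)) (Ch a Q F k) x))\<^sup>2) \<le> nrm p F powr p"
proof (induction n)
  case 0
  then show ?case by simp
next
  case (Suc n)
  define c where "c = p * (p - 1) / 8 * 2 powr (p - 2)"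
  have c: "c \<ge> 0" using p by (simp add: c_def)
  let ?G = "Ch a Q F n"
  let ?d = "(nrm p (\<lambda>x. ?G x - Av (a * R ^ (Q - n)) ?G x))\<^sup>2"
  define S where "S = (\<Sum>k<n. (nrm p (\<lambda>x. Ch a Q F k x - Av (a * R ^ (Q - k)) (Ch a Q F k) x))\<^sup>2)"
  have IH: "nrm p ?G powr p + c * nrm p F powr (p - 2) * S \<le> nrm p F powr p"
    using Suc.IH by (simp only: c_def S_def)
  have goal: ?case if "nrm p (Ch a Q F (Suc n)) powr p + c * nrm p F powr (p - 2) * (S + ?d) \<le> nrm p F powr p"
    using that unfolding c_def S_def sum.lessThan_Suc .
  have s: "a * R ^ (Q - n) > 0" using a R by simp
  have G: "Lp p ?G" by (rule Ch_Lp[OF a F])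
  have step: "nrm p (Ch a Q F (Suc n)) powr p + c * ?d * nrm p ?G powr (p - 2) \<le> nrm p ?G powr p"
    using energy_step[OF s G] by (simp add: c_def)
  have le: "nrm p ?G \<le> nrm p F"
  proof -
    have "0 \<le> c * nrm p F powr (p - 2) * S"
      unfolding S_def using c by (intro mult_nonneg_nonneg sum_nonneg) auto
    then have "nrm p ?G powr p \<le> nrm p F powr p" using IH by linarith
    then show ?thesis using p pos by (smt (verit) powr_less_mono2 nrm_nonneg)
  qed
  show ?case
  proof (cases "nrm p ?G = 0")
    \<comment> \<open>Here \<open>0 powr (p - 2)\<close> is 0 and the energy step carries no
      information, but the increment vanishes too.\<close>
    case True
    then have "AE x in lborel. ?G x = 0" by (rule nrm_zero_AE[OF G])
    moreover have "nrm p (Av (a * R ^ (Q - n)) ?G) = 0"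
      using Av(2)[OF s G] True nrm_nonneg[of p "Av (a * R ^ (Q - n)) ?G"] by simp
    then have "AE x in lborel. Av (a * R ^ (Q - n)) ?G x = 0" by (rule nrm_zero_AE[OF Av(1)[OF s G]])
    ultimately have "AE x in lborel. ?G x - Av (a * R ^ (Q - n)) ?G x = 0" by eventually_elim simp
    then have "nrm p (\<lambda>x. ?G x - Av (a * R ^ (Q - n)) ?G x) = nrm p (\<lambda>x::real^'n. 0::real)"
      using Lp_measurable[OF G] Lp_measurable[OF Av(1)[OF s G]] by (intro nrm_cong_AE) auto
    then have d0: "?d = 0" using p by (simp add: Lp_zero)
    have "nrm p (Ch a Q F (Suc n)) powr p \<le> nrm p ?G powr p" using step d0 by simp
    then show ?thesis using IH d0 by (intro goal) simp
  next
    case False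
    then have "nrm p ?G > 0" using nrm_nonneg[of p ?G] by simp
    then have "nrm p F powr (p - 2) \<le> nrm p ?G powr (p - 2)"
      using le p by (intro powr_mono2') auto
    then have "c * ?d * nrm p F powr (p - 2) \<le> c * ?d * nrm p ?G powr (p - 2)"
      using c by (intro mult_left_mono) auto
    then have "c * nrm p F powr (p - 2) * ?d \<le> nrm p ?G powr p - nrm p (Ch a Q F (Suc n)) powr p"
      using step by (simp add: mult_ac)
    then show ?thesis using IH by (intro goal) (simp add: distrib_left)
  qed
qed

text \<open>Step \<open>i\<close> averages at a scale finer by the factor \<open>R ^ (k - i)\<close>
  and thus costs the block at level \<open>k\<close> at most the factor
  \<open>1 - C / 2 * (1/R) ^ (k - i)\<close>.\<close>

private lemma Ch_project:
  assumes a: "a > 0" and F: "Lp p F" and "j \<le> k" "k \<le> Q"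
  shows "nrm p (Pr (a * R ^ (Q - k)) F) * (1 - C / 2 * (\<Sum>i<j. (1/R) ^ (k - i))) \<le> nrm p (Pr (a * R ^ (Q - k)) (Ch a Q F j))"
  using assms(3)
proof (induction j)
  case 0
  then show ?case by simp
next
  case (Suc j)
  let ?s = "a * R ^ (Q - k)" and ?t = "a * R ^ (Q - j)"
  let ?S = "\<Sum>i<j. (1/R) ^ (k - i)"
  define x where "x = (1/R) ^ (k - j)"
  have pos: "?s > 0" "?t > 0" using a R by auto
  have ratio: "C * ?s / ?t / 2 = C / 2 * x"
  proof -
    have "R ^ (Q - j) = R ^ (Q - k) * R ^ (k - j)" using Suc.prems assms(4) by (simp add: power_add[symmetric])
    then show ?thesis using a R by (simp add: x_def power_one_over field_simps)
  qed
  have x: "0 \<le> x" "C / 2 * x \<le> 1"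
  proof -
    show x0: "0 \<le> x" using R by (simp add: x_def)
    have "x \<le> 1 / R"
      using power_decreasing[of 1 "k - j" "1/R"] Suc.prems R by (simp add: x_def)
    then have "C * x \<le> R * (1 / R)" using C R x0 by (intro mult_mono) auto
    then show "C / 2 * x \<le> 1" using R by simp
  qed
  have S0: "0 \<le> C / 2 * ?S" using C R by (intro mult_nonneg_nonneg sum_nonneg) auto
  \<comment> \<open>A product of numbers \<open>1 - x\<close> is at least one minus their sum; the
    discarded cross term is nonnegative.\<close>
  have "nrm p (Pr ?s F) * (1 - C / 2 * (?S + x)) \<le> nrm p (Pr ?s F) * ((1 - C / 2 * ?S) * (1 - C / 2 * x))"
  proof (rule mult_left_mono[OF _ nrm_nonneg])
    have "0 \<le> (C / 2 * ?S) * (C / 2 * x)" using S0 C(1) x(1) by (intro mult_nonneg_nonneg[OF S0]) auto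
    then show "1 - C / 2 * (?S + x) \<le> (1 - C / 2 * ?S) * (1 - C / 2 * x)" by (simp add: algebra_simps)
  qed
  also have "\<dots> = (nrm p (Pr ?s F) * (1 - C / 2 * ?S)) * (1 - C / 2 * x)" by simp
  also have "\<dots> \<le> nrm p (Pr ?s (Ch a Q F j)) * (1 - C / 2 * x)"
    using Suc x by (intro mult_right_mono) auto
  also have "\<dots> \<le> nrm p (Pr ?s (Ch a Q F (Suc j)))"
    using Pr_Tm_lower[OF pos Ch_Lp[OF a F]] unfolding ratio by simp
  finally show ?case by (simp add: x_def)
qed

text \<open>This is where \<open>R \<ge> 1 + C\<close> comes from: the geometric series sums to at
  most \<open>1 / (R - 1)\<close>, and \<open>C / (R - 1)\<close> must not exceed 1 for half of the
  block to survive.\<close>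

private lemma Ch_project_half:
  assumes a: "a > 0" and F: "Lp p F" and "k \<le> Q"
  shows "nrm p (Pr (a * R ^ (Q - k)) F) \<le> 2 * nrm p (Pr (a * R ^ (Q - k)) (Ch a Q F k))"
proof -
  have "(\<Sum>i<k. (1/R) ^ (k - i)) \<le> (1/R) ^ (k - k) * ((1/R) / (1 - 1/R))"
    by (rule sum_geometric_tail) (use R in auto)
  also have "\<dots> = 1 / (R - 1)" using R by (simp add: field_simps)
  finally have "C / 2 * (\<Sum>i<k. (1/R) ^ (k - i)) \<le> C / 2 * (1 / (R - 1))"
    using C by (intro mult_left_mono) auto
  also have "\<dots> \<le> 1/2" using R by (simp add: field_simps)
  finally have "nrm p (Pr (a * R ^ (Q - k)) F) * (1/2) \<le> nrm p (Pr (a * R ^ (Q - k)) F) * (1 - C / 2 * (\<Sum>i<k. (1/R) ^ (k - i)))"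
    by (intro mult_left_mono nrm_nonneg) simp
  also have "\<dots> \<le> nrm p (Pr (a * R ^ (Q - k)) (Ch a Q F k))"
    by (rule Ch_project[OF a F order_refl assms(3)])
  finally show ?thesis by simp
qed

text \<open>At each level the block is at most twice the block of the chain, which is controlled by
  the increment there; the energy bound sums the squares uniformly in \<open>Q\<close>. The free
  offset \<open>a\<close> later selects a residue class.\<close>

lemma lacunary_square_sum:
  assumes a: "a > 0" and F: "Lp p F"
  shows "(\<Sum>q\<le>Q. (block_norm p (a * R ^ q) e (\<lambda>x. F x))\<^sup>2)
    \<le> (2 * (LBINT x. norm (finv e x)))\<^sup>2 / (p * (p - 1) / 8 * 2 powr (p - 2)) * (nrm p F)\<^sup>2"
proof -
  define c where "c = p * (p - 1) / 8 * 2 powr (p - 2)"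
  have c: "c > 0" using p by (simp add: c_def)
  define E where "E = (LBINT x. norm (finv e x))"
  have E: "E \<ge> 0" by (simp add: E_def)
  let ?d = "\<lambda>k. (nrm p (\<lambda>x. Ch a Q F k x - Av (a * R ^ (Q - k)) (Ch a Q F k) x))"
  have "(\<Sum>q\<le>Q. (nrm p (Pr (a * R ^ q) F))\<^sup>2) = (\<Sum>k<Suc Q. (nrm p (Pr (a * R ^ (Q - k)) F))\<^sup>2)"
    unfolding lessThan_Suc_atMost
    by (rule sum.reindex_bij_witness[of _ "\<lambda>k. Q - k" "\<lambda>k. Q - k"]) auto
  also have "\<dots> \<le> (2 * E)\<^sup>2 / c * (nrm p F)\<^sup>2"
  proof (cases "nrm p F = 0")
    case True
    have "nrm p (Pr (a * R ^ (Q - k)) F) = 0" for k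
      using Pr(2)[of "a * R ^ (Q - k)" F] a R F True nrm_nonneg[of p "Pr (a * R ^ (Q - k)) F"] by simp
    then show ?thesis by (simp add: True)
  next
    case False
    then have N: "nrm p F > 0" using nrm_nonneg[of p F] by simp
    have "(\<Sum>k<Suc Q. (nrm p (Pr (a * R ^ (Q - k)) F))\<^sup>2) \<le> (\<Sum>k<Suc Q. (2 * E)\<^sup>2 * (?d k)\<^sup>2)"
    proof (rule sum_mono)
      fix k assume "k \<in> {..<Suc Q}"
      then have k: "k \<le> Q" by simp
      have s: "a * R ^ (Q - k) > 0" using a R by simp
      have "nrm p (Pr (a * R ^ (Q - k)) F) \<le> 2 * nrm p (Pr (a * R ^ (Q - k)) (Ch a Q F k))"
        by (rule Ch_project_half[OF a F k])
      also have "\<dots> \<le> 2 * (E * ?d k)"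
        using Pr_le_increment[OF s Ch_Lp[OF a F]] by (simp add: E_def)
      finally have "(nrm p (Pr (a * R ^ (Q - k)) F))\<^sup>2 \<le> (2 * (E * ?d k))\<^sup>2"
        by (intro power_mono nrm_nonneg)
      then show "(nrm p (Pr (a * R ^ (Q - k)) F))\<^sup>2 \<le> (2 * E)\<^sup>2 * (?d k)\<^sup>2"
        by (simp add: power_mult_distrib)
    qed
    also have "\<dots> = (2 * E)\<^sup>2 * (\<Sum>k<Suc Q. (?d k)\<^sup>2)" by (simp only: sum_distrib_left)
    also have "(\<Sum>k<Suc Q. (?d k)\<^sup>2) \<le> (nrm p F)\<^sup>2 / c"
    proof -
      have "c * nrm p F powr (p - 2) * (\<Sum>k<Suc Q. (?d k)\<^sup>2) \<le> nrm p F powr p"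
        using Ch_energy[OF a F N, of Q "Suc Q"] powr_ge_zero[of "nrm p (Ch a Q F (Suc Q))" p]
        unfolding c_def by linarith
      also have "nrm p F powr p = nrm p F powr (p - 2) * (nrm p F)\<^sup>2"
        using N by (simp add: powr_diff)
      finally have "nrm p F powr (p - 2) * (c * (\<Sum>k<Suc Q. (?d k)\<^sup>2)) \<le> nrm p F powr (p - 2) * (nrm p F)\<^sup>2"
        by (simp add: mult_ac)
      then have "c * (\<Sum>k<Suc Q. (?d k)\<^sup>2) \<le> (nrm p F)\<^sup>2"
        using N by (simp add: mult_le_cancel_left)
      then show ?thesis using c by (simp add: pos_le_divide_eq mult.commute)
    qed
    finally show ?thesis by (simp add: mult_left_mono)
  qed
  finally show ?thesis by (simp add: Pr_def E_def c_def)
qed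

end

text \<open>The lacunary bound holds for frequencies in ratio \<open>2 ^ m\<close> with any starting
  point. Starting at \<open>2 ^ r\<close> for each \<open>r < m\<close> covers every dyadic
  frequency at the price of the factor \<open>m\<close>.\<close>

theorem Littlewood_Paley:
  fixes \<phi>0 e :: "real^'n::finite \<Rightarrow> real"
  assumes \<phi>0: "admissible_phi0 \<phi>0" and p: "1 < p" "p \<le> 2"
    and e: "tf e" "\<And>\<xi>. e \<xi> \<noteq> 0 \<Longrightarrow> 1/2 \<le> norm \<xi> \<and> norm \<xi> \<le> 2"
  obtains C where "C \<ge> 0" "\<And>F N. Lp p F \<Longrightarrow>
    (\<Sum>j<N. (block_norm p (2 ^ j) e (\<lambda>x. F x))\<^sup>2) \<le> C * (nrm p F)\<^sup>2"
proof (rule averaging_kernel_exists[OF \<phi>0])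
  fix K :: "real^'n \<Rightarrow> real" assume K: "integrable lborel K" "\<And>x. K x \<ge> 0" "(LBINT x. K x) = 1"
    "integrable lborel (\<lambda>x. norm x * K x)"
    "\<And>\<xi>. norm \<xi> \<ge> 1/2 \<Longrightarrow> (LBINT x. cx (K x) * cis (2 * pi * (x \<bullet> \<xi>))) = 0"
  \<comment> \<open>Stretched by 2, \<open>\<phi>0\<close> is 1 up to radius 22/10 and so covers the
    spectrum of \<open>e\<close>.\<close>
  define \<theta> where "\<theta> \<xi> = \<phi>0 ((1/2) *\<^sub>R \<xi>)" for \<xi>
  have \<theta>: "tf \<theta>" unfolding \<theta>_def by (rule tf_scale[OF admissible_tf[OF \<phi>0]]) simp
  have \<theta>1: "\<theta> \<xi> = 1" if "e \<xi> \<noteq> 0" for \<xi>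
    unfolding \<theta>_def by (rule admissible_one[OF \<phi>0]) (use e(2)[OF that] in simp)
  obtain C where C: "C \<ge> 0" "\<And>\<mu>. \<mu> > 0 \<Longrightarrow> (LBINT x. norm (finv \<theta> x - conv (dil \<mu> (\<lambda>x. cx (K x))) (finv \<theta>) x)) \<le> C / \<mu>"
    using averaging_L1_error[OF \<theta> K(1-4)] by blast
  \<comment> \<open>Taking the ratio \<open>R\<close> of the chain to be a power of two keeps all
    scales dyadic.\<close>
  obtain m where "1 + C < (2::real) ^ m" using real_arch_pow[of 2 "1 + C"] by auto
  then have m: "(2::real) ^ m > 1" "(2::real) ^ m \<ge> 1 + C" using C(1) by linarith+
  have m0: "m > 0" using m(1) by (cases m) auto
  define A where "A = (2 * (LBINT x. norm (finv e x)))\<^sup>2 / (p * (p - 1) / 8 * 2 powr (p - 2))"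
  have A: "A \<ge> 0" using p by (simp add: A_def)
  have main: "(\<Sum>q\<le>Q. (block_norm p (a * (2 ^ m) ^ q) e (\<lambda>x. F x))\<^sup>2) \<le> A * (nrm p F)\<^sup>2"
    if "a > 0" "Lp p F" for a F Q
    unfolding A_def
    by (rule lacunary_square_sum[OF p K(1-3) K(5) e(1) _ \<theta> \<theta>1 C m that]) (use e(2) in auto)
  show thesis
  proof (rule that[of "real m * A"])
    show "real m * A \<ge> 0" using A by simp
    fix F :: "real^'n \<Rightarrow> real" and N assume F: "Lp p F"
    let ?f = "\<lambda>j. (block_norm p (2 ^ j) e (\<lambda>x. F x))\<^sup>2"
    \<comment> \<open>The range is enlarged to a multiple of \<open>m\<close>, so that it splits
      into complete groups.\<close>
    have "(\<Sum>j<N. ?f j) \<le> (\<Sum>j<Suc N * m. ?f j)"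
    proof (rule sum_mono2)
      have "Suc N * 1 \<le> Suc N * m" using m0 by (intro mult_le_mono2) simp
      then have "N \<le> Suc N * m" by (rule order_trans[rotated]) simp
      then show "{..<N} \<subseteq> {..<Suc N * m}" by auto
    qed auto
    also have "\<dots> = (\<Sum>q<Suc N. sum ?f {q * m..<q * m + m})"
      by (rule sum.nat_group[symmetric])
    also have "\<dots> = (\<Sum>q<Suc N. \<Sum>r<m. ?f (q * m + r))"
    proof (rule sum.cong[OF refl])
      have "sum g {k..<k + m} = (\<Sum>r<m. g (k + r))" for g :: "nat \<Rightarrow> real" and k
        using sum.shift_bounds_nat_ivl[of g 0 k m] by (simp add: add.commute lessThan_atLeast0)
      then show "sum ?f {q * m..<q * m + m} = (\<Sum>r<m. ?f (q * m + r))" for q .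
    qed
    also have "\<dots> = (\<Sum>r<m. \<Sum>q<Suc N. ?f (q * m + r))" by (rule sum.swap)
    also have "\<dots> \<le> (\<Sum>r<m. A * (nrm p F)\<^sup>2)"
    proof (rule sum_mono)
      fix r
      have e: "(2::real) ^ (q * m + r) = 2 ^ r * (2 ^ m) ^ q" for q
        by (simp add: power_add power_mult[symmetric] mult.commute)
      show "(\<Sum>q<Suc N. ?f (q * m + r)) \<le> A * (nrm p F)\<^sup>2"
        unfolding e lessThan_Suc_atMost by (rule main) (use F in auto)
    qed
    also have "\<dots> = real m * A * (nrm p F)\<^sup>2" by simp
    finally show "(\<Sum>j<N. ?f j) \<le> real m * A * (nrm p F)\<^sup>2" .
  qed
qed

section \<open>The fractional Laplacian of a localised wave packet\<close>

text \<open>Both signs of the exponent occur. As \<open>0 powr a = 0\<close>, the value at the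
  origin is 0 in either case.\<close>

definition frac_sym :: "real \<Rightarrow> real^'n::finite \<Rightarrow> real" where
  "frac_sym a \<xi> = (2 * pi * norm \<xi>) powr a"

lemma frac_sym_measurable[measurable]: "frac_sym a \<in> borel_measurable borel"
  unfolding frac_sym_def[abs_def] by measurable

lemma frac_sym_nonneg: "frac_sym a \<xi> \<ge> 0"
  by (simp add: frac_sym_def)

lemma frac_sym_scale: "c > 0 \<Longrightarrow> frac_sym a (c *\<^sub>R \<xi>) = c powr a * frac_sym a \<xi>"
  by (simp add: frac_sym_def powr_mult mult.left_commute)

lemma frac_sym_minus: "frac_sym a (- \<xi>) = frac_sym a \<xi>"
  by (simp add: frac_sym_def)

lemma test_fun_frac_sym:
  fixes f :: "real^'n::finite \<Rightarrow> real"
  assumes f: "test_fun U f" and "0 < \<epsilon>" "\<And>x. norm x < \<epsilon> \<Longrightarrow> f x = 0"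
  shows "test_fun U (\<lambda>\<xi>. f \<xi> * frac_sym a \<xi>)"
proof (rule test_funI[of _ "fsupport f"])
  have "smooth_fun (\<lambda>\<xi>. (2 * pi) powr a * (f \<xi> * norm \<xi> powr a))"
    by (intro smooth_fun_cmult smooth_fun_norm_powr[of f \<epsilon>] tf_smooth[OF f] assms)
  then show "smooth_fun (\<lambda>\<xi>. f \<xi> * frac_sym a \<xi>)"
    by (simp add: frac_sym_def powr_mult mult_ac)
qed (use f in \<open>auto simp: test_fun_def fsupport_zero\<close>)

text \<open>Conjugating the transform of a real symbol reflects the symbol. For an even or odd
  symbol the transform is thus real or purely imaginary, a constant times a real smooth function,
  and the latter can be used in a test function.\<close>

definition has_parity :: "('a::real_vector \<Rightarrow> real) \<Rightarrow> bool" where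
  "has_parity f \<longleftrightarrow> (\<forall>x. f (- x) = f x) \<or> (\<forall>x. f (- x) = - f x)"

lemma has_parity_mult: "has_parity f \<Longrightarrow> has_parity g \<Longrightarrow> has_parity (\<lambda>x. f x * g x)"
  by (auto simp: has_parity_def)

lemma dd_odd:
  assumes f: "smooth_fun f" and e: "\<And>x. f (- x) = f x"
  shows "dd f v (- x) = - dd f v x"
proof -
  have "dd (\<lambda>x. f ((-1) *\<^sub>R x)) v x = (-1) * dd f v ((-1) *\<^sub>R x)"
    by (simp only: dd_scale[OF f])
  moreover have "(\<lambda>x. f ((-1) *\<^sub>R x)) = f" using e by auto
  ultimately show ?thesis by simp
qed

lemma finv_has_parity:
  fixes e :: "real^'n::finite \<Rightarrow> real"
  assumes e: "tf e" and has_parity: "has_parity e"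
  obtains c a where "\<And>x. finv e x = c * cx (a x)" "smooth_fun a"
proof -
  have ie: "integrable lborel e" by (rule tf_integrable[OF e])
  have cnj: "cnj (finv e x) = finv (\<lambda>\<xi>. e (- \<xi>)) x" for x
  proof -
    have "cnj (finv e x) = (LBINT \<xi>. cnj (cx (e \<xi>) * cis (2 * pi * (x \<bullet> \<xi>))))"
      unfolding finv_lborel[OF ie] by (rule Bochner_Integration.integral_cnj[symmetric])
    also have "\<dots> = finv e (- x)" unfolding finv_lborel[OF ie] by (simp add: cis_cnj)
    finally show ?thesis by (simp add: finv_reflect[OF ie])
  qed
  from has_parity consider "\<And>x. e (- x) = e x" | "\<And>x. e (- x) = - 1 * e x" by (auto simp: has_parity_def)
  then show thesis
  proof cases
    case 1
    then have "finv e x = cx (Re (finv e x))" for x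
      using cnj[of x] by (simp add: complex_eq_iff)
    then show thesis
      by (intro that[of 1 "\<lambda>x. Re (finv e x)"] smooth_fun_finv e) simp
  next
    case 2
    have "cnj (finv e x) = - finv e x" for x
      unfolding cnj using finv_cmult[OF ie, of "-1" x] 2 by simp
    then have "finv e x = \<i> * cx (Im (finv e x))" for x
      by (simp add: complex_eq_iff)
    then show thesis
      by (intro that[of \<i> "\<lambda>x. Im (finv e x)"] smooth_fun_finv e) simp
  qed
qed

subsection \<open>Frequency decomposition\<close>

lemma frac_lap_eq:
  fixes h :: "real^'n::finite \<Rightarrow> real"
  assumes h: "tf h"
  shows "frac_lap s h y = (LBINT \<xi>. cx (frac_sym (2 * s) \<xi>) * finv h (- \<xi>) * cis (2 * pi * (y \<bullet> \<xi>)))"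
proof -
  note [measurable] = tf_measurable[OF h] finv_measurable[OF h]
  have "fourier (\<lambda>x. cx (h x)) \<xi> = finv h (- \<xi>)" for \<xi>
    by (simp add: fourier_eq_inv finv_def)
  then have "frac_lap s h y = fourier_inv (\<lambda>\<xi>. cx (frac_sym (2 * s) \<xi>) * finv h (- \<xi>)) y"
    by (simp add: frac_lap_def frac_sym_def)
  then show ?thesis by (simp add: fourier_inv_lborel)
qed

lemma frac_lap_measurable:
  fixes h :: "real^'n::finite \<Rightarrow> real"
  assumes h: "tf h"
  shows "frac_lap s h \<in> borel_measurable borel"
proof -
  note [measurable] = finv_measurable[OF h]
  have "(\<lambda>y. LBINT \<xi>. cx (frac_sym (2 * s) \<xi>) * finv h (- \<xi>) * cis (2 * pi * (y \<bullet> \<xi>))) \<in> borel_measurable lborel"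
    by (rule lborel.borel_measurable_lebesgue_integral) measurable
  then show ?thesis by (simp add: frac_lap_eq[OF h, abs_def])
qed

lemma frac_sym_integrable:
  fixes h :: "real^'n::finite \<Rightarrow> real"
  assumes h: "tf h" and s: "0 < s" "s < 1"
  shows "integrable lborel (\<lambda>\<xi>. frac_sym (2 * s) \<xi> * norm (finv h (- \<xi>)))"
proof -
  note [measurable] = finv_measurable[OF h]
  define A where "A = (2 * pi) powr (2 * s)"
  have A: "A \<ge> 0" by (simp add: A_def)
  show ?thesis
  proof (rule Bochner_Integration.integrable_bound)
    have "integrable lborel (\<lambda>x. (1 + norm x) ^ 2 * norm (finv h x))"
      by (rule rapid_integrable_moment[OF rapid_finv[OF h]])
    then have "integrable lborel (\<lambda>x. (1 + norm (0 - x)) ^ 2 * norm (finv h (0 - x)))"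
      by (subst lborel_integrable_translate(3)[of "\<lambda>x. (1 + norm x) ^ 2 * norm (finv h x)" 0]) auto
    then show "integrable lborel (\<lambda>x. A * ((1 + norm x) ^ 2 * norm (finv h (- x))))"
      by simp
    have "frac_sym (2 * s) \<xi> \<le> A * (1 + norm \<xi>) ^ 2" for \<xi> :: "real^'n"
    proof -
      have "norm \<xi> powr (2 * s) \<le> (1 + norm \<xi>) powr (2 * s)" using s by (intro powr_mono2) auto
      also have "\<dots> \<le> (1 + norm \<xi>) powr 2" using s by (intro powr_mono) auto
      also have "\<dots> = (1 + norm \<xi>) ^ 2" by (simp add: add_pos_nonneg)
      finally show ?thesis using A by (simp add: frac_sym_def powr_mult A_def mult_left_mono)
    qed
    then have "frac_sym (2 * s) \<xi> * norm (finv h (- \<xi>)) \<le> A * (1 + norm \<xi>) ^ 2 * norm (finv h (- \<xi>))" for \<xi> :: "real^'n"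
      by (intro mult_right_mono) auto
    then show "AE \<xi> in lborel. norm (frac_sym (2 * s) \<xi> * norm (finv h (- \<xi>))) \<le> norm (A * ((1 + norm \<xi>) ^ 2 * norm (finv h (- \<xi>))))"
      using A by (intro AE_I2) (simp add: frac_sym_nonneg abs_mult mult.assoc)
  qed measurable
qed

lemma multiplier_conv:
  fixes h q :: "real^'n::finite \<Rightarrow> real"
  assumes h: "tf h" and q: "tf q"
  shows "(LBINT \<xi>. cx (q \<xi>) * finv h (- \<xi>) * cis (2 * pi * (y \<bullet> \<xi>)))
    = conv (finv q) (\<lambda>z. cx (h z)) y"
proof -
  note [measurable] = tf_measurable[OF h] tf_measurable[OF q]
  have ih: "integrable lborel h" and iq: "integrable lborel q" by (auto intro: tf_integrable h q)
  have "(LBINT \<xi>. cx (q \<xi>) * finv h (- \<xi>) * cis (2 * pi * (y \<bullet> \<xi>)))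
    = (LBINT \<xi>. (LBINT z. cx (q \<xi>) * cis (2 * pi * (y \<bullet> \<xi>)) * (cx (h z) * cis (2 * pi * (- \<xi> \<bullet> z)))))"
    unfolding finv_lborel[OF ih] integral_mult_right_zero by (simp add: mult_ac)
  also have "\<dots> = (LBINT z. (LBINT \<xi>. cx (q \<xi>) * cis (2 * pi * (y \<bullet> \<xi>)) * (cx (h z) * cis (2 * pi * (- \<xi> \<bullet> z)))))"
    by (rule Fubini_dominated[of "\<lambda>\<xi>. \<bar>q \<xi>\<bar>" "\<lambda>z. \<bar>h z\<bar>"]) (use ih iq in \<open>auto simp: norm_mult\<close>)
  also have "\<dots> = (LBINT z. finv q (y - z) * cx (h z))"
  proof (intro Bochner_Integration.integral_cong refl)
    fix z
    have "(LBINT \<xi>. cx (q \<xi>) * cis (2 * pi * (y \<bullet> \<xi>)) * (cx (h z) * cis (2 * pi * (- \<xi> \<bullet> z))))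
      = (LBINT \<xi>. (cx (q \<xi>) * cis (2 * pi * ((y - z) \<bullet> \<xi>))) * cx (h z))"
    proof (intro Bochner_Integration.integral_cong refl)
      fix \<xi>
      have "cis (2 * pi * ((y - z) \<bullet> \<xi>)) = cis (2 * pi * (y \<bullet> \<xi>)) * cis (2 * pi * (- \<xi> \<bullet> z))"
        by (simp add: cis_mult inner_diff_left inner_commute algebra_simps)
      then show "cx (q \<xi>) * cis (2 * pi * (y \<bullet> \<xi>)) * (cx (h z) * cis (2 * pi * (- \<xi> \<bullet> z)))
        = (cx (q \<xi>) * cis (2 * pi * ((y - z) \<bullet> \<xi>))) * cx (h z)" by simp
    qed
    then show "(LBINT \<xi>. cx (q \<xi>) * cis (2 * pi * (y \<bullet> \<xi>)) * (cx (h z) * cis (2 * pi * (- \<xi> \<bullet> z))))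
      = finv q (y - z) * cx (h z)"
      by (simp add: finv_lborel[OF iq])
  qed
  finally show ?thesis by (simp add: conv_def)
qed

text \<open>The common shape of the dyadic functions: for \<open>j \<ge> 1\<close>,
  \<open>dyadic \<phi>0 j\<close> is this function dilated by \<open>2 ^ j\<close>.\<close>

definition annulus :: "(real^'n::finite \<Rightarrow> real) \<Rightarrow> real^'n \<Rightarrow> real" where
  "annulus \<phi>0 \<xi> = \<phi>0 \<xi> - \<phi>0 (2 *\<^sub>R \<xi>)"

text \<open>The telescoped sum of the annuli at scales 1/2, 1 and 2, equal to 1 around the support
  of the middle one.\<close>

definition mid :: "(real^'n::finite \<Rightarrow> real) \<Rightarrow> real^'n \<Rightarrow> real" where
  "mid \<phi>0 \<xi> = \<phi>0 ((1/2) *\<^sub>R \<xi>) - \<phi>0 (4 *\<^sub>R \<xi>)"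

definition annulus_part :: "(real^'n::finite \<Rightarrow> real) \<Rightarrow> real \<Rightarrow> real \<Rightarrow> real^'n \<Rightarrow> real" where
  "annulus_part \<phi>0 s c \<xi> = annulus \<phi>0 ((1/c) *\<^sub>R \<xi>) * frac_sym (2 * s) \<xi>"

definition mid_part :: "(real^'n::finite \<Rightarrow> real) \<Rightarrow> real \<Rightarrow> real^'n \<Rightarrow> real" where
  "mid_part \<phi>0 s \<xi> = mid \<phi>0 \<xi> * frac_sym (2 * s) \<xi>"

context
  fixes \<phi>0 :: "real^'n::finite \<Rightarrow> real" and s :: real
  assumes \<phi>0: "admissible_phi0 \<phi>0" and s: "0 < s" "s < 1"
begin

lemma annulus_tf: "tf (annulus \<phi>0)"
  unfolding annulus_def[abs_def] by (intro test_fun_diff tf_scale admissible_tf[OF \<phi>0]) simp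

lemma annulus_zero: "norm \<xi> < 11/20 \<or> norm \<xi> \<ge> 19/10 \<Longrightarrow> annulus \<phi>0 \<xi> = 0"
  using admissible_one[OF \<phi>0, of \<xi>] admissible_one[OF \<phi>0, of "2 *\<^sub>R \<xi>"]
    admissible_zero[OF \<phi>0, of \<xi>] admissible_zero[OF \<phi>0, of "2 *\<^sub>R \<xi>"]
  by (auto simp: annulus_def)

lemma mid_tf: "tf (mid \<phi>0)"
  unfolding mid_def[abs_def] by (intro test_fun_diff tf_scale admissible_tf[OF \<phi>0]) simp_all

lemma mid_zero: "norm \<xi> < 11/40 \<Longrightarrow> mid \<phi>0 \<xi> = 0"
  using admissible_one[OF \<phi>0, of "(1/2) *\<^sub>R \<xi>"] admissible_one[OF \<phi>0, of "4 *\<^sub>R \<xi>"] by (simp add: mid_def)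

lemma mid_one: "19/40 \<le> norm \<xi> \<Longrightarrow> norm \<xi> < 22/10 \<Longrightarrow> mid \<phi>0 \<xi> = 1"
  using admissible_one[OF \<phi>0, of "(1/2) *\<^sub>R \<xi>"] admissible_zero[OF \<phi>0, of "4 *\<^sub>R \<xi>"] by (simp add: mid_def)

lemma mid_minus: "mid \<phi>0 (- \<xi>) = mid \<phi>0 \<xi>"
  using admissible_radial[OF \<phi>0, of "(1/2) *\<^sub>R (- \<xi>)" "(1/2) *\<^sub>R \<xi>"] admissible_radial[OF \<phi>0, of "4 *\<^sub>R (- \<xi>)" "4 *\<^sub>R \<xi>"]
  by (simp add: mid_def)

lemma mid_part_tf: "tf (mid_part \<phi>0 s)"
  unfolding mid_part_def[abs_def] by (rule test_fun_frac_sym[OF mid_tf, of "11/40"]) (auto intro: mid_zero)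

lemma mid_part_minus: "mid_part \<phi>0 s (- \<xi>) = mid_part \<phi>0 s \<xi>"
  by (simp add: mid_part_def mid_minus frac_sym_minus)

lemma annulus_part_tf: "c > 0 \<Longrightarrow> tf (annulus_part \<phi>0 s c)"
  unfolding annulus_part_def[abs_def]
  by (rule test_fun_frac_sym[OF tf_scale[OF annulus_tf], of _ "11/20 * c"]) (auto intro!: annulus_zero simp: divide_less_eq)

lemma annulus_part_zero: "c > 0 \<Longrightarrow> norm \<xi> < 11/20 * c \<or> norm \<xi> \<ge> 19/10 * c \<Longrightarrow> annulus_part \<phi>0 s c \<xi> = 0"
  by (auto simp: annulus_part_def pos_divide_less_eq pos_le_divide_eq intro!: annulus_zero)

text \<open>Homogeneity of the symbol: all pieces are dilates of one kernel with a factor c^(2s),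
  the source of the geometric series in the remainder estimate.\<close>

lemma finv_annulus_part:
  assumes c: "c > 0"
  shows "finv (annulus_part \<phi>0 s c) x = cx (c powr (2 * s)) * dil c (finv (annulus_part \<phi>0 s 1)) x"
proof -
  have i: "integrable lborel (annulus_part \<phi>0 s 1)" by (rule tf_integrable[OF annulus_part_tf]) simp
  have i': "integrable lborel (\<lambda>\<xi>. annulus_part \<phi>0 s 1 ((1/c) *\<^sub>R \<xi>))"
    using tf_integrable[OF tf_scale[OF annulus_part_tf[of 1], of "1/c"]] c by simp
  have "annulus_part \<phi>0 s c = (\<lambda>\<xi>. c powr (2 * s) * annulus_part \<phi>0 s 1 ((1/c) *\<^sub>R \<xi>))"
    using c by (auto simp: annulus_part_def fun_eq_iff frac_sym_scale powr_divide)
  then show ?thesis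
    using finv_cmult[OF i', of "c powr (2 * s)" x] finv_dil[OF i c] by simp
qed

definition window :: "nat \<Rightarrow> real^'n \<Rightarrow> real" where
  "window k \<xi> = \<phi>0 ((1 / 2 ^ Suc k) *\<^sub>R \<xi>) - \<phi>0 (2 ^ Suc (Suc k) *\<^sub>R \<xi>)"

text \<open>Telescoping. The exponents \<open>i + 2\<close> start at 2 because \<open>mid\<close>
  already contains the scales 1/2, 1 and 2.\<close>

lemma window_decomp:
  "window k \<xi> * frac_sym (2 * s) \<xi> = mid_part \<phi>0 s \<xi>
     + (\<Sum>i<k. annulus_part \<phi>0 s (2 ^ (i + 2)) \<xi> + annulus_part \<phi>0 s (1 / 2 ^ (i + 2)) \<xi>)"
proof -
  have "window k \<xi> = mid \<phi>0 \<xi> + (\<Sum>i<k. annulus \<phi>0 ((1 / 2 ^ (i + 2)) *\<^sub>R \<xi>) + annulus \<phi>0 (2 ^ (i + 2) *\<^sub>R \<xi>))"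
    by (induction k) (auto simp: window_def mid_def annulus_def power_add)
  then show ?thesis
    by (simp add: mid_part_def annulus_part_def ring_distribs sum_distrib_right)
qed

lemma window_tf: "tf (window k)"
  unfolding window_def[abs_def] by (intro test_fun_diff tf_scale admissible_tf[OF \<phi>0]) simp_all

text \<open>Each truncated symbol is a test function and acts by convolution with an integrable
  kernel. The windows are bounded by 1 and equal 1 eventually at every nonzero frequency, so the
  partial sums converge at each point by dominated convergence.\<close>

lemma frac_lap_limit:
  fixes h :: "real^'n \<Rightarrow> real"
  assumes h: "tf h"
  shows "(\<lambda>k. conv (finv (mid_part \<phi>0 s)) (\<lambda>z. cx (h z)) y
     + (\<Sum>i<k. conv (finv (annulus_part \<phi>0 s (2 ^ (i + 2)))) (\<lambda>z. cx (h z)) y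
          + conv (finv (annulus_part \<phi>0 s (1 / 2 ^ (i + 2)))) (\<lambda>z. cx (h z)) y))
     \<longlonglongrightarrow> frac_lap s h y"
proof -
  note [measurable] = tf_measurable[OF window_tf] finv_measurable[OF h]
  define H where "H \<xi> = finv h (- \<xi>) * cis (2 * pi * (y \<bullet> \<xi>))" for \<xi>
  have [measurable]: "H \<in> borel_measurable borel" unfolding H_def by measurable
  have nH: "norm (H \<xi>) = norm (finv h (- \<xi>))" for \<xi> by (simp add: H_def norm_mult)
  obtain B where B: "\<And>x. norm (finv h x) \<le> B" using finv_bound[OF tf_integrable[OF h]] by blast
  have iH: "integrable lborel (\<lambda>\<xi>. cx (q \<xi>) * H \<xi>)" if q: "tf q" for q
  proof (rule Bochner_Integration.integrable_bound)
    note [measurable] = tf_measurable[OF q]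
    show "integrable lborel (\<lambda>\<xi>. B * \<bar>q \<xi>\<bar>)" using tf_integrable[OF q] by simp
    have B0: "B \<ge> 0" using B[of 0] norm_ge_zero by (rule order_trans[rotated])
    show "AE \<xi> in lborel. norm (cx (q \<xi>) * H \<xi>) \<le> norm (B * \<bar>q \<xi>\<bar>)"
      using mult_right_mono[OF B] B0 by (intro AE_I2) (simp add: norm_mult nH abs_mult mult.commute[of "\<bar>q _\<bar>"])
    show "(\<lambda>\<xi>. cx (q \<xi>) * H \<xi>) \<in> borel_measurable lborel" by measurable
  qed
  have conv: "conv (finv q) (\<lambda>z. cx (h z)) y = (LBINT \<xi>. cx (q \<xi>) * H \<xi>)" if "tf q" for q
    using multiplier_conv[OF h that, of y] by (simp add: H_def mult.assoc)
  have "(\<lambda>k. LBINT \<xi>. cx (window k \<xi> * frac_sym (2 * s) \<xi>) * H \<xi>)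
     \<longlonglongrightarrow> (LBINT \<xi>. cx (frac_sym (2 * s) \<xi>) * H \<xi>)"
  proof (rule integral_dominated_convergence[where w = "\<lambda>\<xi>. frac_sym (2 * s) \<xi> * norm (finv h (- \<xi>))"])
    show "integrable lborel (\<lambda>\<xi>. frac_sym (2 * s) \<xi> * norm (finv h (- \<xi>)))"
      by (rule frac_sym_integrable[OF h s])
    fix k
    have "\<bar>window k \<xi>\<bar> \<le> 1" for \<xi>
    proof -
      have "0 \<le> \<phi>0 \<eta> \<and> \<phi>0 \<eta> \<le> 1" for \<eta> using \<phi>0 unfolding admissible_phi0_def by blast
      then show ?thesis unfolding window_def by (smt (verit))
    qed
    then have "\<bar>window k \<xi>\<bar> * (frac_sym (2 * s) \<xi> * norm (finv h (- \<xi>))) \<le> 1 * (frac_sym (2 * s) \<xi> * norm (finv h (- \<xi>)))" for \<xi>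
      by (intro mult_right_mono mult_nonneg_nonneg frac_sym_nonneg) auto
    then show "AE \<xi> in lborel. norm (cx (window k \<xi> * frac_sym (2 * s) \<xi>) * H \<xi>) \<le> frac_sym (2 * s) \<xi> * norm (finv h (- \<xi>))"
      by (intro AE_I2) (simp add: norm_mult nH frac_sym_nonneg mult.assoc)
  next
    show "AE \<xi> in lborel. (\<lambda>k. cx (window k \<xi> * frac_sym (2 * s) \<xi>) * H \<xi>) \<longlonglongrightarrow> cx (frac_sym (2 * s) \<xi>) * H \<xi>"
      using AE_lborel_singleton[of "0::real^'n"]
    proof eventually_elim
      case (elim \<xi>)
      then have n: "norm \<xi> > 0" by simp
      obtain k0 where k0: "norm \<xi> < 2 ^ k0" using real_arch_pow[of 2 "norm \<xi>"] by auto
      obtain k1 where k1: "19/10 / norm \<xi> < 2 ^ k1" using real_arch_pow[of 2 "19/10 / norm \<xi>"] by auto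
      have "window k \<xi> = 1" if k: "k \<ge> max k0 k1" for k
      proof -
        have "norm \<xi> < 2 ^ Suc k"
          using k0 power_increasing[of k0 "Suc k" "2::real"] k by simp
        then have "norm \<xi> / 2 ^ Suc k < 1" by (simp add: divide_less_eq del: power_Suc)
        moreover have "norm ((1 / 2 ^ Suc k) *\<^sub>R \<xi>) = norm \<xi> / 2 ^ Suc k" by simp
        ultimately have "norm ((1 / 2 ^ Suc k) *\<^sub>R \<xi>) < 11/10" by linarith
        moreover have "19/10 / norm \<xi> < 2 ^ Suc (Suc k)"
          using k1 power_increasing[of k1 "Suc (Suc k)" "2::real"] k by simp
        then have "norm ((2 ^ Suc (Suc k)) *\<^sub>R \<xi>) \<ge> 19/10" using n by (simp add: pos_divide_less_eq)
        ultimately show ?thesis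
          unfolding window_def using admissible_one[OF \<phi>0] admissible_zero[OF \<phi>0] by simp
      qed
      then have "\<forall>\<^sub>F k in sequentially. cx (window k \<xi> * frac_sym (2 * s) \<xi>) * H \<xi> = cx (frac_sym (2 * s) \<xi>) * H \<xi>"
        unfolding eventually_sequentially by (intro exI[of _ "max k0 k1"]) simp
      then show ?case by (rule tendsto_eventually)
    qed
  qed measurable
  moreover have "(LBINT \<xi>. cx (window k \<xi> * frac_sym (2 * s) \<xi>) * H \<xi>) =
     conv (finv (mid_part \<phi>0 s)) (\<lambda>z. cx (h z)) y
     + (\<Sum>i<k. conv (finv (annulus_part \<phi>0 s (2 ^ (i + 2)))) (\<lambda>z. cx (h z)) y
          + conv (finv (annulus_part \<phi>0 s (1 / 2 ^ (i + 2)))) (\<lambda>z. cx (h z)) y)" for k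
  proof -
    have t: "tf (annulus_part \<phi>0 s (2 ^ (i + 2)))" "tf (annulus_part \<phi>0 s (1 / 2 ^ (i + 2)))" for i
      by (intro annulus_part_tf; simp)+
    have "(LBINT \<xi>. cx (window k \<xi> * frac_sym (2 * s) \<xi>) * H \<xi>)
      = (LBINT \<xi>. cx (mid_part \<phi>0 s \<xi>) * H \<xi>
          + (\<Sum>i<k. cx (annulus_part \<phi>0 s (2 ^ (i + 2)) \<xi>) * H \<xi> + cx (annulus_part \<phi>0 s (1 / 2 ^ (i + 2)) \<xi>) * H \<xi>))"
      unfolding window_decomp
      by (intro Bochner_Integration.integral_cong refl) (simp add: ring_distribs sum_distrib_right)
    also have "\<dots> = (LBINT \<xi>. cx (mid_part \<phi>0 s \<xi>) * H \<xi>)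
        + (\<Sum>i<k. (LBINT \<xi>. cx (annulus_part \<phi>0 s (2 ^ (i + 2)) \<xi>) * H \<xi>)
             + (LBINT \<xi>. cx (annulus_part \<phi>0 s (1 / 2 ^ (i + 2)) \<xi>) * H \<xi>))"
      using iH[OF mid_part_tf] iH[OF t(1)] iH[OF t(2)]
      by (subst Bochner_Integration.integral_add, simp, intro Bochner_Integration.integrable_sum Bochner_Integration.integrable_add, simp, simp)
         (subst Bochner_Integration.integral_sum, intro Bochner_Integration.integrable_add, simp, simp, simp)
    finally show ?thesis unfolding conv[OF mid_part_tf] conv[OF t(1)] conv[OF t(2)] .
  qed
  ultimately show ?thesis by (simp add: frac_lap_eq[OF h] H_def mult.assoc)
qed

end

text \<open>The second-order Taylor remainder of a pairing. The factor
  \<open>(norm w)\<^sup>2\<close> sits on the kernel around whose centre the cutoff is expanded, so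
  the order of the arguments matters. Its integral factorises into a second moment of
  \<open>P\<close> and an \<open>L\<^sup>1\<close> norm of \<open>Q\<close>.\<close>

definition cross_moment :: "(real^'n::finite \<Rightarrow> complex) \<Rightarrow> (real^'n \<Rightarrow> complex) \<Rightarrow> real^'n \<Rightarrow> real" where
  "cross_moment P Q v = (LBINT w. (norm w)\<^sup>2 * norm (P w) * norm (Q (v + w)))"

lemma cross_moment_nonneg: "cross_moment P Q v \<ge> 0"
  by (simp add: cross_moment_def)

lemma cross_moment_integrable:
  fixes P Q :: "real^'n::finite \<Rightarrow> complex"
  assumes P: "rapid P" and Q: "rapid Q"
  shows "integrable lborel (cross_moment P Q)"
    and "(LBINT v. cross_moment P Q v) = (LBINT w. (norm w)\<^sup>2 * norm (P w)) * (LBINT w. norm (Q w))"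
proof -
  have [measurable]: "P \<in> borel_measurable borel" "Q \<in> borel_measurable borel"
    using P Q by (auto simp: rapid_def)
  let ?g = "\<lambda>w. (norm w)\<^sup>2 * norm (P w)"
  have ig: "integrable lborel ?g" by (rule rapid_integrable(2)[OF P])
  have ig': "integrable lborel (\<lambda>y. ?g (0 - y))"
    by (subst lborel_integrable_translate(3)) (use ig in auto)
  have iq: "integrable lborel (\<lambda>x. norm (Q x))" using rapid_integrable(1)[OF Q] by simp
  have eq: "cross_moment P Q = conv (\<lambda>x. norm (Q x)) (\<lambda>y. ?g (0 - y))"
  proof
    fix v
    have "cross_moment P Q v = (LBINT w. norm (Q (v - (0 - w))) * ?g w)"
      by (simp add: cross_moment_def mult_ac)
    also have "\<dots> = (LBINT y. norm (Q (v - (0 - (0 - y)))) * ?g (0 - y))"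
      by (rule lborel_integral_translate(3)[symmetric]) measurable
    finally show "cross_moment P Q v = conv (\<lambda>x. norm (Q x)) (\<lambda>y. ?g (0 - y)) v"
      by (simp add: conv_def)
  qed
  show "integrable lborel (cross_moment P Q)"
    unfolding eq by (rule conv_integrable(2)[OF iq ig'])
  show "(LBINT v. cross_moment P Q v) = (LBINT w. (norm w)\<^sup>2 * norm (P w)) * (LBINT w. norm (Q w))"
    unfolding eq conv_integrable(3)[OF iq ig']
    by (subst lborel_integral_translate(3)[of ?g]) (auto simp: mult.commute)
qed

text \<open>With \<open>z = y - w\<close> the cutoff is expanded at \<open>y\<close>, the centre of
  \<open>P\<close>. The terms of order 0 and 1 are correlations, which Fourier analysis evaluates
  exactly; only the quadratic remainder is estimated.\<close>

lemma taylor_pairing: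
  fixes P Q :: "real^'n::finite \<Rightarrow> complex" and \<eta> :: "real^'n \<Rightarrow> real"
  assumes P: "rapid P" and Q[measurable]: "Q \<in> borel_measurable borel" and A: "\<And>w. norm (Q w) \<le> A"
    and \<eta>: "tf \<eta>" and B: "\<And>b c x. b \<in> Basis \<Longrightarrow> c \<in> Basis \<Longrightarrow> \<bar>dd (dd \<eta> b) c x\<bar> \<le> B"
  shows "norm ((LBINT z. P (y - z) * (cx (\<eta> z) * Q (x - z)))
      - cx (\<eta> y) * (LBINT w. P w * Q (x - y + w))
      + (\<Sum>b\<in>Basis. cx (dd \<eta> b y) * (LBINT w. cx (w \<bullet> b) * P w * Q (x - y + w))))
    \<le> (real CARD('n))\<^sup>2 * B * cross_moment P Q (x - y)"
proof -
  have Pm[measurable]: "P \<in> borel_measurable borel" using P by (simp add: rapid_def)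
  note [measurable] = tf_measurable[OF \<eta>]
  have A0: "A \<ge> 0" using A[of 0] norm_ge_zero by (rule order_trans[rotated])
  obtain H where H: "\<And>z. \<bar>\<eta> z\<bar> \<le> H" using tf_bounded[OF \<eta>] by blast
  have H0: "H \<ge> 0" using H[of 0] abs_ge_zero by (rule order_trans[rotated])
  define v where "v = x - y"
  have iP: "integrable lborel (\<lambda>w. norm w ^ k * norm (P w))" for k by (rule rapid_integrable(2)[OF P])
  have bnd: "integrable lborel (\<lambda>w. g w * P w * Q (v + w))"
    if [measurable]: "g \<in> borel_measurable borel" and g: "\<And>w. norm (g w) \<le> D * norm w ^ k" and D: "D \<ge> 0" for g :: "real^'n \<Rightarrow> complex" and k D
  proof (rule Bochner_Integration.integrable_bound[of _ "\<lambda>w. D * A * (norm w ^ k * norm (P w))"])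
    show "integrable lborel (\<lambda>w. D * A * (norm w ^ k * norm (P w)))" by (intro integrable_mult_right iP)
    have "norm (g w) * norm (P w) * norm (Q (v + w)) \<le> (D * norm w ^ k) * norm (P w) * A" for w
      using g[of w] A[of "v + w"] D A0 by (intro mult_mono) auto
    then show "AE w in lborel. norm (g w * P w * Q (v + w)) \<le> norm (D * A * (norm w ^ k * norm (P w)))"
      using D A0 by (intro AE_I2) (simp add: norm_mult abs_mult mult_ac)
  qed measurable
  have i0: "integrable lborel (\<lambda>w. cx (\<eta> (y - w)) * P w * Q (v + w))"
    by (rule bnd[of _ H 0]) (use H H0 in auto)
  have i1: "integrable lborel (\<lambda>w. 1 * P w * Q (v + w))"
    by (rule bnd[of _ 1 0]) auto
  have i2: "integrable lborel (\<lambda>w. cx (w \<bullet> b) * P w * Q (v + w))" for b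
    by (rule bnd[of _ "norm b" 1]) (auto simp: mult.commute Cauchy_Schwarz_ineq2)
  have e0: "(LBINT z. P (y - z) * (cx (\<eta> z) * Q (x - z))) = (LBINT w. cx (\<eta> (y - w)) * P w * Q (v + w))"
  proof -
    have "(LBINT z. P (y - z) * (cx (\<eta> z) * Q (x - z)))
      = (LBINT w. P (y - (y - w)) * (cx (\<eta> (y - w)) * Q (x - (y - w))))"
      by (rule lborel_integral_translate(3)[symmetric]) measurable
    then show ?thesis by (simp add: v_def algebra_simps)
  qed
  have "(LBINT z. P (y - z) * (cx (\<eta> z) * Q (x - z)))
      - cx (\<eta> y) * (LBINT w. P w * Q (v + w))
      + (\<Sum>b\<in>Basis. cx (dd \<eta> b y) * (LBINT w. cx (w \<bullet> b) * P w * Q (v + w)))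
     = (LBINT w. cx (\<eta> (y - w)) * P w * Q (v + w) - cx (\<eta> y) * (P w * Q (v + w))
         + (\<Sum>b\<in>Basis. cx (dd \<eta> b y) * (cx (w \<bullet> b) * P w * Q (v + w))))"
    unfolding e0 using i0 i1 i2
    by (subst Bochner_Integration.integral_add) (auto intro!: Bochner_Integration.integrable_sum simp: Bochner_Integration.integral_sum)
  also have "\<dots> = (LBINT w. cx (\<eta> (y - w) - \<eta> y + (\<Sum>b\<in>Basis. (w \<bullet> b) * dd \<eta> b y)) * (P w * Q (v + w)))"
    by (intro Bochner_Integration.integral_cong refl) (simp add: ring_distribs sum_distrib_left sum_distrib_right mult_ac)
  finally have eq: "(LBINT z. P (y - z) * (cx (\<eta> z) * Q (x - z)))
      - cx (\<eta> y) * (LBINT w. P w * Q (v + w))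
      + (\<Sum>b\<in>Basis. cx (dd \<eta> b y) * (LBINT w. cx (w \<bullet> b) * P w * Q (v + w)))
     = (LBINT w. cx (\<eta> (y - w) - \<eta> y + (\<Sum>b\<in>Basis. (w \<bullet> b) * dd \<eta> b y)) * (P w * Q (v + w)))" .
  have "norm (LBINT w. cx (\<eta> (y - w) - \<eta> y + (\<Sum>b\<in>Basis. (w \<bullet> b) * dd \<eta> b y)) * (P w * Q (v + w)))
    \<le> (LBINT w. (real CARD('n))\<^sup>2 * B * ((norm w)\<^sup>2 * norm (P w) * norm (Q (v + w))))"
  proof (rule order_trans[OF integral_norm_bound], rule integral_mono_AE')
    have "integrable lborel (\<lambda>w. norm (cx ((norm w)\<^sup>2) * P w * Q (v + w)))"
      by (intro integrable_norm bnd[of _ 1 2]) (auto simp: norm_power)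
    then show "integrable lborel (\<lambda>w. (real CARD('n))\<^sup>2 * B * ((norm w)\<^sup>2 * norm (P w) * norm (Q (v + w))))"
      by (intro integrable_mult_right) (simp add: norm_mult norm_power)
    obtain b0 :: "real^'n" where "b0 \<in> Basis" using nonempty_Basis by blast
    then have B0: "B \<ge> 0" using B[of b0 b0 0] by linarith
    have "norm (cx (\<eta> (y - w) - \<eta> y + (\<Sum>b\<in>Basis. (w \<bullet> b) * dd \<eta> b y)) * (P w * Q (v + w)))
      \<le> ((real CARD('n))\<^sup>2 * B * (norm w)\<^sup>2) * (norm (P w) * norm (Q (v + w)))" for w
      unfolding norm_mult norm_of_real using taylor_second[OF tf_smooth[OF \<eta>] B, of y w]
      by (intro mult_right_mono) auto
    then show "AE w in lborel. norm (cx (\<eta> (y - w) - \<eta> y + (\<Sum>b\<in>Basis. (w \<bullet> b) * dd \<eta> b y)) * (P w * Q (v + w)))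
       \<le> (real CARD('n))\<^sup>2 * B * ((norm w)\<^sup>2 * norm (P w) * norm (Q (v + w)))"
      by (simp add: mult.assoc)
    show "AE w in lborel. 0 \<le> (real CARD('n))\<^sup>2 * B * ((norm w)\<^sup>2 * norm (P w) * norm (Q (v + w)))"
      using B0 by simp
  qed
  then show ?thesis unfolding eq[symmetric] by (simp add: cross_moment_def v_def)
qed

lemma finv_first_moment:
  fixes m :: "real^'n::finite \<Rightarrow> real"
  assumes "tf m"
  shows "cx (w \<bullet> b) * finv m w = \<i> / (2 * pi) * finv (dd m b) w"
  unfolding finv_dd[OF assms] by (simp add: field_simps)

text \<open>A coordinate factor on a kernel differentiates its symbol, so the first-order Taylor
  term is again the transform of a symbol. This is the origin of \<open>twist\<close>.\<close>

lemma finv_moment_correlation: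
  fixes p q :: "real^'n::finite \<Rightarrow> real"
  assumes p: "tf p" and q: "tf q"
  shows "(LBINT w. cx (w \<bullet> b) * finv p w * finv q (v + w)) = \<i> / (2 * pi) * finv (\<lambda>\<xi>. q \<xi> * dd p b (- \<xi>)) v"
proof -
  have "(LBINT w. cx (w \<bullet> b) * finv p w * finv q (v + w))
    = (LBINT w. \<i> / (2 * pi) * (finv (dd p b) w * finv q (v + w)))"
    unfolding finv_first_moment[OF p] by (simp add: mult.assoc)
  also have "\<dots> = \<i> / (2 * pi) * finv (\<lambda>\<xi>. q \<xi> * dd p b (- \<xi>)) v"
    unfolding integral_mult_right_zero finv_correlation[OF test_fun_dd[OF p] q] ..
  finally show ?thesis .
qed

text \<open>When the spectra are disjoint the first two Taylor terms vanish identically, so the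
  interaction is of second order; this replaces any cancellation argument for the commutator.\<close>

lemma disjoint_pairing:
  fixes p q \<eta> :: "real^'n::finite \<Rightarrow> real"
  assumes p: "tf p" and q: "tf q" and disj: "\<And>\<xi>. q \<xi> \<noteq> 0 \<Longrightarrow> - \<xi> \<notin> fsupport p"
    and \<eta>: "tf \<eta>" and B: "\<And>b c x. b \<in> Basis \<Longrightarrow> c \<in> Basis \<Longrightarrow> \<bar>dd (dd \<eta> b) c x\<bar> \<le> B"
  shows "norm (LBINT z. finv p (y - z) * (cx (\<eta> z) * finv q (x - z)))
    \<le> (real CARD('n))\<^sup>2 * B * cross_moment (finv p) (finv q) (x - y)"
proof -
  have "q \<xi> * p (- \<xi>) = 0" "q \<xi> * dd p b (- \<xi>) = 0" for \<xi> b
    using disj[of \<xi>] fsupport_zero[of "- \<xi>" p] dd_zero_outside[of "- \<xi>" p b] by auto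
  then have "(LBINT w. finv p w * finv q (x - y + w)) = 0"
    "(LBINT w. cx (w \<bullet> b) * finv p w * finv q (x - y + w)) = 0" for b
    by (simp_all add: finv_correlation[OF p q] finv_moment_correlation[OF p q] finv_zero)
  then show ?thesis
    using taylor_pairing[OF rapid_finv[OF p] finv_measurable[OF q] finv_bound[OF tf_integrable[OF q]] \<eta> B, of y x]
    by simp
qed

section \<open>Scaling, admissible profiles and the expansion of a packet\<close>

lemma frac_lap_scale:
  fixes g :: "real^'n::finite \<Rightarrow> real"
  assumes g: "tf g" and t: "t > 0"
  shows "frac_lap s (\<lambda>z. g (t *\<^sub>R z)) y = cx (t powr (2 * s)) * frac_lap s g (t *\<^sub>R y)"
proof -
  note [measurable] = finv_measurable[OF g]
  have tg: "tf (\<lambda>z. g (t *\<^sub>R z))" using tf_scale[OF g] t by simp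
  define F where "F \<xi> = cx (frac_sym (2 * s) \<xi>) * finv (\<lambda>z. g (t *\<^sub>R z)) (- \<xi>) * cis (2 * pi * (y \<bullet> \<xi>))" for \<xi>
  note [measurable] = finv_measurable[OF tg]
  have "F \<in> borel_measurable borel" unfolding F_def by measurable
  then have "(LBINT \<xi>. F \<xi>) = (t ^ CARD('n)) *\<^sub>R (LBINT \<xi>. F (t *\<^sub>R \<xi>))"
    using lborel_integral_affine[of F t 0] t by simp
  also have "\<dots> = (LBINT \<xi>. (t ^ CARD('n)) *\<^sub>R F (t *\<^sub>R \<xi>))" by simp
  also have "\<dots> = (LBINT \<xi>. cx (t powr (2 * s)) * (cx (frac_sym (2 * s) \<xi>) * finv g (- \<xi>) * cis (2 * pi * (t *\<^sub>R y \<bullet> \<xi>))))"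
  proof (intro Bochner_Integration.integral_cong refl)
    fix \<xi>
    have "finv (\<lambda>z. g (t *\<^sub>R z)) = dil (1 / t) (finv g)"
      using finv_dil[OF tf_integrable[OF g], of "1 / t"] t by simp
    then have "(t ^ CARD('n)) *\<^sub>R finv (\<lambda>z. g (t *\<^sub>R z)) (- (t *\<^sub>R \<xi>)) = finv g (- \<xi>)"
      using t by (simp add: dil_def power_one_over)
    then have "cx (t ^ CARD('n)) * finv (\<lambda>z. g (t *\<^sub>R z)) (- (t *\<^sub>R \<xi>)) = finv g (- \<xi>)"
      by (simp only: scaleR_conv_of_real)
    moreover have "(t ^ CARD('n)) *\<^sub>R F (t *\<^sub>R \<xi>) = cx (frac_sym (2 * s) (t *\<^sub>R \<xi>)) * (cx (t ^ CARD('n)) * finv (\<lambda>z. g (t *\<^sub>R z)) (- (t *\<^sub>R \<xi>))) * cis (2 * pi * (y \<bullet> (t *\<^sub>R \<xi>)))"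
      unfolding F_def scaleR_conv_of_real[where 'a = complex] by (simp only: mult_ac)
    ultimately show "(t ^ CARD('n)) *\<^sub>R F (t *\<^sub>R \<xi>) = cx (t powr (2 * s)) * (cx (frac_sym (2 * s) \<xi>) * finv g (- \<xi>) * cis (2 * pi * (t *\<^sub>R y \<bullet> \<xi>)))"
      using t by (simp add: frac_sym_scale)
  qed
  also have "\<dots> = cx (t powr (2 * s)) * frac_lap s g (t *\<^sub>R y)"
    unfolding integral_mult_right_zero frac_lap_eq[OF g] ..
  finally show ?thesis unfolding frac_lap_eq[OF tg] F_def .
qed

lemma AE_lborel_affine:
  fixes P :: "real^'n::finite \<Rightarrow> bool"
  assumes "AE v in lborel. P v" and c: "c \<noteq> 0"
  shows "AE y in lborel. P (a + c *\<^sub>R y)"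
proof -
  obtain N where N: "{v. \<not> P v} \<subseteq> N" "emeasure lborel N = 0" "N \<in> sets borel"
    using AE_E[OF assms(1)] by auto
  note [measurable] = N(3)
  have "ennreal (\<bar>c\<bar> ^ CARD('n)) * (\<integral>\<^sup>+y. indicator N (a + c *\<^sub>R y) \<partial>lborel) = (\<integral>\<^sup>+v. indicator N v \<partial>lborel)"
    by (rule lborel_nn_integral_affine[symmetric]) (use c in auto)
  also have "\<dots> = 0" using N by simp
  finally have "ennreal (\<bar>c\<bar> ^ CARD('n)) * (\<integral>\<^sup>+y. indicator N (a + c *\<^sub>R y) \<partial>lborel) = 0" .
  moreover have "ennreal (\<bar>c\<bar> ^ CARD('n)) \<noteq> 0"
    using zero_less_power[of "\<bar>c\<bar>" "CARD('n)"] c by (simp add: ennreal_eq_0_iff not_le)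
  ultimately have "(\<integral>\<^sup>+y. indicator N (a + c *\<^sub>R y) \<partial>lborel) = 0" by simp
  then have "AE y in lborel. indicator N (a + c *\<^sub>R y) = (0::ennreal)"
    by (subst (asm) nn_integral_0_iff_AE) auto
  then show ?thesis
    by eventually_elim (use N(1) in \<open>auto simp: indicator_def split: if_splits\<close>)
qed

text \<open>The class of block symbols on which the argument can be iterated, being stable under
  \<open>riesz\<close> and \<open>twist\<close>. The radii are those of
  \<open>annulus \<phi>0\<close>, and they leave a gap to all pieces of frequency at least 4 or at
  most 1/4.\<close>

definition profile :: "(real^'n::finite \<Rightarrow> real) \<Rightarrow> bool" where
  "profile e \<longleftrightarrow> tf e \<and> has_parity e \<and> (\<forall>\<xi>. e \<xi> \<noteq> 0 \<longrightarrow> 11/20 \<le> norm \<xi> \<and> norm \<xi> \<le> 19/10)"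

text \<open>The symbol of the packet: applying the fractional Laplacian to it restores
  \<open>e\<close>.\<close>

definition riesz :: "real \<Rightarrow> (real^'n::finite \<Rightarrow> real) \<Rightarrow> real^'n \<Rightarrow> real" where
  "riesz s e \<xi> = e \<xi> * frac_sym (- 2 * s) \<xi>"

text \<open>Symbol of the first-order commutator term in direction \<open>b\<close>, up to the
  factor \<i>/(2 pi) and a derivative of the cutoff.\<close>

definition twist :: "(real^'n::finite \<Rightarrow> real) \<Rightarrow> real \<Rightarrow> (real^'n \<Rightarrow> real) \<Rightarrow> real^'n \<Rightarrow> real^'n \<Rightarrow> real" where
  "twist \<phi>0 s e b \<xi> = riesz s e \<xi> * dd (mid_part \<phi>0 s) b (- \<xi>)"

lemma profile_riesz:
  fixes e :: "real^'n::finite \<Rightarrow> real"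
  assumes "profile e"
  shows "profile (riesz s e)"
proof -
  have "tf (riesz s e)"
    unfolding riesz_def[abs_def] by (rule test_fun_frac_sym[of _ _ "11/20"]) (use assms in \<open>force simp: profile_def\<close>)+
  moreover have "has_parity (riesz s e)"
    unfolding riesz_def[abs_def] using assms by (intro has_parity_mult) (auto simp: profile_def has_parity_def frac_sym_minus)
  ultimately show ?thesis using assms by (auto simp: profile_def riesz_def)
qed

lemma profile_fsupport:
  assumes "profile e" "\<xi> \<in> fsupport e"
  shows "11/20 \<le> norm \<xi>" "norm \<xi> \<le> 19/10"
proof -
  have "fsupport e \<subseteq> {\<xi>. 11/20 \<le> norm \<xi>} \<inter> {\<xi>. norm \<xi> \<le> 19/10}"
    by (rule fsupport_minimal)
       (use assms in \<open>auto simp: profile_def intro!: closed_Int closed_Collect_le continuous_intros\<close>)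
  then show "11/20 \<le> norm \<xi>" "norm \<xi> \<le> 19/10" using assms(2) by auto
qed

context
  fixes \<phi>0 :: "real^'n::finite \<Rightarrow> real" and s :: real
  assumes \<phi>0: "admissible_phi0 \<phi>0" and s: "0 < s" "s < 1"
begin

lemma profile_annulus: "profile (annulus \<phi>0)"
proof -
  have "annulus \<phi>0 (- \<xi>) = annulus \<phi>0 \<xi>" for \<xi>
    using admissible_radial[OF \<phi>0, of "- \<xi>" "\<xi>"] admissible_radial[OF \<phi>0, of "2 *\<^sub>R (- \<xi>)" "2 *\<^sub>R \<xi>"]
    by (simp add: annulus_def)
  then have "has_parity (annulus \<phi>0)" by (simp add: has_parity_def)
  moreover have "11/20 \<le> norm \<xi> \<and> norm \<xi> \<le> 19/10" if "annulus \<phi>0 \<xi> \<noteq> 0" for \<xi>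
    using that annulus_zero[OF \<phi>0 s, of \<xi>] by force
  ultimately show ?thesis
    using annulus_tf[OF \<phi>0 s] unfolding profile_def by blast
qed

text \<open>The derivative of the even symbol \<open>mid_part\<close> is odd, so the product keeps a
  definite parity. Without this the commutator terms could not be treated by the same identity
  again.\<close>

lemma profile_twist:
  assumes e: "profile e"
  shows "profile (twist \<phi>0 s e b)"
proof -
  have l: "profile (riesz s e)" by (rule profile_riesz[OF e])
  have d: "tf (dd (mid_part \<phi>0 s) b)" by (rule test_fun_dd[OF mid_part_tf[OF \<phi>0 s]])
  have "smooth_fun (\<lambda>\<xi>. dd (mid_part \<phi>0 s) b (- \<xi>))"
    using smooth_fun_scale[OF tf_smooth[OF d], of "-1"] by simp
  then have "tf (twist \<phi>0 s e b)"
    unfolding twist_def[abs_def] using l by (intro test_fun_mult) (auto simp: profile_def)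
  moreover have "has_parity (\<lambda>\<xi>. dd (mid_part \<phi>0 s) b (- \<xi>))"
    unfolding has_parity_def using dd_odd[OF tf_smooth[OF mid_part_tf[OF \<phi>0 s]] mid_part_minus[OF \<phi>0 s]] by simp
  then have "has_parity (twist \<phi>0 s e b)"
    unfolding twist_def[abs_def] using l by (intro has_parity_mult) (auto simp: profile_def)
  ultimately show ?thesis using l by (auto simp: profile_def twist_def)
qed

text \<open>On the annulus of a profile \<open>mid\<close> is 1 and the two powers of the norm
  cancel. The reflected argument is the one that \<open>finv_correlation\<close> produces.\<close>

lemma riesz_mid: "profile e \<Longrightarrow> riesz s e \<xi> * mid_part \<phi>0 s (- \<xi>) = e \<xi>"
proof (cases "e \<xi> = 0")
  case False
  assume "profile e"
  then have n: "11/20 \<le> norm \<xi>" "norm \<xi> \<le> 19/10" using False by (auto simp: profile_def)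
  then have "mid \<phi>0 \<xi> = 1" by (intro mid_one[OF \<phi>0 s]) auto
  moreover have "frac_sym (- 2 * s) \<xi> * frac_sym (2 * s) \<xi> = 1"
  proof -
    have "norm \<xi> > 0" using n by linarith
    then show ?thesis by (simp add: frac_sym_def powr_add[symmetric])
  qed
  ultimately show ?thesis
    unfolding mid_part_minus[OF \<phi>0 s] by (simp add: riesz_def mid_part_def)
qed (simp add: riesz_def)

lemma annulus_part_fsupport:
  assumes "c > 0" "\<xi> \<in> fsupport (annulus_part \<phi>0 s c)"
  shows "11/20 * c \<le> norm \<xi>" "norm \<xi> \<le> 19/10 * c"
proof -
  have "fsupport (annulus_part \<phi>0 s c) \<subseteq> {\<xi>. 11/20 * c \<le> norm \<xi>} \<inter> {\<xi>. norm \<xi> \<le> 19/10 * c}"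
  proof (rule fsupport_minimal)
    show "closed ({\<xi>::real^'n. 11/20 * c \<le> norm \<xi>} \<inter> {\<xi>. norm \<xi> \<le> 19/10 * c})"
      by (intro closed_Int closed_Collect_le continuous_intros)
    show "\<xi> \<in> {\<xi>. 11/20 * c \<le> norm \<xi>} \<inter> {\<xi>. norm \<xi> \<le> 19/10 * c}" if "annulus_part \<phi>0 s c \<xi> \<noteq> 0" for \<xi>
      using that annulus_part_zero[OF \<phi>0 s assms(1), of \<xi>] by force
  qed
  then show "11/20 * c \<le> norm \<xi>" "norm \<xi> \<le> 19/10 * c" using assms(2) by auto
qed

text \<open>The middle piece of the symbol gives the two explicit terms by Taylor expansion; all
  other pieces have spectra disjoint from the packet and contribute only second-order remainders.
  The quantifiers stand inside \<open>AE v\<close> and \<open>N\<close> depends on \<open>e\<close>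
  alone, so that the null set and the majorant survive a rescaling of the cutoff.\<close>

lemma packet_expansion:
  fixes e :: "real^'n \<Rightarrow> real"
  assumes e: "profile e"
  obtains N :: "real^'n \<Rightarrow> real" where "integrable lborel N"
    "AE v in lborel. \<forall>c a \<eta> B x. (\<forall>x. finv (riesz s e) x = c * cx (a x)) \<longrightarrow> smooth_fun a \<longrightarrow> tf \<eta> \<longrightarrow>
       (\<forall>b\<in>Basis. \<forall>b'\<in>Basis. \<forall>x. \<bar>dd (dd \<eta> b) b' x\<bar> \<le> B) \<longrightarrow>
       norm (c * frac_lap s (\<lambda>z. \<eta> z * a (x - z)) (x - v) - cx (\<eta> (x - v)) * finv e v
         + (\<Sum>b\<in>Basis. cx (dd \<eta> b (x - v)) * (\<i> / (2 * pi) * finv (twist \<phi>0 s e b) v)))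
       \<le> B * N v"
proof -
  define \<alpha> where "\<alpha> = riesz s e"
  have pa: "profile \<alpha>" unfolding \<alpha>_def by (rule profile_riesz[OF e])
  then have ta: "tf \<alpha>" by (simp add: profile_def)
  define A where "A = finv \<alpha>"
  define M where "M = finv (mid_part \<phi>0 s)"
  define P where "P c = finv (annulus_part \<phi>0 s c)" for c
  have tm: "tf (mid_part \<phi>0 s)" by (rule mid_part_tf[OF \<phi>0 s])
  have tr: "tf (annulus_part \<phi>0 s c)" if "c > 0" for c by (rule annulus_part_tf[OF \<phi>0 s that])
  have rA: "rapid A" and rM: "rapid M" and rP: "\<And>c. c > 0 \<Longrightarrow> rapid (P c)"
    unfolding A_def M_def P_def by (auto intro: rapid_finv ta tm tr)
  define hi lo where "hi i = (2::real) ^ (i + 2)" and "lo i = (1::real) / 2 ^ (i + 2)" for i :: nat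
  have hl: "hi i > 0" "lo i > 0" "hi i \<ge> 4" "lo i \<le> 1/4" for i
  proof -
    have "(2::real) ^ 2 \<le> 2 ^ (i + 2)" by (rule power_increasing) auto
    then show "hi i \<ge> 4" "lo i \<le> 1/4" by (auto simp: hi_def lo_def divide_simps)
  qed (auto simp: hi_def lo_def)
  \<comment> \<open>The second moment sits on the kernel of high frequency in one summand and on the
    packet in the other, where the roles of \<open>x\<close> and \<open>y\<close> are exchanged;
    hence the argument \<open>0 - v\<close>.\<close>
  define S where "S i v = cross_moment (P (hi i)) A v + cross_moment A (P (lo i)) (0 - v)" for i v
  have S0: "S i v \<ge> 0" for i v by (simp add: S_def cross_moment_nonneg)
  have cm: "cross_moment P' Q' \<in> borel_measurable borel" if "rapid P'" "rapid Q'" for P' Q' :: "real^'n \<Rightarrow> complex"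
    using cross_moment_integrable(1)[OF that] by (auto dest: borel_measurable_integrable)
  have iS2: "integrable lborel (\<lambda>v. cross_moment A (P (lo i)) (0 - v))" for i
    by (subst lborel_integrable_translate(3)[OF cm[OF rA rP[OF hl(2)]]]) (rule cross_moment_integrable(1)[OF rA rP[OF hl(2)]])
  have iS: "integrable lborel (S i)" for i
    unfolding S_def[abs_def] by (intro Bochner_Integration.integrable_add iS2 cross_moment_integrable(1) rP rA hl)
  define J2 where "J2 = (LBINT w. (norm w)\<^sup>2 * norm (P 1 w))"
  define J0 where "J0 = (LBINT w. norm (P 1 w))"
  define A2 where "A2 = (LBINT w. (norm w)\<^sup>2 * norm (A w))"
  define A0 where "A0 = (LBINT w. norm (A w))"
  have nP: "norm (P c w) = c powr (2 * s) * norm (dil c (P 1) w)" if "c > 0" for c w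
    unfolding P_def finv_annulus_part[OF \<phi>0 s that] by (simp add: norm_mult)
  have P0: "(LBINT w. norm (P c w)) = c powr (2 * s) * J0" if "c > 0" for c
    unfolding nP[OF that] integral_mult_right_zero J0_def
    using dil_integrable(2)[OF rapid_integrable(1)[OF rP[of 1]] that] by simp
  \<comment> \<open>A kernel of frequency \<open>c\<close> has width \<open>1 / c\<close>, so its
    second moment is smaller than its mass by \<open>c\<close> squared.\<close>
  have P2: "(LBINT w. (norm w)\<^sup>2 * norm (P c w)) = c powr (2 * s - 2) * J2" if c: "c > 0" for c
  proof -
    have [measurable]: "P 1 \<in> borel_measurable borel" using rP[of 1] by (simp add: rapid_def)
    have "(norm w)\<^sup>2 * norm (P c w) = c powr (2 * s - 2) * (c ^ CARD('n) * ((norm (c *\<^sub>R w))\<^sup>2 * norm (P 1 (c *\<^sub>R w))))" for w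
      using c unfolding nP[OF c] by (simp add: dil_def powr_diff power_mult_distrib)
    then have "(LBINT w. (norm w)\<^sup>2 * norm (P c w)) = c powr (2 * s - 2) * (c ^ CARD('n) * (LBINT w. (norm (c *\<^sub>R w))\<^sup>2 * norm (P 1 (c *\<^sub>R w))))"
      by (simp only: integral_mult_right_zero)
    then show ?thesis
      using lborel_integral_affine[of "\<lambda>w. (norm w)\<^sup>2 * norm (P 1 w)" c 0] c by (simp add: J2_def)
  qed
  have SI: "(LBINT v. S i v) = hi i powr (2 * s - 2) * J2 * A0 + A2 * (lo i powr (2 * s) * J0)" for i
  proof -
    have "(LBINT v. S i v) = (LBINT v. cross_moment (P (hi i)) A v) + (LBINT v. cross_moment A (P (lo i)) (0 - v))"
      unfolding S_def by (rule Bochner_Integration.integral_add[OF cross_moment_integrable(1)[OF rP[OF hl(1)] rA] iS2])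
    also have "(LBINT v. cross_moment A (P (lo i)) (0 - v)) = (LBINT v. cross_moment A (P (lo i)) v)"
      by (rule lborel_integral_translate(3)[OF cm[OF rA rP[OF hl(2)]]])
    finally show ?thesis
      by (simp add: cross_moment_integrable(2)[OF rP[OF hl(1)] rA] cross_moment_integrable(2)[OF rA rP[OF hl(2)]] P0[OF hl(2)] P2[OF hl(1)]
          A0_def[symmetric] A2_def[symmetric])
  qed
  have sumSI: "summable (\<lambda>i. LBINT v. norm (S i v))"
  proof -
    have h: "hi i powr (2 * s - 2) = (2 powr (2 * s - 2)) ^ (i + 2)" for i
      by (simp add: hi_def powr_realpow[symmetric] powr_powr mult.commute del: power_add power_Suc of_nat_add)
    have l: "lo i powr (2 * s) = (2 powr (- 2 * s)) ^ (i + 2)" for i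
    proof -
      have loi: "lo i = 2 powr (- real (i + 2))" unfolding lo_def by (simp only: powr_minus_divide powr_realpow zero_less_numeral)
      have neg: "- k * (2 * s) = k * (- 2 * s)" for k :: real by simp
      have "(2 powr (- 2 * s)) ^ (i + 2) = 2 powr (real (i + 2) * (- 2 * s))" by (rule powr_power) simp
      then show ?thesis unfolding loi powr_powr neg ..
    qed
    \<comment> \<open>High frequencies sum because s < 1, low ones because s > 0.\<close>
    have r: "(2::real) powr (2 * s - 2) < 1" "(2::real) powr (- 2 * s) < 1" using s by (simp_all add: powr_less_one)
    have "summable (\<lambda>i. (2 powr (2 * s - 2)) ^ (i + 2) * J2 * A0 + A2 * ((2 powr (- 2 * s)) ^ (i + 2) * J0))"
      using r by (intro summable_add summable_mult summable_mult2 summable_ignore_initial_segment summable_geometric) auto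
    then have "summable (\<lambda>i. LBINT v. S i v)" unfolding SI h l .
    then show ?thesis using S0 by simp
  qed
  have Sm[measurable]: "S i \<in> borel_measurable borel" for i using iS[of i] by (auto dest: borel_measurable_integrable)
  \<comment> \<open>A series of nonnegative functions with summable integrals has a finite sum
    almost everywhere; the exceptional set is the one in the conclusion.\<close>
  have aeS: "AE v in lborel. summable (\<lambda>i. S i v)"
  proof -
    have "(\<integral>\<^sup>+v. (\<Sum>i. ennreal (S i v)) \<partial>lborel) = (\<Sum>i. \<integral>\<^sup>+v. ennreal (S i v) \<partial>lborel)"
      by (rule nn_integral_suminf) measurable
    also have "\<dots> = (\<Sum>i. ennreal (LBINT v. S i v))"
      by (intro suminf_cong nn_integral_eq_integral iS) (simp add: S0)
    also have "\<dots> < \<infinity>"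
      using sumSI S0 by (subst suminf_ennreal2) auto
    finally have "AE v in lborel. (\<Sum>i. ennreal (S i v)) \<noteq> \<infinity>"
      by (intro nn_integral_noteq_infinite) auto
    then show ?thesis
      by eventually_elim (use S0 in \<open>auto intro: summable_suminf_not_top\<close>)
  qed
  define N where "N v = (real CARD('n))\<^sup>2 * (cross_moment M A v + (\<Sum>i. S i v))" for v
  have iN: "integrable lborel N"
    unfolding N_def[abs_def]
    by (intro integrable_mult_right Bochner_Integration.integrable_add cross_moment_integrable(1)[OF rM rA] integrable_suminf iS sumSI)
       (use aeS S0 in simp)
  show thesis
  proof (rule that[OF iN])
    show "AE v in lborel. \<forall>c a \<eta> B x. (\<forall>x. finv (riesz s e) x = c * cx (a x)) \<longrightarrow> smooth_fun a \<longrightarrow> tf \<eta> \<longrightarrow>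
       (\<forall>b\<in>Basis. \<forall>b'\<in>Basis. \<forall>x. \<bar>dd (dd \<eta> b) b' x\<bar> \<le> B) \<longrightarrow>
       norm (c * frac_lap s (\<lambda>z. \<eta> z * a (x - z)) (x - v) - cx (\<eta> (x - v)) * finv e v
         + (\<Sum>b\<in>Basis. cx (dd \<eta> b (x - v)) * (\<i> / (2 * pi) * finv (twist \<phi>0 s e b) v)))
       \<le> B * N v"
      using aeS
    proof eventually_elim
      case (elim v)
      show ?case
      proof (intro allI impI)
        fix c :: complex and a \<eta> :: "real^'n \<Rightarrow> real" and B :: real and x :: "real^'n"
        assume a: "\<forall>x. finv (riesz s e) x = c * cx (a x)" "smooth_fun a" and \<eta>: "tf \<eta>"
          and B: "\<forall>b\<in>Basis. \<forall>b'\<in>Basis. \<forall>x. \<bar>dd (dd \<eta> b) b' x\<bar> \<le> B"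
        define y where "y = x - v"
        have v: "x - y = v" "y - x = 0 - v" by (simp_all add: y_def)
        define h where "h z = \<eta> z * a (x - z)" for z
        have th: "tf h" unfolding h_def[abs_def] by (intro test_fun_mult[OF \<eta>] smooth_fun_reflect a)
        obtain b0 :: "real^'n" where "b0 \<in> Basis" using nonempty_Basis by blast
        then have B0: "B \<ge> 0" using B by (meson abs_ge_zero order_trans)
        define nn where "nn = (real CARD('n))\<^sup>2"
        have nn: "nn \<ge> 0" by (simp add: nn_def)
        have cv: "c * conv Q (\<lambda>z. cx (h z)) y = (LBINT z. Q (y - z) * (cx (\<eta> z) * A (x - z)))" for Q
          unfolding conv_def integral_mult_right_zero[symmetric]
          by (intro Bochner_Integration.integral_cong refl) (use a(1) in \<open>simp add: h_def A_def \<alpha>_def mult_ac\<close>)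
        define L where "L = cx (\<eta> y) * finv e v
            - (\<Sum>b\<in>Basis. cx (dd \<eta> b y) * (\<i> / (2 * pi) * finv (twist \<phi>0 s e b) v))"
        have main: "norm (c * conv M (\<lambda>z. cx (h z)) y - L) \<le> nn * B * cross_moment M A v"
        proof -
          have "(LBINT w. M w * A (v + w)) = finv e v"
            unfolding M_def A_def finv_correlation[OF tm ta] by (simp add: \<alpha>_def riesz_mid[OF e])
          moreover have "(LBINT w. cx (w \<bullet> b) * M w * A (v + w)) = \<i> / (2 * pi) * finv (twist \<phi>0 s e b) v" for b
            unfolding M_def A_def finv_moment_correlation[OF tm ta] by (simp add: \<alpha>_def twist_def[abs_def])
          ultimately show ?thesis
            using taylor_pairing[OF rM _ _ \<eta>, of A "LBINT \<xi>. \<bar>\<alpha> \<xi>\<bar>" B y x] B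
              finv_measurable[OF ta] finv_bound[OF tf_integrable[OF ta]]
            unfolding cv v L_def nn_def by (simp add: A_def diff_diff_eq2 diff_add_eq)
        qed
        \<comment> \<open>The inner radius \<open>11/20 * 4\<close> exceeds 19/10, so the spectra
          are disjoint; the fine kernel is centred at \<open>y\<close> and the cutoff is expanded
          there.\<close>
        have hi: "norm (c * conv (P (hi i)) (\<lambda>z. cx (h z)) y) \<le> nn * B * cross_moment (P (hi i)) A v" for i
        proof -
          have "- \<xi> \<notin> fsupport (annulus_part \<phi>0 s (hi i))" if "\<alpha> \<xi> \<noteq> 0" for \<xi>
          proof
            assume "- \<xi> \<in> fsupport (annulus_part \<phi>0 s (hi i))"
            then have "11/20 * hi i \<le> norm \<xi>" using annulus_part_fsupport(1)[OF hl(1), of "- \<xi>" i] by simp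
            moreover have "norm \<xi> \<le> 19/10" using pa that by (auto simp: profile_def)
            ultimately show False using hl(3)[of i] by linarith
          qed
          then show ?thesis
            unfolding cv P_def A_def nn_def
            using disjoint_pairing[OF tr[OF hl(1)] ta _ \<eta>, of i B y x] B by (simp add: v)
        qed
        \<comment> \<open>The outer radius \<open>19/10 * (1/4)\<close> is below 11/20. Now the
          piece is the broad kernel and the packet the narrow one, so the cutoff is expanded at
          \<open>x\<close>.\<close>
        have lo: "norm (c * conv (P (lo i)) (\<lambda>z. cx (h z)) y) \<le> nn * B * cross_moment A (P (lo i)) (0 - v)" for i
        proof -
          have "- \<xi> \<notin> fsupport \<alpha>" if "annulus_part \<phi>0 s (lo i) \<xi> \<noteq> 0" for \<xi>
          proof
            assume "- \<xi> \<in> fsupport \<alpha>"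
            then have "11/20 \<le> norm \<xi>" using profile_fsupport(1)[OF pa, of "- \<xi>"] by simp
            moreover have "norm \<xi> < 19/10 * lo i"
              using annulus_part_zero[OF \<phi>0 s hl(2)[of i], of \<xi>] that by force
            ultimately show False using hl(4)[of i] by linarith
          qed
          then have "norm (LBINT z. finv \<alpha> (x - z) * (cx (\<eta> z) * finv (annulus_part \<phi>0 s (lo i)) (y - z)))
             \<le> nn * B * cross_moment A (P (lo i)) (y - x)"
            unfolding P_def A_def nn_def
            using disjoint_pairing[OF ta tr[OF hl(2)] _ \<eta>, of i B x y] B by simp
          then show ?thesis
            unfolding cv v(2) P_def A_def by (simp add: mult_ac)
        qed
        \<comment> \<open>Partial sums of the decomposition. Their distance to the explicit terms is
          bounded uniformly in \<open>k\<close>, so the bound passes to the limit.\<close>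
        define T where "T k = c * (conv M (\<lambda>z. cx (h z)) y
           + (\<Sum>i<k. conv (P (hi i)) (\<lambda>z. cx (h z)) y + conv (P (lo i)) (\<lambda>z. cx (h z)) y))" for k
        have "T \<longlonglongrightarrow> c * frac_lap s h y"
          unfolding T_def M_def P_def hi_def lo_def by (intro tendsto_mult tendsto_const frac_lap_limit[OF \<phi>0 s th])
        then have lim: "(\<lambda>k. norm (T k - L)) \<longlonglongrightarrow> norm (c * frac_lap s h y - L)"
          by (intro tendsto_intros)
        have "norm (T k - L) \<le> B * N v" for k
        proof -
          have "T k - L = (c * conv M (\<lambda>z. cx (h z)) y - L)
             + (\<Sum>i<k. c * conv (P (hi i)) (\<lambda>z. cx (h z)) y + c * conv (P (lo i)) (\<lambda>z. cx (h z)) y)"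
            by (simp add: T_def ring_distribs sum_distrib_left)
          then have "norm (T k - L) \<le> norm (c * conv M (\<lambda>z. cx (h z)) y - L)
             + norm (\<Sum>i<k. c * conv (P (hi i)) (\<lambda>z. cx (h z)) y + c * conv (P (lo i)) (\<lambda>z. cx (h z)) y)"
            by (simp only: norm_triangle_ineq)
          also have "\<dots> \<le> nn * B * cross_moment M A v + (\<Sum>i<k. nn * B * S i v)"
          proof (intro add_mono main sum_norm_le)
            fix i
            show "norm (c * conv (P (hi i)) (\<lambda>z. cx (h z)) y + c * conv (P (lo i)) (\<lambda>z. cx (h z)) y) \<le> nn * B * S i v"
              unfolding S_def distrib_left by (rule norm_triangle_mono[OF hi lo])
          qed
          also have "\<dots> = nn * B * (cross_moment M A v + (\<Sum>i<k. S i v))" by (simp add: ring_distribs sum_distrib_left)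
          also have "\<dots> \<le> nn * B * (cross_moment M A v + (\<Sum>i. S i v))"
            using nn B0 by (intro mult_left_mono add_left_mono sum_le_suminf elim) (auto simp: S0)
          finally show ?thesis by (simp add: N_def nn_def mult_ac)
        qed
        then have "norm (c * frac_lap s h y - L) \<le> B * N v"
          by (intro LIMSEQ_le_const2[OF lim]) auto
        then show "norm (c * frac_lap s (\<lambda>z. \<eta> z * a (x - z)) (x - v) - cx (\<eta> (x - v)) * finv e v
         + (\<Sum>b\<in>Basis. cx (dd \<eta> b (x - v)) * (\<i> / (2 * pi) * finv (twist \<phi>0 s e b) v))) \<le> B * N v"
          unfolding L_def h_def[abs_def] y_def by (simp only: diff_diff_eq2 diff_add_eq)
      qed
    qed
  qed
qed

end

section \<open>Interior estimate\<close>

text \<open>Borel form of \<open>dist_solution\<close>. It is used with \<open>f\<close> extended by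
  zero, so the right-hand side is an integral over the whole space.\<close>

definition weak_sol :: "real \<Rightarrow> (real^'n::finite) set \<Rightarrow> (real^'n \<Rightarrow> real) \<Rightarrow> (real^'n \<Rightarrow> real) \<Rightarrow> bool" where
  "weak_sol s \<Omega> u f \<longleftrightarrow> (\<forall>\<phi>. test_fun \<Omega> \<phi> \<longrightarrow>
     (LBINT y. cx (u y) * frac_lap s \<phi> y) = cx (LBINT y. f y * \<phi> y))"

lemma Lp_mult_bounded:
  fixes g u :: "real^'n::finite \<Rightarrow> real"
  assumes g: "g \<in> borel_measurable borel" "\<And>x. \<bar>g x\<bar> \<le> H" and u: "Lp p u" and p: "p > 1"
  shows "Lp p (\<lambda>x. g x * u x)" "nrm p (\<lambda>x. g x * u x) \<le> H * nrm p u"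
proof -
  note [measurable] = g(1) Lp_measurable[OF u]
  have H: "H \<ge> 0" using g(2)[of 0] by linarith
  have c: "Lp p (\<lambda>x. H * u x)" "nrm p (\<lambda>x. H * u x) = H * nrm p u"
    using Lp_cmult[OF u, of H] p H by auto
  have "AE x in lborel. norm (g x * u x) \<le> norm (H * u x)"
    using g(2) H by (auto simp: abs_mult intro!: mult_right_mono)
  then show "Lp p (\<lambda>x. g x * u x)" "nrm p (\<lambda>x. g x * u x) \<le> H * nrm p u"
    using Lp_mono[OF c(1), of "\<lambda>x. g x * u x"] p c(2) by auto
qed

lemma conv_cutoff_bound:
  fixes K :: "real^'n::finite \<Rightarrow> complex" and g u :: "real^'n \<Rightarrow> real"
  assumes K: "integrable lborel K" and t: "t > 0" and g: "g \<in> borel_measurable borel" "\<And>x. \<bar>g x\<bar> \<le> H" and u: "Lp p u" and p: "p > 1"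
  shows "Lp p (conv (dil t K) (\<lambda>y. cx (g y * u y)))"
    and "nrm p (conv (dil t K) (\<lambda>y. cx (g y * u y))) \<le> (LBINT x. norm (K x)) * H * nrm p u"
proof -
  note gu = Lp_mult_bounded[OF g u p]
  show "Lp p (conv (dil t K) (\<lambda>y. cx (g y * u y)))"
    by (rule Young_inequality(2)[OF dil_integrable(1)[OF K t] Lp_of_real[OF gu(1)] p])
  have "nrm p (conv (dil t K) (\<lambda>y. cx (g y * u y))) \<le> (LBINT x. norm (K x)) * nrm p (\<lambda>y. g y * u y)"
    using Young_inequality(3)[OF dil_integrable(1)[OF K t] Lp_of_real[OF gu(1)] p]
    by (simp only: dil_integrable(2)[OF K t] nrm_of_real)
  also have "\<dots> \<le> (LBINT x. norm (K x)) * (H * nrm p u)"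
    by (intro mult_left_mono gu) simp
  finally show "nrm p (conv (dil t K) (\<lambda>y. cx (g y * u y))) \<le> (LBINT x. norm (K x)) * H * nrm p u"
    by (simp add: mult.assoc)
qed

lemma tf_second_bound:
  fixes \<eta> :: "real^'n::finite \<Rightarrow> real"
  assumes \<eta>: "tf \<eta>"
  obtains B where "B \<ge> 0" "\<And>b b' x. b \<in> Basis \<Longrightarrow> b' \<in> Basis \<Longrightarrow> \<bar>dd (dd \<eta> b) b' x\<bar> \<le> B"
proof -
  have "\<exists>B\<ge>0. \<forall>x. \<bar>dd (dd \<eta> b) b' x\<bar> \<le> B" for b b'
    using tf_bounded[OF test_fun_dd[OF test_fun_dd[OF \<eta>]], of b b'] by metis
  then obtain B where B: "\<And>b b'. B b b' \<ge> 0" "\<And>b b' x. \<bar>dd (dd \<eta> b) b' x\<bar> \<le> B b b'" by metis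
  show thesis
  proof (rule that[of "\<Sum>b\<in>Basis. \<Sum>b'\<in>Basis. B b b'"])
    show "0 \<le> (\<Sum>b\<in>Basis. \<Sum>b'\<in>Basis. B b b')" by (intro sum_nonneg B)
    fix b b' x :: "real^'n" assume b: "b \<in> Basis" "b' \<in> Basis"
    have "\<bar>dd (dd \<eta> b) b' x\<bar> \<le> B b b'" by (rule B)
    also have "\<dots> \<le> (\<Sum>b'\<in>Basis. B b b')" by (rule member_le_sum[OF b(2)]) (auto intro: B)
    also have "\<dots> \<le> (\<Sum>b\<in>Basis. \<Sum>b'\<in>Basis. B b b')"
      by (rule member_le_sum[OF b(1), of "\<lambda>b. \<Sum>b'\<in>Basis. B b b'"]) (auto intro: sum_nonneg B)
    finally show "\<bar>dd (dd \<eta> b) b' x\<bar> \<le> (\<Sum>b\<in>Basis. \<Sum>b'\<in>Basis. B b b')" .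
  qed
qed

context
  fixes \<phi>0 :: "real^'n::finite \<Rightarrow> real" and s p :: real and \<Omega> :: "(real^'n) set"
  assumes \<phi>0: "admissible_phi0 \<phi>0" and s: "0 < s" "s < 1" and p: "p > 1"
begin

text \<open>Stretching space by \<open>t\<close> replaces the cutoff by its slowly varying dilate.
  Each derivative of the latter brings a factor \<open>1 / t\<close>, which explains the sizes of
  the commutator terms and of the remainder; \<open>t powr (- 2 * s)\<close> offsets the homogeneity
  of the operator.\<close>

lemma packet_expansion_scaled:
  fixes e \<eta> :: "real^'n \<Rightarrow> real"
  assumes e: "profile e" and \<eta>: "tf \<eta>"
  obtains N :: "real^'n \<Rightarrow> real" where "integrable lborel N"
    "\<And>t c a x. t > 0 \<Longrightarrow> (\<And>x. finv (riesz s e) x = c * cx (a x)) \<Longrightarrow> smooth_fun a \<Longrightarrow>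
      AE y in lborel. norm (cx (t ^ CARD('n) * t powr (- 2 * s)) * c * frac_lap s (\<lambda>z. \<eta> z * a (t *\<^sub>R (x - z))) y
         - (cx (\<eta> y) * dil t (finv e) (x - y)
            - (\<Sum>b\<in>Basis. cx (dd \<eta> b y) * (\<i> / (2 * pi * t) * dil t (finv (twist \<phi>0 s e b)) (x - y)))))
       \<le> 1 / t\<^sup>2 * dil t N (x - y)"
proof (rule packet_expansion[OF \<phi>0 s e])
  fix N :: "real^'n \<Rightarrow> real" assume N: "integrable lborel N" and ae:
    "AE v in lborel. \<forall>c a \<eta> B x. (\<forall>x. finv (riesz s e) x = c * cx (a x)) \<longrightarrow> smooth_fun a \<longrightarrow> tf \<eta> \<longrightarrow>
       (\<forall>b\<in>Basis. \<forall>b'\<in>Basis. \<forall>x. \<bar>dd (dd \<eta> b) b' x\<bar> \<le> B) \<longrightarrow>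
       norm (c * frac_lap s (\<lambda>z. \<eta> z * a (x - z)) (x - v) - cx (\<eta> (x - v)) * finv e v
         + (\<Sum>b\<in>Basis. cx (dd \<eta> b (x - v)) * (\<i> / (2 * pi) * finv (twist \<phi>0 s e b) v)))
       \<le> B * N v"
  obtain B where B: "B \<ge> 0" "\<And>b b' x. b \<in> Basis \<Longrightarrow> b' \<in> Basis \<Longrightarrow> \<bar>dd (dd \<eta> b) b' x\<bar> \<le> B"
    using tf_second_bound[OF \<eta>] by blast
  show thesis
  proof (rule that[of "\<lambda>v. B * N v"])
    show "integrable lborel (\<lambda>v. B * N v)" using N by simp
    fix t :: real and c :: complex and a :: "real^'n \<Rightarrow> real" and x :: "real^'n"
    assume t: "t > 0" and c: "\<And>x. finv (riesz s e) x = c * cx (a x)" and a: "smooth_fun a"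
    define \<eta>' where "\<eta>' z = \<eta> ((1/t) *\<^sub>R z)" for z
    have t\<eta>': "tf \<eta>'" unfolding \<eta>'_def[abs_def] using tf_scale[OF \<eta>, of "1/t"] t by simp
    have d1: "dd \<eta>' b = (\<lambda>z. (1/t) * dd \<eta> b ((1/t) *\<^sub>R z))" for b
      unfolding \<eta>'_def[abs_def] by (rule dd_scale[OF tf_smooth[OF \<eta>]])
    have d2: "dd (dd \<eta>' b) b' z = (1/t) * ((1/t) * dd (dd \<eta> b) b' ((1/t) *\<^sub>R z))" for b b' z
    proof -
      have sm: "smooth_fun (dd \<eta> b)" by (rule smooth_fun_frechet[OF tf_smooth[OF \<eta>]])
      have "dd (\<lambda>z. (1/t) * dd \<eta> b ((1/t) *\<^sub>R z)) b' z = (1/t) * dd (\<lambda>z. dd \<eta> b ((1/t) *\<^sub>R z)) b' z"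
        by (rule fun_cong[OF dd_eqI]) (intro has_derivative_mult_right smooth_fun_has_derivative smooth_fun_scale sm)
      then show ?thesis unfolding d1 by (simp add: dd_scale[OF sm])
    qed
    have B': "\<forall>b\<in>Basis. \<forall>b'\<in>Basis. \<forall>z. \<bar>dd (dd \<eta>' b) b' z\<bar> \<le> B / t\<^sup>2"
    proof (intro ballI allI)
      fix b b' z :: "real^'n" assume b: "b \<in> Basis" "b' \<in> Basis"
      have "\<bar>dd (dd \<eta>' b) b' z\<bar> = 1 / t\<^sup>2 * \<bar>dd (dd \<eta> b) b' ((1/t) *\<^sub>R z)\<bar>"
        unfolding d2 using t by (simp add: abs_mult power2_eq_square)
      also have "\<dots> \<le> 1 / t\<^sup>2 * B" by (intro mult_left_mono B b) simp
      finally show "\<bar>dd (dd \<eta>' b) b' z\<bar> \<le> B / t\<^sup>2" by simp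
    qed
    define g where "g z = \<eta>' z * a (t *\<^sub>R x - z)" for z
    have tg: "tf g" unfolding g_def[abs_def] by (intro test_fun_mult[OF t\<eta>'] smooth_fun_reflect a)
    have hg: "(\<lambda>z. \<eta> z * a (t *\<^sub>R (x - z))) = (\<lambda>z. g (t *\<^sub>R z))"
      using t by (simp add: g_def \<eta>'_def scaleR_diff_right)
    have fl: "cx (t powr (- 2 * s)) * frac_lap s (\<lambda>z. \<eta> z * a (t *\<^sub>R (x - z))) y = frac_lap s g (t *\<^sub>R y)" for y
    proof -
      have "t powr (- 2 * s) * t powr (2 * s) = 1" using t by (simp add: powr_add[symmetric])
      then have "cx (t powr (- 2 * s)) * cx (t powr (2 * s)) = 1"
        unfolding of_real_mult[symmetric] by simp
      then show ?thesis unfolding hg frac_lap_scale[OF tg t] by (simp only: mult.assoc[symmetric]) simp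
    qed
    \<comment> \<open>The null set in \<open>v\<close> is pulled back along
      \<open>v = t *\<^sub>R (x - y)\<close> with \<open>x\<close> fixed, which yields a null set in
      \<open>y\<close>.\<close>
    have "AE y in lborel. \<forall>c a \<eta> B x'. (\<forall>x. finv (riesz s e) x = c * cx (a x)) \<longrightarrow> smooth_fun a \<longrightarrow> tf \<eta> \<longrightarrow>
       (\<forall>b\<in>Basis. \<forall>b'\<in>Basis. \<forall>x. \<bar>dd (dd \<eta> b) b' x\<bar> \<le> B) \<longrightarrow>
       norm (c * frac_lap s (\<lambda>z. \<eta> z * a (x' - z)) (x' - (t *\<^sub>R x + (- t) *\<^sub>R y)) - cx (\<eta> (x' - (t *\<^sub>R x + (- t) *\<^sub>R y))) * finv e (t *\<^sub>R x + (- t) *\<^sub>R y)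
         + (\<Sum>b\<in>Basis. cx (dd \<eta> b (x' - (t *\<^sub>R x + (- t) *\<^sub>R y))) * (\<i> / (2 * pi) * finv (twist \<phi>0 s e b) (t *\<^sub>R x + (- t) *\<^sub>R y))))
       \<le> B * N (t *\<^sub>R x + (- t) *\<^sub>R y)"
      by (rule AE_lborel_affine[OF ae]) (use t in simp)
    then show "AE y in lborel. norm (cx (t ^ CARD('n) * t powr (- 2 * s)) * c * frac_lap s (\<lambda>z. \<eta> z * a (t *\<^sub>R (x - z))) y
         - (cx (\<eta> y) * dil t (finv e) (x - y)
            - (\<Sum>b\<in>Basis. cx (dd \<eta> b y) * (\<i> / (2 * pi * t) * dil t (finv (twist \<phi>0 s e b)) (x - y)))))
       \<le> 1 / t\<^sup>2 * dil t (\<lambda>v. B * N v) (x - y)"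
    proof eventually_elim
      case (elim y)
      define v where "v = t *\<^sub>R (x - y)"
      have v: "t *\<^sub>R x + (- t) *\<^sub>R y = v" "t *\<^sub>R x - v = t *\<^sub>R y" by (simp_all add: v_def scaleR_diff_right)
      have bd: "norm (c * frac_lap s g (t *\<^sub>R y) - cx (\<eta>' (t *\<^sub>R y)) * finv e v
         + (\<Sum>b\<in>Basis. cx (dd \<eta>' b (t *\<^sub>R y)) * (\<i> / (2 * pi) * finv (twist \<phi>0 s e b) v))) \<le> B / t\<^sup>2 * N v"
        using elim[rule_format, of c a \<eta>' "B / t\<^sup>2" "t *\<^sub>R x"] c a t\<eta>' B' unfolding v g_def[abs_def] by blast
      define T where "T = cx (t ^ CARD('n))"
      have "cx (t ^ CARD('n) * t powr (- 2 * s)) * c * frac_lap s (\<lambda>z. \<eta> z * a (t *\<^sub>R (x - z))) y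
         - (cx (\<eta> y) * dil t (finv e) (x - y)
            - (\<Sum>b\<in>Basis. cx (dd \<eta> b y) * (\<i> / (2 * pi * t) * dil t (finv (twist \<phi>0 s e b)) (x - y))))
        = T * (c * frac_lap s g (t *\<^sub>R y) - cx (\<eta>' (t *\<^sub>R y)) * finv e v
         + (\<Sum>b\<in>Basis. cx (dd \<eta>' b (t *\<^sub>R y)) * (\<i> / (2 * pi) * finv (twist \<phi>0 s e b) v)))"
      proof -
        have dv: "dil t (finv q) (x - y) = T * finv q v" for q :: "real^'n \<Rightarrow> real"
          by (simp add: dil_def v_def T_def scaleR_conv_of_real[where 'a = complex])
        have ee: "\<eta>' (t *\<^sub>R y) = \<eta> y" "dd \<eta>' b (t *\<^sub>R y) = dd \<eta> b y / t" for b
          unfolding d1 using t by (simp_all add: \<eta>'_def)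
        have "cx (t ^ CARD('n) * t powr (- 2 * s)) * c * frac_lap s (\<lambda>z. \<eta> z * a (t *\<^sub>R (x - z))) y
          = T * (c * (cx (t powr (- 2 * s)) * frac_lap s (\<lambda>z. \<eta> z * a (t *\<^sub>R (x - z))) y))"
          by (simp add: T_def mult_ac)
        then show ?thesis
          unfolding dv ee fl by (simp add: ring_distribs sum_distrib_left mult_ac diff_diff_eq2)
      qed
      then have "norm (cx (t ^ CARD('n) * t powr (- 2 * s)) * c * frac_lap s (\<lambda>z. \<eta> z * a (t *\<^sub>R (x - z))) y
         - (cx (\<eta> y) * dil t (finv e) (x - y)
            - (\<Sum>b\<in>Basis. cx (dd \<eta> b y) * (\<i> / (2 * pi * t) * dil t (finv (twist \<phi>0 s e b)) (x - y)))))
        = t ^ CARD('n) * norm (c * frac_lap s g (t *\<^sub>R y) - cx (\<eta>' (t *\<^sub>R y)) * finv e v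
         + (\<Sum>b\<in>Basis. cx (dd \<eta>' b (t *\<^sub>R y)) * (\<i> / (2 * pi) * finv (twist \<phi>0 s e b) v)))"
        using t by (simp only: norm_mult T_def norm_of_real) simp
      also have "\<dots> \<le> t ^ CARD('n) * (B / t\<^sup>2 * N v)"
        using t by (intro mult_left_mono bd) auto
      also have "\<dots> = 1 / t\<^sup>2 * dil t (\<lambda>v. B * N v) (x - y)"
        by (simp add: dil_def v_def)
      finally show ?case .
    qed
  qed
qed

text \<open>For almost every \<open>x\<close> the equation is tested with the cutoff times the
  packet centred at \<open>x\<close>. The right-hand side becomes the block of
  \<open>\<eta> * f\<close>, the explicit terms become the other blocks, and what remains is
  pointwise at most \<open>1 / t\<^sup>2\<close> times the convolution of \<open>dil t N\<close>
  with \<open>\<bar>u\<bar>\<close>.\<close>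

lemma localised_identity:
  fixes e \<eta> :: "real^'n \<Rightarrow> real"
  assumes e: "profile e" and \<eta>: "test_fun \<Omega> \<eta>"
  obtains C where "C \<ge> 0"
    "\<And>t u f. t > 0 \<Longrightarrow> Lp p u \<Longrightarrow> Lp p f \<Longrightarrow> weak_sol s \<Omega> u f \<Longrightarrow>
      nrm p (\<lambda>x. conv (dil t (finv e)) (\<lambda>y. cx (\<eta> y * u y)) x
        - cx (t powr (- 2 * s)) * conv (dil t (finv (riesz s e))) (\<lambda>y. cx (\<eta> y * f y)) x
        - (\<Sum>b\<in>Basis. \<i> / (2 * pi * t) * conv (dil t (finv (twist \<phi>0 s e b))) (\<lambda>y. cx (dd \<eta> b y * u y)) x))
      \<le> C / t\<^sup>2 * nrm p u"
proof (rule packet_expansion_scaled[OF e tf_UNIV[OF \<eta>]])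
  have t\<eta>: "tf \<eta>" by (rule tf_UNIV[OF \<eta>])
  fix N :: "real^'n \<Rightarrow> real" assume N: "integrable lborel N" and exp:
    "\<And>t c a x. t > 0 \<Longrightarrow> (\<And>x. finv (riesz s e) x = c * cx (a x)) \<Longrightarrow> smooth_fun a \<Longrightarrow>
      AE y in lborel. norm (cx (t ^ CARD('n) * t powr (- 2 * s)) * c * frac_lap s (\<lambda>z. \<eta> z * a (t *\<^sub>R (x - z))) y
         - (cx (\<eta> y) * dil t (finv e) (x - y)
            - (\<Sum>b\<in>Basis. cx (dd \<eta> b y) * (\<i> / (2 * pi * t) * dil t (finv (twist \<phi>0 s e b)) (x - y)))))
       \<le> 1 / t\<^sup>2 * dil t N (x - y)"
  have pl: "profile (riesz s e)" by (rule profile_riesz[OF e])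
  have tl: "tf (riesz s e)" and te: "tf e" and tw: "\<And>b. tf (twist \<phi>0 s e b)"
    using pl e profile_twist[OF \<phi>0 s e] by (auto simp: profile_def)
  \<comment> \<open>Parity provides the real function \<open>a\<close> of which the test function is
    made; the scalar \<open>c\<close> is restored after testing.\<close>
  obtain c a where ca: "\<And>x. finv (riesz s e) x = c * cx (a x)" "smooth_fun a"
    using finv_has_parity[OF tl] pl unfolding profile_def by metis
  show thesis
  proof (rule that[of "LBINT x. norm (N x)"])
    show "0 \<le> (LBINT x. norm (N x))" by simp
    fix t :: real and u f :: "real^'n \<Rightarrow> real"
    assume t: "t > 0" and u: "Lp p u" and f: "Lp p f" and ws: "weak_sol s \<Omega> u f"
    obtain H where H: "\<And>x. \<bar>\<eta> x\<bar> \<le> H" using tf_bounded[OF t\<eta>] by blast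
    note me = tf_measurable[OF t\<eta>] and mde = tf_measurable[OF test_fun_dd[OF t\<eta>]]
    note [measurable] = Lp_measurable[OF u] Lp_measurable[OF f] me finv_measurable[OF te] finv_measurable[OF tl] mde finv_measurable[OF tw]
    have Nm[measurable]: "N \<in> borel_measurable borel" using N by (auto dest: borel_measurable_integrable)
    have iE: "integrable lborel (dil t (finv q))" if "tf q" for q by (rule dil_integrable(1)[OF finv_in_L1[OF that] t])
    have iN: "integrable lborel (dil t N)" by (rule dil_integrable(1)[OF N t])
    have hu: "Lp p (\<lambda>y. cx (\<eta> y * u y))"
      by (rule Lp_of_real[OF Lp_mult_bounded(1)[OF me H u p]])
    have dhu: "Lp p (\<lambda>y. cx (dd \<eta> b y * u y))" for b
    proof -
      obtain H' where "\<And>x. \<bar>dd \<eta> b x\<bar> \<le> H'" using tf_bounded[OF test_fun_dd[OF t\<eta>], of b] by blast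
      then show ?thesis by (rule Lp_of_real[OF Lp_mult_bounded(1)[OF mde _ u p]])
    qed
    have au: "Lp p (\<lambda>y. \<bar>u y\<bar>)" "nrm p (\<lambda>y. \<bar>u y\<bar>) = nrm p u"
      using Lp_norm_iff[of u p] u nrm_norm[of p u] by auto
    define Rm where "Rm x = conv (dil t (finv e)) (\<lambda>y. cx (\<eta> y * u y)) x
        - cx (t powr (- 2 * s)) * conv (dil t (finv (riesz s e))) (\<lambda>y. cx (\<eta> y * f y)) x
        - (\<Sum>b\<in>Basis. \<i> / (2 * pi * t) * conv (dil t (finv (twist \<phi>0 s e b))) (\<lambda>y. cx (dd \<eta> b y * u y)) x)" for x
    have [measurable]: "Rm \<in> borel_measurable borel" unfolding Rm_def by measurable
    have "AE x in lborel. \<forall>b\<in>Basis. integrable lborel (\<lambda>y. dil t (finv (twist \<phi>0 s e b)) (x - y) * cx (dd \<eta> b y * u y))"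
      by (intro eventually_ball_finite finite_Basis ballI Young_inequality(1)[OF iE[OF tw] dhu p])
    with Young_inequality(1)[OF iE[OF te] hu p] Young_inequality(1)[OF iN au(1) p]
    have "AE x in lborel. norm (Rm x) \<le> 1 / t\<^sup>2 * conv (dil t N) (\<lambda>y. \<bar>u y\<bar>) x"
    proof eventually_elim
      case (elim x)
      define h where "h z = \<eta> z * a (t *\<^sub>R (x - z))" for z
      have th: "test_fun \<Omega> h"
        unfolding h_def[abs_def]
        by (intro test_fun_mult[OF \<eta>]) (use smooth_fun_affine[OF ca(2), of "- t" "t *\<^sub>R x"] in \<open>simp add: scaleR_diff_right\<close>)
      note [measurable] = frac_lap_measurable[OF tf_UNIV[OF th], of s] tf_measurable[OF tf_UNIV[OF th]]
      define k where "k = cx (t ^ CARD('n) * t powr (- 2 * s)) * c"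
      define E where "E y = cx (\<eta> y) * dil t (finv e) (x - y)
            - (\<Sum>b\<in>Basis. cx (dd \<eta> b y) * (\<i> / (2 * pi * t) * dil t (finv (twist \<phi>0 s e b)) (x - y)))" for y
      have [measurable]: "E \<in> borel_measurable borel" unfolding E_def by measurable
      \<comment> \<open>Integrability of \<open>u\<close> times \<open>frac_lap s h\<close> is not
        presupposed. It follows from this splitting: \<open>G\<close> is dominated through
        \<open>N\<close>, and \<open>u\<close> times \<open>E\<close> is a finite sum of integrands
        of convolutions.\<close>
      define G where "G y = cx (u y) * (k * frac_lap s h y - E y)" for y
      have [measurable]: "G \<in> borel_measurable borel" unfolding G_def by measurable
      have "AE y in lborel. norm (k * frac_lap s h y - E y) \<le> 1 / t\<^sup>2 * dil t N (x - y)"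
        unfolding k_def h_def[abs_def] E_def by (rule exp[OF t ca])
      then have Gb: "AE y in lborel. norm (G y) \<le> 1 / t\<^sup>2 * (dil t N (x - y) * \<bar>u y\<bar>)"
      proof eventually_elim
        case (elim y)
        have "norm (G y) = norm (k * frac_lap s h y - E y) * \<bar>u y\<bar>" by (simp add: G_def norm_mult)
        also have "\<dots> \<le> (1 / t\<^sup>2 * dil t N (x - y)) * \<bar>u y\<bar>" by (intro mult_right_mono elim) simp
        finally show ?case by simp
      qed
      have iB: "integrable lborel (\<lambda>y. 1 / t\<^sup>2 * (dil t N (x - y) * \<bar>u y\<bar>))"
        by (intro integrable_mult_right elim)
      have iG: "integrable lborel G"
      proof (rule Bochner_Integration.integrable_bound[OF iB])
        show "AE y in lborel. norm (G y) \<le> norm (1 / t\<^sup>2 * (dil t N (x - y) * \<bar>u y\<bar>))"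
          using Gb by eventually_elim (erule order_trans, simp only: real_norm_def abs_ge_self)
      qed simp
      have uE: "cx (u y) * E y = dil t (finv e) (x - y) * cx (\<eta> y * u y)
          - (\<Sum>b\<in>Basis. \<i> / (2 * pi * t) * (dil t (finv (twist \<phi>0 s e b)) (x - y) * cx (dd \<eta> b y * u y)))" for y
        by (simp add: E_def ring_distribs sum_distrib_left mult_ac)
      have i2: "integrable lborel (\<lambda>y. \<Sum>b\<in>Basis. \<i> / (2 * pi * t) * (dil t (finv (twist \<phi>0 s e b)) (x - y) * cx (dd \<eta> b y * u y)))"
        using elim by (intro Bochner_Integration.integrable_sum integrable_mult_right) blast
      have iE: "integrable lborel (\<lambda>y. cx (u y) * E y)"
        unfolding uE using elim i2 by (intro Bochner_Integration.integrable_diff) auto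
      have IE: "(LBINT y. cx (u y) * E y) = conv (dil t (finv e)) (\<lambda>y. cx (\<eta> y * u y)) x
         - (\<Sum>b\<in>Basis. \<i> / (2 * pi * t) * conv (dil t (finv (twist \<phi>0 s e b))) (\<lambda>y. cx (dd \<eta> b y * u y)) x)"
      proof -
        have "(LBINT y. (\<Sum>b\<in>Basis. \<i> / (2 * pi * t) * (dil t (finv (twist \<phi>0 s e b)) (x - y) * cx (dd \<eta> b y * u y))))
          = (\<Sum>b\<in>Basis. \<i> / (2 * pi * t) * conv (dil t (finv (twist \<phi>0 s e b))) (\<lambda>y. cx (dd \<eta> b y * u y)) x)"
          unfolding conv_def integral_mult_right_zero[symmetric]
          by (rule Bochner_Integration.integral_sum) (rule integrable_mult_right, use elim in blast)
        then show ?thesis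
          unfolding uE using elim(1) i2 by (subst Bochner_Integration.integral_diff) (auto simp: conv_def)
      qed
      have "(LBINT y. cx (u y) * (k * frac_lap s h y)) = (LBINT y. G y + cx (u y) * E y)"
        by (intro Bochner_Integration.integral_cong refl) (simp add: G_def ring_distribs)
      also have "\<dots> = (LBINT y. G y) + (LBINT y. cx (u y) * E y)"
        by (rule Bochner_Integration.integral_add[OF iG iE])
      finally have eq1: "(LBINT y. cx (u y) * (k * frac_lap s h y)) = (LBINT y. G y) + (LBINT y. cx (u y) * E y)" .
      have "(LBINT y. cx (u y) * (k * frac_lap s h y)) = k * (LBINT y. cx (u y) * frac_lap s h y)"
        by (subst integral_mult_right_zero[symmetric]) (simp add: mult_ac)
      also have "\<dots> = k * (LBINT y. cx (f y * h y))"
        using ws th by (simp add: weak_sol_def integral_complex_of_real del: of_real_mult)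
      also have "\<dots> = cx (t powr (- 2 * s)) * conv (dil t (finv (riesz s e))) (\<lambda>y. cx (\<eta> y * f y)) x"
        unfolding conv_def integral_mult_right_zero[symmetric]
        by (intro Bochner_Integration.integral_cong refl)
           (simp add: k_def h_def dil_def ca(1) scaleR_conv_of_real[where 'a = complex] mult_ac)
      finally have "Rm x = - (LBINT y. G y)"
        using eq1 IE unfolding Rm_def by (simp add: algebra_simps)
      then have "norm (Rm x) = norm (LBINT y. G y)" by simp
      also have "\<dots> \<le> (LBINT y. 1 / t\<^sup>2 * (dil t N (x - y) * \<bar>u y\<bar>))"
        by (rule order_trans[OF integral_norm_bound]) (intro integral_mono_AE integrable_norm iG iB Gb)
      also have "\<dots> = 1 / t\<^sup>2 * conv (dil t N) (\<lambda>y. \<bar>u y\<bar>) x"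
        unfolding integral_mult_right_zero conv_def ..
      finally show ?case .
    qed
    then have ae: "AE x in lborel. norm (Rm x) \<le> norm (1 / t\<^sup>2 * conv (dil t N) (\<lambda>y. \<bar>u y\<bar>) x)"
      by eventually_elim (erule order_trans, simp only: real_norm_def abs_ge_self)
    note Y = Young_inequality(2,3)[OF iN au(1) p]
    have "nrm p Rm \<le> nrm p (\<lambda>x. 1 / t\<^sup>2 * conv (dil t N) (\<lambda>y. \<bar>u y\<bar>) x)"
      by (rule Lp_mono(2)[OF Lp_cmult(1)[OF Y(1)] _ ae]) (use p in auto)
    also have "\<dots> = 1 / t\<^sup>2 * nrm p (conv (dil t N) (\<lambda>y. \<bar>u y\<bar>))"
      using Lp_cmult(2)[OF Y(1), of "1 / t\<^sup>2"] p by simp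
    also have "\<dots> \<le> 1 / t\<^sup>2 * ((LBINT x. norm (N x)) * nrm p u)"
      using Y(2) unfolding dil_integrable(2)[OF N t] au(2) by (intro mult_left_mono) simp_all
    finally show "nrm p (\<lambda>x. conv (dil t (finv e)) (\<lambda>y. cx (\<eta> y * u y)) x
        - cx (t powr (- 2 * s)) * conv (dil t (finv (riesz s e))) (\<lambda>y. cx (\<eta> y * f y)) x
        - (\<Sum>b\<in>Basis. \<i> / (2 * pi * t) * conv (dil t (finv (twist \<phi>0 s e b))) (\<lambda>y. cx (dd \<eta> b y * u y)) x))
      \<le> (LBINT x. norm (N x)) / t\<^sup>2 * nrm p u"
      by (simp add: Rm_def[abs_def])
  qed
qed

end

section \<open>Estimates for a single block and their dyadic summation\<close>

context
  fixes \<phi>0 :: "real^'n::finite \<Rightarrow> real" and s p :: real and \<Omega> :: "(real^'n) set"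
  assumes \<phi>0: "admissible_phi0 \<phi>0" and s: "0 < s" "s < 1" and p: "p > 1"
begin

text \<open>The triangle inequality applied to the identity. All terms on the right except the last
  are again block norms with symbols that are profiles, which permits iteration.\<close>

lemma localised_reduction:
  fixes e \<eta> :: "real^'n \<Rightarrow> real"
  assumes e: "profile e" and \<eta>: "test_fun \<Omega> \<eta>"
  obtains C where "C \<ge> 0"
    "\<And>t u f. t > 0 \<Longrightarrow> Lp p u \<Longrightarrow> Lp p f \<Longrightarrow> weak_sol s \<Omega> u f \<Longrightarrow>
      block_norm p t e (\<lambda>y. \<eta> y * u y)
      \<le> t powr (- 2 * s) * block_norm p t (riesz s e) (\<lambda>y. \<eta> y * f y)
        + (\<Sum>b\<in>Basis. 1 / t * block_norm p t (twist \<phi>0 s e b) (\<lambda>y. dd \<eta> b y * u y))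
        + C / t\<^sup>2 * nrm p u"
proof (rule localised_identity[OF \<phi>0 s p e \<eta>])
  fix C :: real
  assume C: "C \<ge> 0" and id:
    "\<And>t u f. t > 0 \<Longrightarrow> Lp p u \<Longrightarrow> Lp p f \<Longrightarrow> weak_sol s \<Omega> u f \<Longrightarrow>
      nrm p (\<lambda>x. conv (dil t (finv e)) (\<lambda>y. cx (\<eta> y * u y)) x
        - cx (t powr (- 2 * s)) * conv (dil t (finv (riesz s e))) (\<lambda>y. cx (\<eta> y * f y)) x
        - (\<Sum>b\<in>Basis. \<i> / (2 * pi * t) * conv (dil t (finv (twist \<phi>0 s e b))) (\<lambda>y. cx (dd \<eta> b y * u y)) x))
      \<le> C / t\<^sup>2 * nrm p u"
  have t\<eta>: "tf \<eta>" by (rule tf_UNIV[OF \<eta>])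
  have te: "tf e" and tl: "tf (riesz s e)" and tw: "\<And>b. tf (twist \<phi>0 s e b)"
    using e profile_riesz[OF e] profile_twist[OF \<phi>0 s e] by (auto simp: profile_def)
  show thesis
  proof (rule that[OF C])
    fix t :: real and u f :: "real^'n \<Rightarrow> real" assume t: "t > 0" and u: "Lp p u" and f: "Lp p f" and ws: "weak_sol s \<Omega> u f"
    have lp: "Lp p (conv (dil t (finv q)) (\<lambda>y. cx (g y * v y)))"
      if q: "tf q" and g: "tf g" and v: "Lp p v" for q g v :: "real^'n \<Rightarrow> real"
    proof -
      obtain H where H: "\<And>x. \<bar>g x\<bar> \<le> H" using tf_bounded[OF g] by blast
      show ?thesis
        by (rule conv_cutoff_bound(1)[OF finv_in_L1[OF q] t tf_measurable[OF g] H v p])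
    qed
    define X where "X = conv (dil t (finv e)) (\<lambda>y. cx (\<eta> y * u y))"
    define Y where "Y x = cx (t powr (- 2 * s)) * conv (dil t (finv (riesz s e))) (\<lambda>y. cx (\<eta> y * f y)) x" for x
    define Z where "Z b x = \<i> / (2 * pi * t) * conv (dil t (finv (twist \<phi>0 s e b))) (\<lambda>y. cx (dd \<eta> b y * u y)) x" for b x
    have X: "Lp p X" unfolding X_def by (rule lp[OF te t\<eta> u])
    have Y: "Lp p Y" "nrm p Y = t powr (- 2 * s) * block_norm p t (riesz s e) (\<lambda>y. \<eta> y * f y)"
      unfolding Y_def[abs_def] using Lp_cmult[OF lp[OF tl t\<eta> f], of "cx (t powr (- 2 * s))"] p by auto
    have Z: "Lp p (Z b)" "nrm p (Z b) \<le> 1 / t * block_norm p t (twist \<phi>0 s e b) (\<lambda>y. dd \<eta> b y * u y)" for b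
    proof -
      note l = Lp_cmult[OF lp[OF tw test_fun_dd[OF t\<eta>] u], of "\<i> / (2 * pi * t)" b b]
      show "Lp p (Z b)" unfolding Z_def[abs_def] using l(1) p by simp
      have "1 * t \<le> 2 * pi * t" using t pi_gt3 by (intro mult_right_mono) auto
      then have "norm (\<i> / (2 * pi * t)) \<le> 1 / t"
        using t by (simp add: norm_divide norm_mult frac_le)
      moreover have "nrm p (Z b) = norm (\<i> / (2 * pi * t)) * block_norm p t (twist \<phi>0 s e b) (\<lambda>y. dd \<eta> b y * u y)"
        unfolding Z_def[abs_def] by (rule l(2)) (use p in simp)
      ultimately show "nrm p (Z b) \<le> 1 / t * block_norm p t (twist \<phi>0 s e b) (\<lambda>y. dd \<eta> b y * u y)"
        by (simp only: mult_right_mono nrm_nonneg)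
    qed
    have SZ: "Lp p (\<lambda>x. \<Sum>b\<in>Basis. Z b x)" "nrm p (\<lambda>x. \<Sum>b\<in>Basis. Z b x) \<le> (\<Sum>b\<in>Basis. nrm p (Z b))"
      using Lp_sum[OF p finite_Basis, of Z] Z(1) by auto
    define W where "W x = X x - Y x - (\<Sum>b\<in>Basis. Z b x)" for x
    have W: "Lp p W" unfolding W_def[abs_def] by (intro Lp_diff(1) X Y SZ p)
    have W2: "nrm p W \<le> C / t\<^sup>2 * nrm p u"
      using id[OF t u f ws] by (simp add: W_def[abs_def] X_def Y_def Z_def)
    have "X = (\<lambda>x. (Y x + (\<Sum>b\<in>Basis. Z b x)) + W x)" by (simp add: W_def fun_eq_iff)
    then have "nrm p X \<le> nrm p (\<lambda>x. Y x + (\<Sum>b\<in>Basis. Z b x)) + nrm p W"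
      using Lp_add(2)[OF Lp_add(1)[OF Y(1) SZ(1) p] W p] by simp
    also have "\<dots> \<le> (nrm p Y + (\<Sum>b\<in>Basis. nrm p (Z b))) + C / t\<^sup>2 * nrm p u"
      using Lp_add(2)[OF Y(1) SZ(1) p] SZ(2) W2 by linarith
    also have "\<dots> \<le> nrm p Y + (\<Sum>b\<in>Basis. 1 / t * block_norm p t (twist \<phi>0 s e b) (\<lambda>y. dd \<eta> b y * u y)) + C / t\<^sup>2 * nrm p u"
      by (intro add_mono sum_mono Z(2) order_refl)
    finally show "block_norm p t e (\<lambda>y. \<eta> y * u y)
      \<le> t powr (- 2 * s) * block_norm p t (riesz s e) (\<lambda>y. \<eta> y * f y)
        + (\<Sum>b\<in>Basis. 1 / t * block_norm p t (twist \<phi>0 s e b) (\<lambda>y. dd \<eta> b y * u y))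
        + C / t\<^sup>2 * nrm p u"
      unfolding Y(2) X_def .
  qed
qed

text \<open>Every block on the right is bounded by the \<open>L\<^sup>1\<close> norm of its kernel,
  and \<open>t \<ge> 1\<close> absorbs \<open>1 / t\<^sup>2\<close> into \<open>1 / t\<close>. The
  existential form allows constants to be chosen simultaneously for all directions in the
  bootstrap.\<close>

lemma localised_first_order:
  fixes e \<eta> :: "real^'n \<Rightarrow> real"
  assumes e: "profile e" and \<eta>: "test_fun \<Omega> \<eta>"
  shows "\<exists>C\<ge>0. \<forall>t u f. t \<ge> 1 \<longrightarrow> Lp p u \<longrightarrow> Lp p f \<longrightarrow> weak_sol s \<Omega> u f \<longrightarrow>
      block_norm p t e (\<lambda>y. \<eta> y * u y) \<le> C * (t powr (- 2 * s) * nrm p f + 1 / t * nrm p u)"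
proof (rule localised_reduction[OF e \<eta>])
  fix C :: real
  assume C: "C \<ge> 0" and red:
    "\<And>t u f. t > 0 \<Longrightarrow> Lp p u \<Longrightarrow> Lp p f \<Longrightarrow> weak_sol s \<Omega> u f \<Longrightarrow>
      block_norm p t e (\<lambda>y. \<eta> y * u y)
      \<le> t powr (- 2 * s) * block_norm p t (riesz s e) (\<lambda>y. \<eta> y * f y)
        + (\<Sum>b\<in>Basis. 1 / t * block_norm p t (twist \<phi>0 s e b) (\<lambda>y. dd \<eta> b y * u y))
        + C / t\<^sup>2 * nrm p u"
  have t\<eta>: "tf \<eta>" by (rule tf_UNIV[OF \<eta>])
  have tl: "tf (riesz s e)" and tw: "\<And>b. tf (twist \<phi>0 s e b)"
    using profile_riesz[OF e] profile_twist[OF \<phi>0 s e] by (auto simp: profile_def)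
  obtain H where H: "H \<ge> 0" "\<And>x. \<bar>\<eta> x\<bar> \<le> H" using tf_bounded[OF t\<eta>] by blast
  have "\<exists>H\<ge>0. \<forall>x. \<bar>dd \<eta> b x\<bar> \<le> H" for b using tf_bounded[OF test_fun_dd[OF t\<eta>], of b] by metis
  then obtain D where D: "\<And>b. D b \<ge> 0" "\<And>b x. \<bar>dd \<eta> b x\<bar> \<le> D b" by metis
  define A where "A = (LBINT x. norm (finv (riesz s e) x)) * H"
  define B where "B = (\<Sum>b\<in>Basis. (LBINT x. norm (finv (twist \<phi>0 s e b) x)) * D b)"
  have AB: "A \<ge> 0" "B \<ge> 0" unfolding A_def B_def using H D by (auto intro!: sum_nonneg mult_nonneg_nonneg)
  show ?thesis
  proof (intro exI[of _ "A + B + C"] conjI allI impI)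
    show "0 \<le> A + B + C" using AB C by simp
    fix t :: real and u f :: "real^'n \<Rightarrow> real" assume t: "(1::real) \<le> t" and u: "Lp p u" and f: "Lp p f" and ws: "weak_sol s \<Omega> u f"
    have t0: "t > 0" using t by simp
    have "block_norm p t e (\<lambda>y. \<eta> y * u y)
      \<le> t powr (- 2 * s) * (A * nrm p f)
        + (\<Sum>b\<in>Basis. 1 / t * ((LBINT x. norm (finv (twist \<phi>0 s e b) x)) * D b * nrm p u))
        + C / t\<^sup>2 * nrm p u"
    proof (rule order_trans[OF red[OF t0 u f ws]], intro add_mono sum_mono mult_left_mono order_refl)
      show "block_norm p t (riesz s e) (\<lambda>y. \<eta> y * f y) \<le> A * nrm p f"
        unfolding A_def by (rule conv_cutoff_bound(2)[OF finv_in_L1[OF tl] t0 tf_measurable[OF t\<eta>] H(2) f p])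
      show "block_norm p t (twist \<phi>0 s e b) (\<lambda>y. dd \<eta> b y * u y)
        \<le> (LBINT x. norm (finv (twist \<phi>0 s e b) x)) * D b * nrm p u" for b
        by (rule conv_cutoff_bound(2)[OF finv_in_L1[OF tw] t0 tf_measurable[OF test_fun_dd[OF t\<eta>]] D(2) u p])
    qed (use t0 C in auto)
    also have "(\<Sum>b\<in>Basis. 1 / t * ((LBINT x. norm (finv (twist \<phi>0 s e b) x)) * D b * nrm p u)) = B * (1 / t * nrm p u)"
      unfolding B_def sum_distrib_right by (simp add: mult_ac)
    also have "t powr (- 2 * s) * (A * nrm p f) + B * (1 / t * nrm p u) + C / t\<^sup>2 * nrm p u
       \<le> (A + B + C) * (t powr (- 2 * s) * nrm p f) + B * (1 / t * nrm p u) + (A + C) * (1 / t * nrm p u)"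
    proof -
      have "A * (t powr (- 2 * s) * nrm p f) \<le> (A + B + C) * (t powr (- 2 * s) * nrm p f)"
        using AB C nrm_nonneg[of p f] by (intro mult_right_mono) auto
      moreover have "C / t\<^sup>2 * nrm p u \<le> (A + C) * (1 / t * nrm p u)"
      proof -
        have "C / t\<^sup>2 \<le> C / t" using C t by (intro divide_left_mono) (auto simp: power2_eq_square)
        also have "\<dots> \<le> (A + C) / t" using AB t0 by (intro divide_right_mono) auto
        finally have "C / t\<^sup>2 * nrm p u \<le> (A + C) / t * nrm p u" by (rule mult_right_mono[OF _ nrm_nonneg])
        then show ?thesis by simp
      qed
      ultimately show ?thesis by (simp add: mult_ac)
    qed
    also have "(A + B + C) * (t powr (- 2 * s) * nrm p f) + B * (1 / t * nrm p u) + (A + C) * (1 / t * nrm p u)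
      = (A + B + C) * (t powr (- 2 * s) * nrm p f + 1 / t * nrm p u)"
    proof -
      have "(A + B + C) * X + B * Y + (A + C) * Y = (A + B + C) * (X + Y)" for X Y
        by (simp add: algebra_simps)
      then show ?thesis .
    qed
    finally show "block_norm p t e (\<lambda>y. \<eta> y * u y) \<le> (A + B + C) * (t powr (- 2 * s) * nrm p f + 1 / t * nrm p u)" .
  qed
qed

text \<open>Bootstrap: the first-order commutator terms are again wave packets tested against a cutoff
  of \<open>u\<close>, so the crude estimate applies to them and gains one more power of the frequency.\<close>

lemma localised_second_order:
  fixes e \<eta> :: "real^'n \<Rightarrow> real"
  assumes e: "profile e" and \<eta>: "test_fun \<Omega> \<eta>"
  obtains C where "C \<ge> 0" "\<And>t u f. t \<ge> 1 \<Longrightarrow> Lp p u \<Longrightarrow> Lp p f \<Longrightarrow> weak_sol s \<Omega> u f \<Longrightarrow>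
      block_norm p t e (\<lambda>y. \<eta> y * u y)
      \<le> t powr (- 2 * s) * block_norm p t (riesz s e) (\<lambda>y. \<eta> y * f y)
        + C * (t powr (- 2 * s) / t * nrm p f + 1 / t\<^sup>2 * nrm p u)"
proof (rule localised_reduction[OF e \<eta>])
  fix C :: real
  assume C: "C \<ge> 0" and red:
    "\<And>t u f. t > 0 \<Longrightarrow> Lp p u \<Longrightarrow> Lp p f \<Longrightarrow> weak_sol s \<Omega> u f \<Longrightarrow>
      block_norm p t e (\<lambda>y. \<eta> y * u y)
      \<le> t powr (- 2 * s) * block_norm p t (riesz s e) (\<lambda>y. \<eta> y * f y)
        + (\<Sum>b\<in>Basis. 1 / t * block_norm p t (twist \<phi>0 s e b) (\<lambda>y. dd \<eta> b y * u y))
        + C / t\<^sup>2 * nrm p u"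
  \<comment> \<open>\<open>dd \<eta> b\<close> is again a test function in \<Omega> and
    \<open>twist\<close> again a profile, which is all that the crude estimate requires.\<close>
  have "\<forall>b. \<exists>C\<ge>0. \<forall>t u f. t \<ge> 1 \<longrightarrow> Lp p u \<longrightarrow> Lp p f \<longrightarrow> weak_sol s \<Omega> u f \<longrightarrow>
      block_norm p t (twist \<phi>0 s e b) (\<lambda>y. dd \<eta> b y * u y) \<le> C * (t powr (- 2 * s) * nrm p f + 1 / t * nrm p u)"
    by (intro allI localised_first_order profile_twist[OF \<phi>0 s e] test_fun_dd[OF \<eta>])
  then obtain K where K: "\<And>b. K b \<ge> 0" "\<And>b t u f. t \<ge> 1 \<Longrightarrow> Lp p u \<Longrightarrow> Lp p f \<Longrightarrow> weak_sol s \<Omega> u f \<Longrightarrow>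
      block_norm p t (twist \<phi>0 s e b) (\<lambda>y. dd \<eta> b y * u y) \<le> K b * (t powr (- 2 * s) * nrm p f + 1 / t * nrm p u)"
    unfolding choice_iff by blast
  define S where "S = (\<Sum>b\<in>(Basis :: (real^'n) set). K b)"
  have S: "S \<ge> 0" unfolding S_def by (intro sum_nonneg K)
  show thesis
  proof (rule that[of "S + C"])
    show "0 \<le> S + C" using S C by simp
    fix t :: real and u f :: "real^'n \<Rightarrow> real" assume t: "(1::real) \<le> t" and u: "Lp p u" and f: "Lp p f" and ws: "weak_sol s \<Omega> u f"
    have t0: "t > 0" using t by simp
    define V where "V = t powr (- 2 * s) * nrm p f + 1 / t * nrm p u"
    have "(\<Sum>b\<in>Basis. 1 / t * block_norm p t (twist \<phi>0 s e b) (\<lambda>y. dd \<eta> b y * u y))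
       \<le> (\<Sum>b\<in>(Basis :: (real^'n) set). 1 / t * (K b * V))"
      unfolding V_def by (intro sum_mono mult_left_mono K(2) t u f ws) (use t0 in simp)
    also have "\<dots> = S * (1 / t * V)"
      unfolding S_def sum_distrib_right by (simp add: mult_ac)
    also have "1 / t * V = t powr (- 2 * s) / t * nrm p f + 1 / t\<^sup>2 * nrm p u"
      by (simp add: V_def distrib_left power2_eq_square)
    finally have le: "(\<Sum>b\<in>Basis. 1 / t * block_norm p t (twist \<phi>0 s e b) (\<lambda>y. dd \<eta> b y * u y))
       \<le> S * (t powr (- 2 * s) / t * nrm p f + 1 / t\<^sup>2 * nrm p u)" .
    have "0 \<le> C * (t powr (- 2 * s) / t * nrm p f)" using C t0 nrm_nonneg[of p f] by simp
    moreover have "S * (x + y) + C * y \<le> (S + C) * (x + y)" if "0 \<le> C * x" for x y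
      using that by (simp add: distrib_left distrib_right)
    ultimately have "S * (t powr (- 2 * s) / t * nrm p f + 1 / t\<^sup>2 * nrm p u) + C * (1 / t\<^sup>2 * nrm p u)
      \<le> (S + C) * (t powr (- 2 * s) / t * nrm p f + 1 / t\<^sup>2 * nrm p u)"
      by blast
    moreover have "C / t\<^sup>2 * nrm p u = C * (1 / t\<^sup>2 * nrm p u)" by simp
    ultimately have "S * (t powr (- 2 * s) / t * nrm p f + 1 / t\<^sup>2 * nrm p u) + C / t\<^sup>2 * nrm p u
      \<le> (S + C) * (t powr (- 2 * s) / t * nrm p f + 1 / t\<^sup>2 * nrm p u)"
      by (simp only:)
    then show "block_norm p t e (\<lambda>y. \<eta> y * u y)
      \<le> t powr (- 2 * s) * block_norm p t (riesz s e) (\<lambda>y. \<eta> y * f y)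
        + (S + C) * (t powr (- 2 * s) / t * nrm p f + 1 / t\<^sup>2 * nrm p u)"
      using red[OF t0 u f ws] le by linarith
  qed
qed

text \<open>After multiplication by t^(2s) the main term is a block of \<open>\<eta> * f\<close>,
  whose squares sum by the Littlewood-Paley inequality. The errors are of size 1/t and t^(2s-2),
  hence geometric in \<open>j\<close>.\<close>

lemma dyadic_square_sum:
  fixes \<eta> :: "real^'n \<Rightarrow> real"
  assumes \<eta>: "test_fun \<Omega> \<eta>" and p2: "p \<le> 2"
  obtains C where "C \<ge> 0" "\<And>u f k. Lp p u \<Longrightarrow> Lp p f \<Longrightarrow> weak_sol s \<Omega> u f \<Longrightarrow>
     (\<Sum>j<k. ((2 ^ j) powr (2 * s) * block_norm p (2 ^ j) (annulus \<phi>0) (\<lambda>y. \<eta> y * u y))\<^sup>2)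
     \<le> C * (nrm p f + nrm p u)\<^sup>2"
proof (rule localised_second_order[OF profile_annulus[OF \<phi>0 s] \<eta>])
  let ?e = "annulus \<phi>0"
  fix C :: real
  assume C: "C \<ge> 0" and main: "\<And>t u f. t \<ge> 1 \<Longrightarrow> Lp p u \<Longrightarrow> Lp p f \<Longrightarrow> weak_sol s \<Omega> u f \<Longrightarrow>
      block_norm p t ?e (\<lambda>y. \<eta> y * u y)
      \<le> t powr (- 2 * s) * block_norm p t (riesz s ?e) (\<lambda>y. \<eta> y * f y)
        + C * (t powr (- 2 * s) / t * nrm p f + 1 / t\<^sup>2 * nrm p u)"
  have pl: "profile (riesz s ?e)" by (rule profile_riesz[OF profile_annulus[OF \<phi>0 s]])
  have t\<eta>: "tf \<eta>" by (rule tf_UNIV[OF \<eta>])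
  obtain H where H: "H \<ge> 0" "\<And>x. \<bar>\<eta> x\<bar> \<le> H" using tf_bounded[OF t\<eta>] by blast
  have e1: "tf (riesz s ?e)" using pl by (simp add: profile_def)
  have e2: "1/2 \<le> norm \<xi> \<and> norm \<xi> \<le> 2" if "riesz s ?e \<xi> \<noteq> 0" for \<xi>
  proof -
    have "11/20 \<le> norm \<xi> \<and> norm \<xi> \<le> 19/10" using pl that by (simp add: profile_def)
    then show ?thesis by linarith
  qed
  show thesis
  proof (rule Littlewood_Paley[OF \<phi>0 p p2 e1 e2])
    fix L :: real
    assume L: "L \<ge> 0" and LP: "\<And>F N. Lp p F \<Longrightarrow>
      (\<Sum>j<N. (block_norm p (2 ^ j) (riesz s ?e) (\<lambda>x. F x))\<^sup>2) \<le> L * (nrm p F)\<^sup>2"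
    \<comment> \<open>A common ratio for both errors at \<open>t = 2 ^ j\<close>; it is below 1
      because s < 1.\<close>
    define r where "r = max (1/2) ((2::real) powr (2 * s - 2))"
    have r: "0 < r" "r < 1" using s by (auto simp: r_def powr_less_one)
    define G where "G = 1 / (1 - r\<^sup>2)"
    have r2: "0 \<le> r\<^sup>2" "r\<^sup>2 < 1" using r by (auto simp: power_less_one_iff)
    have G: "G \<ge> 0" "\<And>k. (\<Sum>j<k. (r\<^sup>2) ^ j) \<le> G"
    proof -
      show "G \<ge> 0" using r2 by (simp add: G_def)
      show "(\<Sum>j<k. (r\<^sup>2) ^ j) \<le> G" for k
        unfolding G_def suminf_geometric[of "r\<^sup>2", symmetric] using r2
        by (subst suminf_geometric[symmetric]) (auto intro!: sum_le_suminf summable_geometric)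
    qed
    show thesis
    proof (rule that[of "2 * L * H\<^sup>2 + 2 * C\<^sup>2 * G"])
      show "0 \<le> 2 * L * H\<^sup>2 + 2 * C\<^sup>2 * G" using L G by simp
      fix u f :: "real^'n \<Rightarrow> real" and k :: nat assume u: "Lp p u" and f: "Lp p f" and ws: "weak_sol s \<Omega> u f"
      define U where "U = nrm p f + nrm p u"
      have U: "nrm p f \<le> U" "nrm p u \<le> U" "U \<ge> 0" using nrm_nonneg[of p f] nrm_nonneg[of p u] by (auto simp: U_def)
      let ?x = "\<lambda>j. block_norm p (2 ^ j) ?e (\<lambda>y. \<eta> y * u y)"
      let ?y = "\<lambda>j. block_norm p (2 ^ j) (riesz s ?e) (\<lambda>y. \<eta> y * f y)"
      have pt: "((2 ^ j) powr (2 * s) * ?x j)\<^sup>2 \<le> 2 * (?y j)\<^sup>2 + 2 * C\<^sup>2 * U\<^sup>2 * (r\<^sup>2) ^ j" for j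
      proof -
        define t where "t = (2::real) ^ j"
        have t: "t \<ge> 1" "t > 0" by (auto simp: t_def)
        have "t powr (2 * s) * ?x j \<le> t powr (2 * s) * (t powr (- 2 * s) * ?y j + C * (t powr (- 2 * s) / t * nrm p f + 1 / t\<^sup>2 * nrm p u))"
          unfolding t_def by (intro mult_left_mono main u f ws) auto
        also have "\<dots> = (t powr (2 * s) * t powr (- 2 * s)) * ?y j + C * ((t powr (2 * s) * t powr (- 2 * s)) / t * nrm p f + t powr (2 * s) / t\<^sup>2 * nrm p u)"
          by (simp add: algebra_simps)
        also have "t powr (2 * s) * t powr (- 2 * s) = 1" using t by (simp add: powr_add[symmetric])
        also have "t powr (2 * s) / t\<^sup>2 = t powr (2 * s - 2)" using t by (simp add: powr_diff)
        also have "1 * ?y j + C * (1 / t * nrm p f + t powr (2 * s - 2) * nrm p u) \<le> ?y j + C * (r ^ j * nrm p f + r ^ j * nrm p u)"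
        proof -
          have "1 / t = (1/2) ^ j" by (simp add: t_def power_one_over)
          also have "\<dots> \<le> r ^ j" by (intro power_mono) (auto simp: r_def)
          finally have a: "1 / t \<le> r ^ j" .
          have "t powr (2 * s - 2) = (2 powr (2 * s - 2)) ^ j"
            unfolding t_def by (simp add: powr_realpow[symmetric] powr_powr mult.commute)
          also have "\<dots> \<le> r ^ j" by (intro power_mono) (auto simp: r_def)
          finally have b: "t powr (2 * s - 2) \<le> r ^ j" .
          have "C * (1 / t * nrm p f + t powr (2 * s - 2) * nrm p u) \<le> C * (r ^ j * nrm p f + r ^ j * nrm p u)"
            by (intro mult_left_mono add_mono mult_right_mono a b nrm_nonneg C)
          then show ?thesis by simp
        qed
        also have "?y j + C * (r ^ j * nrm p f + r ^ j * nrm p u) = ?y j + C * U * r ^ j"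
          by (simp add: U_def algebra_simps)
        finally have "(t powr (2 * s) * ?x j)\<^sup>2 \<le> (?y j + C * U * r ^ j)\<^sup>2"
          by (intro power_mono mult_nonneg_nonneg nrm_nonneg) auto
        also have "\<dots> \<le> 2 * (?y j)\<^sup>2 + 2 * (C * U * r ^ j)\<^sup>2"
          using sum_squares_bound[of "?y j" "C * U * r ^ j"] by (simp add: power2_sum)
        also have "(C * U * r ^ j)\<^sup>2 = C\<^sup>2 * U\<^sup>2 * (r\<^sup>2) ^ j"
          by (simp add: power_mult_distrib power_mult[symmetric] mult.commute)
        finally show ?thesis by (simp add: t_def)
      qed
      note gf = Lp_mult_bounded[OF tf_measurable[OF t\<eta>] H(2) f p]
      have "(\<Sum>j<k. ((2 ^ j) powr (2 * s) * ?x j)\<^sup>2) \<le> (\<Sum>j<k. 2 * (?y j)\<^sup>2 + 2 * C\<^sup>2 * U\<^sup>2 * (r\<^sup>2) ^ j)"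
        by (intro sum_mono pt)
      also have "\<dots> = 2 * (\<Sum>j<k. (?y j)\<^sup>2) + 2 * C\<^sup>2 * U\<^sup>2 * (\<Sum>j<k. (r\<^sup>2) ^ j)"
        by (simp add: sum.distrib sum_distrib_left)
      also have "\<dots> \<le> 2 * (L * (H * U)\<^sup>2) + 2 * C\<^sup>2 * U\<^sup>2 * G"
      proof (intro add_mono mult_left_mono G(2))
        have "nrm p (\<lambda>y. \<eta> y * f y) \<le> H * U"
          using gf(2) mult_left_mono[OF U(1) H(1)] by linarith
        then have "(nrm p (\<lambda>y. \<eta> y * f y))\<^sup>2 \<le> (H * U)\<^sup>2" by (intro power_mono nrm_nonneg)
        then show "(\<Sum>j<k. (?y j)\<^sup>2) \<le> L * (H * U)\<^sup>2"
          using LP[OF gf(1), of k] mult_left_mono[OF _ L] by fastforce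
      qed auto
      also have "\<dots> = (2 * L * H\<^sup>2 + 2 * C\<^sup>2 * G) * U\<^sup>2"
        by (simp add: power_mult_distrib algebra_simps)
      finally show "(\<Sum>j<k. ((2 ^ j) powr (2 * s) * ?x j)\<^sup>2) \<le> (2 * L * H\<^sup>2 + 2 * C\<^sup>2 * G) * (nrm p f + nrm p u)\<^sup>2"
        by (simp add: U_def)
    qed
  qed
qed

end

subsection \<open>Translation to the Lebesgue setting\<close>

lemma Lp_imp_Lp_mem:
  fixes g :: "real^'n::finite \<Rightarrow> 'b::{banach, second_countable_topology}"
  assumes "Lp p g"
  shows "Lp_mem p UNIV g" "Lp_norm p UNIV g = nrm p g"
proof -
  have [measurable]: "g \<in> borel_measurable borel" and i: "integrable lborel (\<lambda>x. norm (g x) powr p)"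
    using assms by (auto simp: Lp_def)
  have "integrable lebesgue (\<lambda>x. norm (g x) powr p)"
    using i by (subst integrable_completion) auto
  then show "Lp_mem p UNIV g"
    by (auto simp: Lp_mem_def set_borel_measurable_def set_integrable_def intro!: measurable_completion)
  show "Lp_norm p UNIV g = nrm p g"
    unfolding Lp_norm_def nrm_def set_lebesgue_integral_def
    by (simp add: integral_completion)
qed

text \<open>Extension by zero followed by a Borel modification on a null set. Measurability of the
  extension itself is kept for comparing integrals later.\<close>

lemma Lp_mem_representative:
  fixes f :: "real^'n::finite \<Rightarrow> real"
  assumes "Lp_mem p S f"
  obtains g where "Lp p g" "nrm p g = Lp_norm p S f" "AE x in lborel. indicator S x * f x = g x"
    "(\<lambda>x. indicator S x * f x) \<in> borel_measurable lebesgue"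
proof -
  define f1 where "f1 x = indicator S x * f x" for x
  have m: "f1 \<in> borel_measurable lebesgue" and i: "integrable lebesgue (\<lambda>x. indicator S x * \<bar>f x\<bar> powr p)"
    using assms by (auto simp: Lp_mem_def set_borel_measurable_def set_integrable_def f1_def[abs_def])
  have e: "\<bar>f1 x\<bar> powr p = indicator S x * \<bar>f x\<bar> powr p" for x by (simp add: f1_def indicator_def)
  obtain g where g: "g \<in> borel_measurable lborel" "AE x in lborel. f1 x = g x"
    using completion_ex_borel_measurable_real[OF m] by blast
  have [measurable]: "g \<in> borel_measurable borel" using g(1) by simp
  have ae: "AE x in lebesgue. f1 x = g x" by (rule AE_completion[OF g(2)])
  have ae': "AE x in lebesgue. \<bar>f1 x\<bar> powr p = \<bar>g x\<bar> powr p" using ae by eventually_elim simp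
  have gm: "g \<in> borel_measurable lebesgue" by (rule measurable_completion[OF g(1)])
  have "integrable lebesgue (\<lambda>x. \<bar>g x\<bar> powr p)"
    using i unfolding e[symmetric]
    by (rule integrable_cong_AE_imp) (use ae' m gm in \<open>auto elim!: eventually_mono\<close>)
  then have "integrable lborel (\<lambda>x. \<bar>g x\<bar> powr p)"
    by (subst (asm) integrable_completion) auto
  then have L: "Lp p g" by (simp add: Lp_def)
  have "(LBINT x. \<bar>g x\<bar> powr p) = (\<integral>x. \<bar>g x\<bar> powr p \<partial>lebesgue)"
    by (rule integral_completion[symmetric]) measurable
  also have "\<dots> = (\<integral>x. \<bar>f1 x\<bar> powr p \<partial>lebesgue)"
    by (rule integral_cong_AE) (use ae' m gm in \<open>auto elim!: eventually_mono\<close>)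
  finally have "nrm p g = Lp_norm p S f"
    by (simp add: nrm_def Lp_norm_def set_lebesgue_integral_def e)
  then show thesis using that[OF L] g(2) m by (simp add: f1_def[abs_def])
qed

lemma weak_sol_representative:
  fixes \<Omega> :: "(real^'n::finite) set" and u f g v :: "real^'n \<Rightarrow> real"
  assumes ds: "dist_solution s \<Omega> u f"
    and u: "u \<in> borel_measurable lebesgue" and v: "v \<in> borel_measurable borel" "AE x in lborel. u x = v x"
    and f: "(\<lambda>x. indicator \<Omega> x * f x) \<in> borel_measurable lebesgue" and g: "g \<in> borel_measurable borel" "AE x in lborel. indicator \<Omega> x * f x = g x"
  shows "weak_sol s \<Omega> v g"
  unfolding weak_sol_def
proof (intro allI impI)
  fix \<phi> assume \<phi>: "test_fun \<Omega> \<phi>"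
  note fm = frac_lap_measurable[OF tf_UNIV[OF \<phi>], of s] and pm = tf_measurable[OF tf_UNIV[OF \<phi>]]
  note [measurable] = fm pm v(1) g(1)
  have fm': "frac_lap s \<phi> \<in> borel_measurable lebesgue" and pm': "\<phi> \<in> borel_measurable lebesgue"
    and vm': "v \<in> borel_measurable lebesgue" and gm': "g \<in> borel_measurable lebesgue"
    by (auto intro!: measurable_completion)
  have "(LBINT y. cx (v y) * frac_lap s \<phi> y) = (LINT y|lebesgue. cx (v y) * frac_lap s \<phi> y)"
    by (rule integral_completion[symmetric]) measurable
  also have "\<dots> = (LINT y|lebesgue. cx (u y) * frac_lap s \<phi> y)"
    by (rule integral_cong_AE) (use u vm' fm' AE_completion[OF v(2)] in \<open>auto elim!: eventually_mono\<close>)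
  also have "\<dots> = cx (LINT y:\<Omega>|lebesgue. f y * \<phi> y)"
    using ds \<phi> by (simp add: dist_solution_def)
  also have "(LINT y:\<Omega>|lebesgue. f y * \<phi> y) = (LINT y|lebesgue. (indicator \<Omega> y * f y) * \<phi> y)"
    by (simp add: set_lebesgue_integral_def mult.assoc)
  also have "\<dots> = (LINT y|lebesgue. g y * \<phi> y)"
    by (rule integral_cong_AE) (use f gm' pm' AE_completion[OF g(2)] in \<open>auto elim!: eventually_mono\<close>)
  also have "\<dots> = (LBINT y. g y * \<phi> y)"
    by (rule integral_completion) measurable
  finally show "(LBINT y. cx (v y) * frac_lap s \<phi> y) = cx (LBINT y. g y * \<phi> y)" .
qed

text \<open>The block of index 0 has the full bump as symbol and stands apart; all later ones are
  dilates of a single annulus, in the form used by the block estimates.\<close>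

lemma dyadic_block_conv:
  fixes \<phi>0 w :: "real^'n::finite \<Rightarrow> real"
  assumes \<phi>0: "admissible_phi0 \<phi>0" and [measurable]: "w \<in> borel_measurable borel"
  shows "dyadic_block \<phi>0 0 w = conv (dil 1 (finv \<phi>0)) (\<lambda>y. cx (w y))"
    and "dyadic_block \<phi>0 (Suc j) w = conv (dil (2 ^ Suc j) (finv (annulus \<phi>0))) (\<lambda>y. cx (w y))"
proof -
  have gen: "dyadic_block \<phi>0 j w = conv K (\<lambda>y. cx (w y))"
    if "finv (dyadic \<phi>0 j) = K" and [measurable]: "K \<in> borel_measurable borel" for j K
  proof
    fix x
    have "dyadic_block \<phi>0 j w x = (LINT y|lebesgue. K (x - y) * cx (w y))"
      using that(1) by (simp add: dyadic_block_def finv_def)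
    also have "\<dots> = conv K (\<lambda>y. cx (w y)) x"
      unfolding conv_def by (rule integral_completion) measurable
    finally show "dyadic_block \<phi>0 j w x = conv K (\<lambda>y. cx (w y)) x" .
  qed
  note t0 = admissible_tf[OF \<phi>0]
  have tr: "tf (annulus \<phi>0)" unfolding annulus_def[abs_def] by (intro test_fun_diff tf_scale t0) simp
  note [measurable] = finv_measurable[OF t0] finv_measurable[OF tr]
  have "dyadic \<phi>0 0 = \<phi>0" by (simp add: dyadic_def fun_eq_iff)
  then show "dyadic_block \<phi>0 0 w = conv (dil 1 (finv \<phi>0)) (\<lambda>y. cx (w y))"
    by (intro gen) (simp_all add: dil_def[abs_def])
  have "dyadic \<phi>0 (Suc j) = (\<lambda>\<xi>. annulus \<phi>0 ((1 / 2 ^ Suc j) *\<^sub>R \<xi>))"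
  proof
    fix \<xi> :: "real^'n"
    have "(2::real) powr - real (Suc j) = 1 / 2 ^ Suc j"
      by (simp only: powr_minus_divide powr_realpow zero_less_numeral)
    moreover have "(2::real) powr (1 - real (Suc j)) = 2 * (1 / 2 ^ Suc j)"
      by (simp add: powr_minus_divide powr_realpow)
    ultimately show "dyadic \<phi>0 (Suc j) \<xi> = annulus \<phi>0 ((1 / 2 ^ Suc j) *\<^sub>R \<xi>)"
      by (simp only: dyadic_def annulus_def scaleR_scaleR) simp
  qed
  then have "finv (dyadic \<phi>0 (Suc j)) = dil (2 ^ Suc j) (finv (annulus \<phi>0))"
    using finv_dil[OF tf_integrable[OF tr], of "2 ^ Suc j"] by simp
  then show "dyadic_block \<phi>0 (Suc j) w = conv (dil (2 ^ Suc j) (finv (annulus \<phi>0))) (\<lambda>y. cx (w y))"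
    by (rule gen) measurable
qed

lemma besov_norm_on_le:
  assumes "besov_mem \<phi>0 \<sigma> p q w" "AE x in lebesgue. x \<in> U \<longrightarrow> w x = v x"
  shows "besov_norm_on \<phi>0 \<sigma> p q U v \<le> besov_norm \<phi>0 \<sigma> p q w"
  unfolding besov_norm_on_def
  by (rule cInf_lower) (use assms in \<open>auto intro!: bdd_belowI[of _ 0] simp: besov_norm_def\<close>)

theorem theorem5p5:
  fixes \<Omega> \<Omega>' :: "(real^'n::finite) set" and s p :: real and \<phi>0 :: "real^'n \<Rightarrow> real"
  assumes "open \<Omega>" and "bounded \<Omega>"
    and "open \<Omega>'" and "compact (closure \<Omega>')" and "closure \<Omega>' \<subseteq> \<Omega>"
    and "0 < s" and "s < 1" and "s \<noteq> 1/2"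
    and "1 < p" and "p \<le> 2"
    and "admissible_phi0 \<phi>0"
  shows "\<exists>C>0. \<forall>f u. Lp_mem p \<Omega> f \<and> Lp_mem p UNIV u \<and> dist_solution s \<Omega> u f \<longrightarrow>
            besov_mem_on \<phi>0 (2 * s) p 2 \<Omega>' u
          \<and> besov_norm_on \<phi>0 (2 * s) p 2 \<Omega>' u \<le> C * (Lp_norm p \<Omega> f + Lp_norm p UNIV u)"
proof (rule cutoff_exists[OF assms(11,1,4,5)])
  fix \<eta> :: "real^'n \<Rightarrow> real" assume \<eta>: "test_fun \<Omega> \<eta>" and \<eta>1: "\<And>x. x \<in> closure \<Omega>' \<Longrightarrow> \<eta> x = 1"
  note s = assms(6,7) and p = assms(9,10) and \<phi>0 = assms(11)
  have t\<eta>: "tf \<eta>" by (rule tf_UNIV[OF \<eta>])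
  obtain H where H: "H \<ge> 0" "\<And>x. \<bar>\<eta> x\<bar> \<le> H" using tf_bounded[OF t\<eta>] by blast
  have t0: "tf \<phi>0" by (rule admissible_tf[OF \<phi>0])
  have tr: "tf (annulus \<phi>0)" by (rule annulus_tf[OF \<phi>0 s])
  define A where "A = (LBINT x. norm (finv \<phi>0 x)) * H"
  have A: "A \<ge> 0" using H by (simp add: A_def)
  show ?thesis
  proof (rule dyadic_square_sum[OF \<phi>0 s p(1) \<eta> p(2)])
    fix C :: real
    assume C: "C \<ge> 0" and sq: "\<And>u f k. Lp p u \<Longrightarrow> Lp p f \<Longrightarrow> weak_sol s \<Omega> u f \<Longrightarrow>
     (\<Sum>j<k. ((2 ^ j) powr (2 * s) * block_norm p (2 ^ j) (annulus \<phi>0) (\<lambda>y. \<eta> y * u y))\<^sup>2)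
     \<le> C * (nrm p f + nrm p u)\<^sup>2"
    show ?thesis
    \<comment> \<open>\<open>A\<close> controls the lowest block and \<open>C\<close> the sum over
      the others; the summand 1 makes the constant strictly positive.\<close>
    proof (intro exI[of _ "sqrt (A\<^sup>2 + C + 1)"] conjI allI impI; (elim conjE)?)
      show "0 < sqrt (A\<^sup>2 + C + 1)" using C by (simp add: add_nonneg_pos)
      fix f u :: "real^'n \<Rightarrow> real"
      assume f: "Lp_mem p \<Omega> f" and u: "Lp_mem p UNIV u" and ds: "dist_solution s \<Omega> u f"
      obtain g where g: "Lp p g" "nrm p g = Lp_norm p \<Omega> f" "AE x in lborel. indicator \<Omega> x * f x = g x"
        "(\<lambda>x. indicator \<Omega> x * f x) \<in> borel_measurable lebesgue"
        by (rule Lp_mem_representative[OF f])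
      obtain v where v: "Lp p v" "nrm p v = Lp_norm p UNIV u" "AE x in lborel. indicator UNIV x * u x = v x"
        "(\<lambda>x. indicator UNIV x * u x) \<in> borel_measurable lebesgue"
        by (rule Lp_mem_representative[OF u])
      have ws: "weak_sol s \<Omega> v g"
        by (rule weak_sol_representative[OF ds _ Lp_measurable[OF v(1)] _ g(4) Lp_measurable[OF g(1)] g(3)])
           (use v(3,4) in simp_all)
      \<comment> \<open>The competitor for the infimum: it agrees with \<open>u\<close> almost
        everywhere on \<Omega>', where \<eta> is 1.\<close>
      define w where "w x = \<eta> x * v x" for x
      note Lw = Lp_mult_bounded[OF tf_measurable[OF t\<eta>] H(2) v(1) p(1), folded w_def]
      note [measurable] = Lp_measurable[OF Lw(1)]
      define U where "U = nrm p g + nrm p v"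
      have U: "U \<ge> 0" by (simp add: U_def nrm_nonneg)
      have lp: "Lp p (conv (dil t (finv q)) (\<lambda>y. cx (w y)))" if "t > 0" "tf q" for t q
        unfolding w_def
        by (rule conv_cutoff_bound(1)[OF finv_in_L1[OF that(2)] that(1) tf_measurable[OF t\<eta>] H(2) v(1) p(1)])
      have blk: "Lp p (dyadic_block \<phi>0 j w)" for j
        by (cases j) (simp_all only: dyadic_block_conv[OF \<phi>0 Lp_measurable[OF Lw(1)]], simp_all add: lp t0 tr)
      define a where "a j = (2 powr (real j * (2 * s) * 2)) * Lp_norm p UNIV (dyadic_block \<phi>0 j w) powr 2" for j
      have a0: "a j \<ge> 0" for j by (simp add: a_def)
      have an: "a j = ((2 ^ j) powr (2 * s) * nrm p (dyadic_block \<phi>0 j w))\<^sup>2" for j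
      proof -
        have "2 powr (real j * (2 * s) * 2) = ((2 ^ j) powr (2 * s))\<^sup>2"
          by (simp add: powr_realpow[symmetric] powr_powr power2_eq_square powr_add[symmetric] algebra_simps)
        then show ?thesis
          using nrm_nonneg[of p "dyadic_block \<phi>0 j w"] by (simp add: a_def Lp_imp_Lp_mem(2)[OF blk] power_mult_distrib)
      qed
      have a_first: "a 0 \<le> A\<^sup>2 * U\<^sup>2"
      proof -
        have "nrm p (dyadic_block \<phi>0 0 w) \<le> A * nrm p v"
          unfolding dyadic_block_conv(1)[OF \<phi>0 Lp_measurable[OF Lw(1)]] unfolding w_def A_def
          by (rule conv_cutoff_bound(2)[OF finv_in_L1[OF t0] _ tf_measurable[OF t\<eta>] H(2) v(1) p(1)]) simp
        also have "\<dots> \<le> A * U" using A nrm_nonneg[of p g] by (intro mult_left_mono) (auto simp: U_def)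
        finally have "(nrm p (dyadic_block \<phi>0 0 w))\<^sup>2 \<le> (A * U)\<^sup>2" by (intro power_mono nrm_nonneg)
        then show ?thesis by (simp add: an power_mult_distrib)
      qed
      have part: "(\<Sum>j<k. a j) \<le> (A\<^sup>2 + C) * U\<^sup>2" for k
      proof -
        let ?b = "\<lambda>j. ((2 ^ j) powr (2 * s) * block_norm p (2 ^ j) (annulus \<phi>0) (\<lambda>y. \<eta> y * v y))\<^sup>2"
        have "(\<Sum>j<k. a j) \<le> (\<Sum>j<Suc k. a j)" using a0 by simp
        also have "\<dots> = a 0 + (\<Sum>j<k. a (Suc j))" by (rule sum.lessThan_Suc_shift)
        also have "(\<Sum>j<k. a (Suc j)) = (\<Sum>j<k. ?b (Suc j))"
          by (intro sum.cong refl) (simp only: an dyadic_block_conv(2)[OF \<phi>0 Lp_measurable[OF Lw(1)]] w_def)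
        \<comment> \<open>The annulus at frequency 1 is not among the blocks of the Besov norm;
          adding its nonnegative term completes the sum to the one already estimated.\<close>
        also have "\<dots> \<le> ?b 0 + (\<Sum>j<k. ?b (Suc j))" by simp
        also have "\<dots> = (\<Sum>j<Suc k. ?b j)" by (rule sum.lessThan_Suc_shift[symmetric])
        also have "\<dots> \<le> C * U\<^sup>2" unfolding U_def by (rule sq[OF v(1) g(1) ws])
        finally show ?thesis using a_first by (simp add: distrib_right)
      qed
      have summ: "summable a"
        by (rule bounded_imp_summable[of _ "(A\<^sup>2 + C) * U\<^sup>2"]) (use a0 part[of "Suc _"] in \<open>auto simp: lessThan_Suc_atMost\<close>)
      have mem: "besov_mem \<phi>0 (2 * s) p 2 w"
        using summ Lp_imp_Lp_mem(1)[OF Lw(1)] Lp_imp_Lp_mem(1)[OF blk]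
        by (simp add: besov_mem_def a_def[abs_def])
      have ae: "AE x in lebesgue. x \<in> \<Omega>' \<longrightarrow> w x = u x"
        using AE_completion[OF v(3)]
        by eventually_elim (use \<eta>1 closure_subset in \<open>auto simp: w_def\<close>)
      show "besov_mem_on \<phi>0 (2 * s) p 2 \<Omega>' u"
        using mem ae by (auto simp: besov_mem_on_def)
      have "besov_norm_on \<phi>0 (2 * s) p 2 \<Omega>' u \<le> besov_norm \<phi>0 (2 * s) p 2 w"
        by (rule besov_norm_on_le[OF mem ae])
      also have "\<dots> = sqrt (\<Sum>j. a j)"
        using suminf_nonneg[OF summ a0] by (simp add: besov_norm_def a_def powr_half_sqrt)
      also have "(\<Sum>j. a j) \<le> (A\<^sup>2 + C) * U\<^sup>2"
        by (rule suminf_le_const[OF summ part])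
      then have "sqrt (\<Sum>j. a j) \<le> sqrt ((A\<^sup>2 + C + 1) * U\<^sup>2)"
        by (intro real_sqrt_le_mono) (simp add: distrib_right, use zero_le_power2[of U] in linarith)
      also have "\<dots> = sqrt (A\<^sup>2 + C + 1) * U" using U by (simp add: real_sqrt_mult)
      finally show "besov_norm_on \<phi>0 (2 * s) p 2 \<Omega>' u \<le> sqrt (A\<^sup>2 + C + 1) * (Lp_norm p \<Omega> f + Lp_norm p UNIV u)"
        by (simp add: U_def g(2) v(2))
    qed
  qed
qed

end
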